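(* Let $\mu$ be a self-similar measure associated with an IFS of finite type. If $x$ is a periodic point with period $\theta$ of period length $\beta$, then the local dimension of $\mu$ at $x$ exists and is given by $$\dim_{loc}\mu(x)=\frac{\log sp(T(\theta))}{\beta\log r_{\min}},$$ where, if $x$ is a boundary point of a net interval with two different standard symbolic representations given by periods $\theta$ and $\theta'$ of length $\beta=\lambda$, then $\theta$ is chosen to satisfy $sp(T(\theta))\ge sp(T(\theta'))$. Here $sp$ denotes the spectral radius.
   Context: Let $S_j(x)=r_jx+d_j:\mathbb R\to\mathbb R$, $j=0,\dots,k$, with $k\ge 1$ and $0<|r_j|<1$ ($r_j$ may be negative), be an iterated function system (IFS). Let $K$ be its self-similar set, i.e. the unique non-empty compact set with $K=\bigcup_{j=0}^kS_j(K)$; it is assumed throughout that the convex hull of $K$ is $[0,1]$. Given probabilities $p_j>0$ with $\sum_{j=0}^kp_j=1$, the associated self-similar measure $\mu$ is the unique Borel probability measure with $\mu=\sum_{j=0}^kp_j\,\mu\circ S_j^{-1}$; its support is $K$. $\dim_{loc}\mu(x)=\lim_{r\to0^+}\frac{\log\mu([x-r,x+r])}{\log r}$ when the limit exists. $\Sigma$ is the set of finite words on $\{0,\dots,k\}$. For $\sigma=(\sigma_1,\dots,\sigma_j)$ put $\sigma^-=(\sigma_1,\dots,\sigma_{j-1})$, $S_\sigma=S_{\sigma_1}\circ\cdots\circ S_{\sigma_j}$, $r_\sigma=\prod_i r_{\sigma_i}$, $p_\sigma=\prod_ip_{\sigma_i}$ (for the empty word, $S_\sigma=\mathrm{id}$,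 $r_\sigma=p_\sigma=1$). Put $r_{\min}=\min_j|r_j|$, $\Lambda_n=\{\sigma\in\Sigma: |r_\sigma|\le r_{\min}^n \text{ and } |r_{\sigma^-}|>r_{\min}^n\}$ for $n\ge 1$, and $\Lambda_0=\{\text{empty word}\}$. Finite type: $\sigma,\tau\in\Lambda_n$ are neighbours if $S_\sigma(0,1)\cap S_\tau(0,1)\ne\emptyset$; $\mathcal N(\sigma)$ is the set of all neighbours of $\sigma$. Words $\sigma\in\Lambda_n$ and $\tau\in\Lambda_m$ have the same neighbourhood type if there is a map $f(x)=\pm r_{\min}^{m-n}x+c$ with $\{f\circ S_\eta:\eta\in\mathcal N(\sigma)\}=\{S_\nu:\nu\in\mathcal N(\tau)\}$ and $f\circ S_\sigma=S_\tau$. The IFS is of finite type if there are only finitely many neighbourhood types. Net intervals: for $n\ge1$ let $h_1<\dots<h_{s_n}$ be the elements of $\{S_\sigma(0),S_\sigma(1):\sigma\in\Lambda_n\}$ in increasing order, and $\mathcal F_n=\{[h_j,h_{j+1}]: 1\le j\le s_n-1,\ (h_j,h_{j+1})\cap K\ne\emptyset\}$; $\mathcal F_0=\{[0,1]\}$. Elements of $\mathcal F_n$ are net intervals of generation $n$. For $n\ge 1$ each $\Delta\in\mathcal F_n$ is contained in a unique $\widehat\Delta\in\mathcal F_{n-1}$, its parent; $\Delta$ is a child of $\widehat\Delta$. For $\Delta=[a,b]\in\mathcal F_n$: the normalized length is $\ell_n(\Delta)=r_{\min}^{-n}(b-a)$. The neighbour set $V_n(\Delta)=((a_1,L_1),\dots,(a_j,L_j))$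 is the tuple of all distinct pairs $(a_i,L_i)=(r_{\min}^{-n}(a-S_\sigma(0)),\,r_{\min}^{-n}r_\sigma)$ with $\sigma\in\Lambda_n$ and $S_\sigma[0,1]\supseteq\Delta$, ordered so that $a_i\le a_{i+1}$ and, if $a_i=a_{i+1}$, $L_i<L_{i+1}$. For $n\ge1$, if $\Delta_1,\dots,\Delta_t,\dots$ are, from left to right, the children of $\widehat\Delta$ having the same normalized length and neighbour set as $\Delta$, then $t_n(\Delta)$ is the index $t$ with $\Delta_t=\Delta$. The characteristic vector of $\Delta$ is $\mathcal C_n(\Delta)=(\ell_n(\Delta),V_n(\Delta),t_n(\Delta))$; that of $[0,1]$ is $(1,((0,1)),1)$. The characteristic vectors of the children of $\Delta$ depend only on the characteristic vector of $\Delta$, and for a finite type IFS there are finitely many characteristic vectors. Symbolic representations: for $\Delta\in\mathcal F_n$ it is $(\mathcal C_0(\Delta_0),\dots,\mathcal C_n(\Delta_n))$ with $\Delta_0=[0,1]$, $\Delta_n=\Delta$ and $\Delta_{j-1}$ the parent of $\Delta_j$. A symbolic representation of a point $x$ is a sequence $[x]=(\mathcal C_0(\Delta_0),\mathcal C_1(\Delta_1),\dots)$ with $x\in\Delta_n\in\mathcal F_n$ for all $n$ and $\Delta_{j-1}$ the parent of $\Delta_j$. It is unique unless $x$ is an endpoint of a net interval (a boundary point), in which case there can be two. Transition matrices: let $\Delta=[a,b]\in\mathcal F_n$ have parent $\widehat\Delta=[c,d]\in\mathcal F_{n-1}$, with $V_n(\Delta)=((a_j,L_j))_{j=1}^I$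 and $V_{n-1}(\widehat\Delta)=((c_i,M_i))_{i=1}^J$. The primitive transition matrix $T(\mathcal C_{n-1}(\widehat\Delta),\mathcal C_n(\Delta))$ is the $J\times I$ matrix with entries $T_{ij}=\sum_{\omega}p_\omega$, where, having chosen $\sigma_i\in\Lambda_{n-1}$ with $r_{\min}^{-n+1}(c-S_{\sigma_i}(0))=c_i$ and $r_{\min}^{-n+1}r_{\sigma_i}=M_i$, the sum is over all $\omega$ with $\sigma_i\omega\in\Lambda_n$, $r_{\min}^{-n}(a-S_{\sigma_i\omega}(0))=a_j$ and $r_{\min}^{-n}r_{\sigma_i\omega}=L_j$ (empty sum $=0$; independent of the choice of $\sigma_i$). Put $T(\gamma_0,\dots,\gamma_n)=T(\gamma_0,\gamma_1)\cdots T(\gamma_{n-1},\gamma_n)$. Periodic points: a cycle is $\theta=(\theta_1,\dots,\theta_s,\theta_1)$ (a path of characteristic vectors, each a child of the previous one, with the same first and last letter), its length is $s$, and $\theta^-=(\theta_1,\dots,\theta_s)$. A periodic point is a point $x$ with a symbolic representation of the form $(\gamma_0,\dots,\gamma_J,\theta^-,\theta^-,\dots)$ for some cycle $\theta$, called a period of $x$ (not unique). $T(\theta)$ is a square matrix. Standard symbolic representations: every boundary point is periodic, and only finitely many periods of minimal length are associated with boundary points; $\lambda$ is the least common multiple of these minimal lengths. When a boundary point $x$ has two symbolic representations, they can be written $(\gamma_0,\dots,\gamma_J,\psi,\theta^-,\theta^-,\dots)$ and $(\gamma_0,\dots,\gamma_J,\psi',\theta'^-,\theta'^-,\dots)$,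 where $(\gamma_0,\dots,\gamma_J)$ is the symbolic representation of the highest generation net interval containing $x$ as an interior point. The lengths of the preperiods $\psi,\psi'$ of minimal length are bounded over all boundary points by a constant $\kappa$; by lengthening $\psi,\psi'$ and cyclically shifting $\theta,\theta'$ one may take $\psi,\psi'$ to have length exactly $\kappa$ and $\theta,\theta'$ to have length exactly $\lambda$. The two representations so written are the standard symbolic representations of $x$. *)

theory Defs
  imports
    "HOL-Probability.Probability"
    "HOL-Library.Stream"
    "Jordan_Normal_Form.Spectral_Radius"
begin

definition has_local_dim :: "real measure \<Rightarrow> real \<Rightarrow> real \<Rightarrow> bool" where
  "has_local_dim \<mu> x D \<longleftrightarrow>
     ((\<lambda>\<rho>. ln (measure \<mu> {x - \<rho>..x + \<rho>}) / ln \<rho>) \<longlongrightarrow> D) (at_right 0)"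

definition sp :: "real mat \<Rightarrow> real" where
  "sp A = spectral_radius (map_mat complex_of_real A)"

text \<open>Intervals $[a,b]$ are represented by the pair $(a,b)$ of their endpoints. A characteristic
  vector is the triple of normalized length, neighbour set (an ordered tuple, hence a list) and
  index.\<close>

type_synonym ivl = "real \<times> real"
type_synonym char_vec = "real \<times> (real \<times> real) list \<times> nat"

definition lex_less :: "real \<times> real \<Rightarrow> real \<times> real \<Rightarrow> bool" where
  "lex_less u v \<longleftrightarrow> fst u < fst v \<or> fst u = fst v \<and> snd u < snd v"

text \<open>The assumptions on \<open>K\<close> determine it uniquely (as the attractor), and likewise those on
  \<open>\<mu>\<close> below.\<close>

locale ifs =
  fixes k :: nat and r d :: "nat \<Rightarrow> real" and K :: "real set"
  assumes k_ge_1: "k \<ge> 1"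
    and ratio_pos: "\<And>j. j \<le> k \<Longrightarrow> 0 < \<bar>r j\<bar>"
    and ratio_less_1: "\<And>j. j \<le> k \<Longrightarrow> \<bar>r j\<bar> < 1"
    and K_compact: "compact K"
    and K_nonempty: "K \<noteq> {}"
    and K_self_similar: "K = (\<Union>j\<le>k. (\<lambda>x. r j * x + d j) ` K)"
    and K_hull: "convex hull K = {0..1}"
begin

definition S :: "nat list \<Rightarrow> real \<Rightarrow> real" where
  "S \<sigma> = foldr (\<lambda>j f. (\<lambda>x. r j * x + d j) \<circ> f) \<sigma> id"

definition ratio :: "nat list \<Rightarrow> real" where
  "ratio \<sigma> = prod_list (map r \<sigma>)"

definition r_min :: real where
  "r_min = Min ((\<lambda>j. \<bar>r j\<bar>) ` {..k})"

definition \<Lambda> :: "nat \<Rightarrow> nat list set" where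
  "\<Lambda> n = (if n = 0 then {[]} else
     {\<sigma>. set \<sigma> \<subseteq> {..k} \<and> \<bar>ratio \<sigma>\<bar> \<le> r_min ^ n \<and> \<bar>ratio (butlast \<sigma>)\<bar> > r_min ^ n})"

definition neighbours :: "nat \<Rightarrow> nat list \<Rightarrow> nat list set" where
  "neighbours n \<sigma> = {\<tau> \<in> \<Lambda> n. S \<sigma> ` {0<..<1} \<inter> S \<tau> ` {0<..<1} \<noteq> {}}"

definition same_nbhd_type :: "((nat \<times> nat list) \<times> (nat \<times> nat list)) set" where
  "same_nbhd_type = {((n, \<sigma>), (m, \<tau>)). \<sigma> \<in> \<Lambda> n \<and> \<tau> \<in> \<Lambda> m \<and>
     (\<exists>s c. s \<in> {1, - 1} \<and>
        (let f = (\<lambda>x. s * r_min powi (int m - int n) * x + c) in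
           (\<lambda>\<eta>. f \<circ> S \<eta>) ` neighbours n \<sigma> = S ` neighbours m \<tau> \<and> f \<circ> S \<sigma> = S \<tau>))}"

definition finite_type :: bool where
  "finite_type \<longleftrightarrow> finite ((SIGMA n:UNIV. \<Lambda> n) // same_nbhd_type)"

definition net_points :: "nat \<Rightarrow> real set" where
  "net_points n = (\<lambda>\<sigma>. S \<sigma> 0) ` \<Lambda> n \<union> (\<lambda>\<sigma>. S \<sigma> 1) ` \<Lambda> n"

definition net_intervals :: "nat \<Rightarrow> ivl set" where
  "net_intervals n = (if n = 0 then {(0, 1)} else
     {(a, b). a \<in> net_points n \<and> b \<in> net_points n \<and> a < b \<and>
        {a<..<b} \<inter> net_points n = {} \<and> {a<..<b} \<inter> K \<noteq> {}})"

definition children :: "nat \<Rightarrow> ivl \<Rightarrow> ivl set" where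
  "children n D = {\<Delta> \<in> net_intervals (Suc n). {fst \<Delta>..snd \<Delta>} \<subseteq> {fst D..snd D}}"

definition parent :: "nat \<Rightarrow> ivl \<Rightarrow> ivl" where
  "parent n \<Delta> = (THE D. D \<in> net_intervals n \<and> \<Delta> \<in> children n D)"

definition norm_length :: "nat \<Rightarrow> ivl \<Rightarrow> real" where
  "norm_length n \<Delta> = (snd \<Delta> - fst \<Delta>) / r_min ^ n"

definition nbr :: "nat \<Rightarrow> ivl \<Rightarrow> nat list \<Rightarrow> real \<times> real" where
  "nbr n \<Delta> \<sigma> = ((fst \<Delta> - S \<sigma> 0) / r_min ^ n, ratio \<sigma> / r_min ^ n)"

definition nbr_set :: "nat \<Rightarrow> ivl \<Rightarrow> (real \<times> real) list" where
  "nbr_set n \<Delta> = (THE xs. sorted_wrt lex_less xs \<and>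
     set xs = nbr n \<Delta> ` {\<sigma> \<in> \<Lambda> n. {fst \<Delta>..snd \<Delta>} \<subseteq> S \<sigma> ` {0..1}})"

text \<open>The index is the position of \<open>\<Delta>\<close>, from left to right and starting with 1, among the
  similar children of its parent: the number of those not to the right of \<open>\<Delta>\<close>.\<close>

definition sibling_index :: "nat \<Rightarrow> ivl \<Rightarrow> nat" where
  "sibling_index n \<Delta> = (case n of 0 \<Rightarrow> 1 | Suc m \<Rightarrow>
     card {\<Delta>' \<in> children m (parent m \<Delta>).
       norm_length n \<Delta>' = norm_length n \<Delta> \<and> nbr_set n \<Delta>' = nbr_set n \<Delta> \<and> fst \<Delta>' \<le> fst \<Delta>})"

definition charvec :: "nat \<Rightarrow> ivl \<Rightarrow> char_vec" where
  "charvec n \<Delta> = (norm_length n \<Delta>, nbr_set n \<Delta>, sibling_index n \<Delta>)"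

definition ivl_symbolic_rep :: "nat \<Rightarrow> ivl \<Rightarrow> char_vec list \<Rightarrow> bool" where
  "ivl_symbolic_rep n \<Delta> \<gamma> \<longleftrightarrow> (\<exists>D. D 0 = (0, 1) \<and> D n = \<Delta> \<and>
     (\<forall>i<n. D (Suc i) \<in> children i (D i)) \<and> \<gamma> = map (\<lambda>i. charvec i (D i)) [0..<Suc n])"

definition symbolic_rep :: "real \<Rightarrow> char_vec stream \<Rightarrow> bool" where
  "symbolic_rep x \<rho> \<longleftrightarrow> (\<exists>D. D 0 = (0, 1) \<and>
     (\<forall>n. D (Suc n) \<in> children n (D n)) \<and>
     (\<forall>n. x \<in> {fst (D n)..snd (D n)} \<and> \<rho> !! n = charvec n (D n)))"

definition boundary_point :: "real \<Rightarrow> bool" where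
  "boundary_point x \<longleftrightarrow> (\<exists>n. \<exists>\<Delta>\<in>net_intervals n. x = fst \<Delta> \<or> x = snd \<Delta>)"

definition child_vec :: "char_vec \<Rightarrow> char_vec \<Rightarrow> bool" where
  "child_vec \<gamma> \<gamma>' \<longleftrightarrow> (\<exists>n. \<exists>D\<in>net_intervals n. \<exists>\<Delta>\<in>children n D.
     \<gamma> = charvec n D \<and> \<gamma>' = charvec (Suc n) \<Delta>)"

text \<open>A cycle lists its first vector again at the end, so its length as a cycle is
  \<open>length \<theta> - 1\<close>, and \<open>butlast \<theta>\<close> is $\theta^-$.\<close>

definition is_cycle :: "char_vec list \<Rightarrow> bool" where
  "is_cycle \<theta> \<longleftrightarrow> length \<theta> \<ge> 2 \<and> hd \<theta> = last \<theta> \<and> successively child_vec \<theta>"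

definition has_period :: "real \<Rightarrow> char_vec list \<Rightarrow> bool" where
  "has_period x \<theta> \<longleftrightarrow> is_cycle \<theta> \<and>
     (\<exists>\<gamma>. \<gamma> \<noteq> [] \<and> symbolic_rep x (\<gamma> @- cycle (butlast \<theta>)))"

definition min_period_length :: "char_vec stream \<Rightarrow> nat" where
  "min_period_length \<rho> = (LEAST s. \<exists>\<gamma> \<theta>. \<gamma> \<noteq> [] \<and> is_cycle \<theta> \<and> length \<theta> - 1 = s \<and>
     \<rho> = \<gamma> @- cycle (butlast \<theta>))"

text \<open>The number $\lambda$; every symbolic representation of a boundary point contributes the
  minimal length of its own periods.\<close>

definition std_period_length :: nat where
  "std_period_length = Lcm {min_period_length \<rho> |x \<rho>. boundary_point x \<and> symbolic_rep x \<rho>}"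

definition interior_rep :: "real \<Rightarrow> char_vec list \<Rightarrow> bool" where
  "interior_rep x \<gamma> \<longleftrightarrow> (\<exists>n. \<exists>\<Delta>\<in>net_intervals n. x \<in> {fst \<Delta><..<snd \<Delta>} \<and>
     (\<forall>m>n. \<forall>\<Delta>'\<in>net_intervals m. x \<notin> {fst \<Delta>'<..<snd \<Delta>'}) \<and> ivl_symbolic_rep n \<Delta> \<gamma>)"

definition min_preperiod_length :: "char_vec list \<Rightarrow> char_vec stream \<Rightarrow> nat" where
  "min_preperiod_length \<gamma> \<rho> = (LEAST l. \<exists>\<psi> \<theta>. length \<psi> = l \<and> is_cycle \<theta> \<and>
     \<rho> = (\<gamma> @ \<psi>) @- cycle (butlast \<theta>))"

text \<open>The constant $\kappa$ is only required to be some common bound.\<close>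

definition preperiod_bound :: "nat \<Rightarrow> bool" where
  "preperiod_bound \<kappa> \<longleftrightarrow> (\<forall>x \<rho> \<rho>' \<gamma>.
     boundary_point x \<and> symbolic_rep x \<rho> \<and> symbolic_rep x \<rho>' \<and> \<rho> \<noteq> \<rho>' \<and> interior_rep x \<gamma>
     \<longrightarrow> min_preperiod_length \<gamma> \<rho> \<le> \<kappa>)"

text \<open>\<open>standard_periods \<kappa> x \<theta> \<theta>'\<close>: the boundary point \<open>x\<close> has two different standard symbolic
  representations, with periods \<open>\<theta>\<close> and \<open>\<theta>'\<close>.\<close>

definition standard_periods :: "nat \<Rightarrow> real \<Rightarrow> char_vec list \<Rightarrow> char_vec list \<Rightarrow> bool" where
  "standard_periods \<kappa> x \<theta> \<theta>' \<longleftrightarrow> boundary_point x \<and>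
     is_cycle \<theta> \<and> length \<theta> - 1 = std_period_length \<and>
     is_cycle \<theta>' \<and> length \<theta>' - 1 = std_period_length \<and>
     (\<exists>\<gamma> \<psi> \<psi>'. interior_rep x \<gamma> \<and> length \<psi> = \<kappa> \<and> length \<psi>' = \<kappa> \<and>
        symbolic_rep x ((\<gamma> @ \<psi>) @- cycle (butlast \<theta>)) \<and>
        symbolic_rep x ((\<gamma> @ \<psi>') @- cycle (butlast \<theta>')) \<and>
        (\<gamma> @ \<psi>) @- cycle (butlast \<theta>) \<noteq> (\<gamma> @ \<psi>') @- cycle (butlast \<theta>'))"

end

locale self_similar_measure = ifs +
  fixes p :: "nat \<Rightarrow> real" and \<mu> :: "real measure"
  assumes p_pos: "\<And>j. j \<le> k \<Longrightarrow> p j > 0"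
    and p_sum: "(\<Sum>j\<le>k. p j) = 1"
    and mu_prob: "prob_space \<mu>"
    and mu_borel: "sets \<mu> = sets borel"
    and mu_self_similar: "\<And>A. A \<in> sets borel \<Longrightarrow>
      measure \<mu> A = (\<Sum>j\<le>k. p j * measure \<mu> ((\<lambda>x. r j * x + d j) -` A))"
begin

text \<open>The matrix $T$ for a net interval \<open>D\<close> of generation \<open>n\<close> and a child \<open>\<Delta>\<close> of it.\<close>

definition ivl_trans_mat :: "nat \<Rightarrow> ivl \<Rightarrow> ivl \<Rightarrow> real mat" where
  "ivl_trans_mat n D \<Delta> = mat (length (nbr_set n D)) (length (nbr_set (Suc n) \<Delta>)) (\<lambda>(i, j).
     let \<sigma> = (SOME \<sigma>. \<sigma> \<in> \<Lambda> n \<and> nbr n D \<sigma> = nbr_set n D ! i) in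
       \<Sum>\<omega> | \<sigma> @ \<omega> \<in> \<Lambda> (Suc n) \<and> nbr (Suc n) \<Delta> (\<sigma> @ \<omega>) = nbr_set (Suc n) \<Delta> ! j.
         prod_list (map p \<omega>))"

text \<open>It depends only on the two characteristic vectors, so any pair of intervals having these
  may be used.\<close>

definition trans_mat :: "char_vec \<Rightarrow> char_vec \<Rightarrow> real mat" where
  "trans_mat \<gamma> \<gamma>' = (SOME M. \<exists>n. \<exists>D\<in>net_intervals n. \<exists>\<Delta>\<in>children n D.
     \<gamma> = charvec n D \<and> \<gamma>' = charvec (Suc n) \<Delta> \<and> M = ivl_trans_mat n D \<Delta>)"

fun path_mat :: "char_vec list \<Rightarrow> real mat" where
  "path_mat (\<gamma> # \<gamma>' # \<gamma>'' # \<gamma>s) = trans_mat \<gamma> \<gamma>' * path_mat (\<gamma>' # \<gamma>'' # \<gamma>s)"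
| "path_mat [\<gamma>, \<gamma>'] = trans_mat \<gamma> \<gamma>'"
| "path_mat [\<gamma>] = 1\<^sub>m (length (fst (snd \<gamma>)))"
| "path_mat [] = 1\<^sub>m 0"

end

end

theory Submission
  imports Defs
begin

text \<open>Let \<open>D 0, D 1, \<dots>\<close> be the net intervals of a symbolic representation of \<open>x\<close> that repeats with
  period \<open>s\<close> from generation \<open>n0\<close> on, and let \<open>T\<close> be the matrix of the period. Two facts give the local
  dimension.

  The first is geometric. A characteristic vector determines its net interval, with everything that
  later generations see of it, up to an increasing similarity (\<open>xfer_charvec\<close>, \<open>child_determined\<close>). So
  the path below \<open>D n0\<close> is carried to the path below \<open>D (n0 + s)\<close> by a similarity of ratio
  \<open>r_min ^ s\<close>, which must fix \<open>x\<close>. Hence the distances from \<open>x\<close> to the ends of \<open>D (n0 + m * s)\<close> are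
  exactly \<open>r_min ^ (m * s)\<close> times those for \<open>m = 0\<close> (\<open>periodic_path_geometry\<close>), and balls around \<open>x\<close> can
  be compared with these intervals.

  The second is about mass. For \<open>A\<close> inside a net interval, collect the numbers \<open>\<mu> (S\<^sub>\<sigma>\<^sup>-\<^sup>1 A)\<close>, one for
  each member of the neighbour set, in a vector. The mass of \<open>A\<close> is comparable to this vector
  (\<open>mu_comparable\<close>), and passing to the parent multiplies it by the transition matrix (\<open>wvec_step\<close>).
  Therefore \<open>\<mu> (D (n0 + m * s))\<close> behaves like \<open>T ^ m w\<close> with a fixed vector \<open>w\<close>. A neighbour may cover
  an interval although its part of \<open>K\<close> misses the inside, so \<open>w\<close> can have zero entries. They do no
  harm: if a row of a high power of \<open>T\<close> is not zero, then the copy of \<open>K\<close> of that row contains a copy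
  shorter than the interval that still covers a later one, so an end of this smaller copy lies
  inside the interval and the entry of \<open>w\<close> is positive (\<open>wvec_pos\<close>). It follows that \<open>T ^ m w\<close> grows
  like \<open>sp T ^ m\<close>, up to subexponential factors (\<open>pow_mat_vec_growth\<close>).

  If only one net interval matters near \<open>x\<close>, this is the claim. Otherwise \<open>x\<close> is an end of two net
  intervals in every late generation, the mass of a ball is the sum of two contributions, and the
  larger spectral radius wins (\<open>local_dim_two_paths\<close>). In that case the period is prescribed only
  for points that have standard representations, so these have to be constructed
  (\<open>standard_periods_exist\<close>). The point there is that the common period, a least common multiple,
  is not the value 0 that an infinite set would give: a finite type system has
  finitely many characteristic vectors (\<open>finite_charvecs\<close>), and at a boundary point each of them
  determines the next one, so the minimal periods are bounded by their number.\<close>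

section \<open>Growth of powers of a nonnegative matrix\<close>

unbundle no vec_syntax

lemma mult_mat_vec_sum:
  assumes "A \<in> carrier_mat nr nc" "v \<in> carrier_vec nc" "i < nr"
  shows "(A *\<^sub>v v) $ i = (\<Sum>j<nc. A $$ (i, j) * v $ j)"
  using assms by (simp add: mult_mat_vec_def scalar_prod_def atLeast0LessThan)

lemma index_mult_mat_sum:
  assumes "A \<in> carrier_mat nr n" "B \<in> carrier_mat n nc" "i < nr" "j < nc"
  shows "(A * B) $$ (i, j) = (\<Sum>l<n. A $$ (i, l) * B $$ (l, j))"
  using assms by (simp add: scalar_prod_def atLeast0LessThan)

lemma pow_mat_add:
  fixes A :: "'a :: semiring_1 mat"
  assumes "A \<in> carrier_mat n n"
  shows "A ^\<^sub>m (k + l) = A ^\<^sub>m k * A ^\<^sub>m l"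
proof (induction l)
  case 0
  then show ?case using assms by (simp add: pow_carrier_mat[OF assms] right_mult_one_mat[OF pow_carrier_mat[OF assms]])
next
  case (Suc l)
  then show ?case
    using assoc_mult_mat[OF pow_carrier_mat[OF assms] pow_carrier_mat[OF assms] assms] by simp
qed

lemma pow_mat_Suc_vec:
  fixes A :: "'a :: semiring_1 mat"
  assumes "A \<in> carrier_mat n n" "v \<in> carrier_vec n"
  shows "A ^\<^sub>m Suc m *\<^sub>v v = A *\<^sub>v (A ^\<^sub>m m *\<^sub>v v)"
  using pow_mat_add[OF assms(1), of 1 m] assms assoc_mult_mat_vec[OF assms(1) pow_carrier_mat[OF assms(1)] assms(2)]
  by simp

lemma smult_pow_mat:
  fixes A :: "'a :: comm_semiring_1 mat"
  assumes "A \<in> carrier_mat n n"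
  shows "(c \<cdot>\<^sub>m A) ^\<^sub>m k = c ^ k \<cdot>\<^sub>m (A ^\<^sub>m k)"
proof (induction k)
  case (Suc k)
  have "(c ^ k \<cdot>\<^sub>m (A ^\<^sub>m k)) * (c \<cdot>\<^sub>m A) = c ^ k \<cdot>\<^sub>m (A ^\<^sub>m k * (c \<cdot>\<^sub>m A))"
    using assms by (intro mult_smult_assoc_mat) auto
  also have "\<dots> = c ^ k \<cdot>\<^sub>m (c \<cdot>\<^sub>m (A ^\<^sub>m k * A))"
    using mult_smult_distrib[OF pow_carrier_mat[OF assms] assms] by simp
  also have "\<dots> = c ^ Suc k \<cdot>\<^sub>m (A ^\<^sub>m k * A)" by (rule eq_matI) (simp_all add: ac_simps)
  finally show ?case using Suc by simp
qed (use assms in auto)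

text \<open>Rescaling by \<open>\<rho>\<close> makes the spectral radius smaller than 1, so that the powers stay bounded.\<close>

lemma pow_mat_le_geometric:
  fixes T :: "real mat"
  assumes T: "T \<in> carrier_mat n n" and n: "0 < n" and \<rho>: "sp T < \<rho>"
  shows "\<exists>C>0. \<forall>m. \<forall>i<n. \<forall>j<n. \<bar>(T ^\<^sub>m m) $$ (i, j)\<bar> \<le> C * \<rho> ^ m"
proof -
  let ?A = "map_mat complex_of_real T"
  have A: "?A \<in> carrier_mat n n" using T by simp
  have "0 \<le> sp T"
  proof -
    obtain v where "v \<in> spectrum ?A" "spectral_radius ?A = norm v"
      using spectral_radius_mem_max(1)[OF A n] by auto
    then show ?thesis by (simp add: sp_def)
  qed
  then have \<rho>0: "0 < \<rho>" using \<rho> by simp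
  let ?c = "complex_of_real (1 / \<rho>)"
  let ?B = "?c \<cdot>\<^sub>m ?A"
  have B: "?B \<in> carrier_mat n n" using A by simp
  have "spectral_radius ?B < 1"
  proof -
    obtain e where e: "e \<in> spectrum ?B" "spectral_radius ?B = norm e"
      using spectral_radius_mem_max(1)[OF B n] by auto
    then obtain v where v: "v \<in> carrier_vec n" "v \<noteq> 0\<^sub>v n" "?B *\<^sub>v v = e \<cdot>\<^sub>v v"
      using B by (auto simp: spectrum_def eigenvalue_def eigenvector_def)
    have "?A *\<^sub>v v = (complex_of_real \<rho> * e) \<cdot>\<^sub>v v"
    proof -
      have "complex_of_real \<rho> \<cdot>\<^sub>v (?B *\<^sub>v v) = ?A *\<^sub>v v"
        using \<rho>0 v(1) T by (intro eq_vecI) (auto simp: mult_mat_vec_def scalar_prod_def sum_distrib_left field_simps)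
      then show ?thesis using v(3) by (simp add: smult_smult_assoc)
    qed
    then have "complex_of_real \<rho> * e \<in> spectrum ?A"
      using v A by (auto simp: spectrum_def eigenvalue_def eigenvector_def)
    then have "norm (complex_of_real \<rho> * e) \<le> sp T"
      using spectral_radius_mem_max(2)[OF A n] by (simp add: sp_def)
    then have "\<rho> * norm e \<le> sp T" using \<rho>0 by (simp add: norm_mult)
    then have "\<rho> * norm e < \<rho> * 1" using \<rho> by linarith
    then show ?thesis using \<rho>0 unfolding e(2) by (simp only: mult_less_cancel_left_pos)
  qed
  then obtain C where C: "\<And>m. norm_bound (?B ^\<^sub>m m) C"
    using spectral_radius_jnf_norm_bound_less_1_upper_triangular[OF B] by blast
  have "\<bar>(T ^\<^sub>m m) $$ (i, j)\<bar> \<le> max C 1 * \<rho> ^ m" if ij: "i < n" "j < n" for m i j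
  proof -
    have "norm ((?B ^\<^sub>m m) $$ (i, j)) \<le> C"
      using C[of m] ij carrier_matD[OF pow_carrier_mat[OF B, of m]] unfolding norm_bound_def by metis
    moreover have "(?B ^\<^sub>m m) $$ (i, j) = complex_of_real ((T ^\<^sub>m m) $$ (i, j) / \<rho> ^ m)"
    proof -
      have "?B ^\<^sub>m m = ?c ^ m \<cdot>\<^sub>m map_mat complex_of_real (T ^\<^sub>m m)"
        unfolding smult_pow_mat[OF A] of_real_hom.mat_hom_pow[OF T] ..
      then show ?thesis using ij carrier_matD[OF T] by (simp add: power_divide)
    qed
    ultimately have "\<bar>(T ^\<^sub>m m) $$ (i, j)\<bar> / \<rho> ^ m \<le> C"
      using \<rho>0 by (simp add: norm_divide norm_power)
    then have "\<bar>(T ^\<^sub>m m) $$ (i, j)\<bar> \<le> C * \<rho> ^ m" using \<rho>0 by (simp add: pos_divide_le_eq)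
    also have "\<dots> \<le> max C 1 * \<rho> ^ m" using \<rho>0 by (intro mult_right_mono) auto
    finally show ?thesis .
  qed
  then show ?thesis by (intro exI[of _ "max C 1"]) auto
qed

text \<open>Compare with an eigenvector of an eigenvalue of maximal modulus, in a row where the
  eigenvector has its largest entry.\<close>

lemma sp_power_le_row_sum:
  fixes T :: "real mat"
  assumes T: "T \<in> carrier_mat n n" and n: "0 < n"
    and nonneg: "\<And>m i j. i < n \<Longrightarrow> j < n \<Longrightarrow> 0 \<le> (T ^\<^sub>m m) $$ (i, j)"
  shows "\<exists>i<n. sp T ^ m \<le> (\<Sum>j<n. (T ^\<^sub>m m) $$ (i, j))"
proof -
  let ?A = "map_mat complex_of_real T"
  have A: "?A \<in> carrier_mat n n" using T by simp
  obtain e where e: "e \<in> spectrum ?A" "sp T = norm e"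
    using spectral_radius_mem_max(1)[OF A n] by (auto simp: sp_def)
  then obtain v where v: "eigenvector ?A v e" by (auto simp: spectrum_def eigenvalue_def)
  then have vn: "v \<in> carrier_vec n" "v \<noteq> 0\<^sub>v n" using A by (auto simp: eigenvector_def)
  have "\<exists>i\<in>{..<n}. \<forall>j\<in>{..<n}. norm (v $ j) \<le> norm (v $ i)"
  proof -
    have "Max ((\<lambda>i. norm (v $ i)) ` {..<n}) \<in> (\<lambda>i. norm (v $ i)) ` {..<n}"
      using n by (intro Max_in) auto
    then obtain i where "i < n" "norm (v $ i) = Max ((\<lambda>i. norm (v $ i)) ` {..<n})" by auto
    then show ?thesis by (intro bexI[of _ i]) auto
  qed
  then obtain i where i: "i < n" "\<And>j. j < n \<Longrightarrow> norm (v $ j) \<le> norm (v $ i)" by auto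
  have "v $ i \<noteq> 0"
  proof
    assume "v $ i = 0"
    then have "v $ j = 0" if "j < n" for j using i(2)[OF that] by simp
    then have "v = 0\<^sub>v n" using vn(1) by (intro eq_vecI) auto
    then show False using vn(2) by simp
  qed
  have "(?A ^\<^sub>m m *\<^sub>v v) $ i = e ^ m * v $ i"
    using eigenvector_pow[OF A v, of m] i(1) vn(1) by simp
  moreover have "(?A ^\<^sub>m m *\<^sub>v v) $ i = (\<Sum>j<n. complex_of_real ((T ^\<^sub>m m) $$ (i, j)) * v $ j)"
    unfolding mult_mat_vec_sum[OF pow_carrier_mat[OF A] vn(1) i(1)]
    unfolding of_real_hom.mat_hom_pow[OF T, symmetric] using i(1) carrier_matD[OF T] by (intro sum.cong) auto
  ultimately have "e ^ m * v $ i = (\<Sum>j<n. complex_of_real ((T ^\<^sub>m m) $$ (i, j)) * v $ j)"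
    by (rule trans[OF sym])
  from arg_cong[OF this, of norm]
  have "norm e ^ m * norm (v $ i) = norm (\<Sum>j<n. complex_of_real ((T ^\<^sub>m m) $$ (i, j)) * v $ j)"
    by (simp only: norm_mult norm_power)
  also have "\<dots> \<le> (\<Sum>j<n. (T ^\<^sub>m m) $$ (i, j) * norm (v $ i))"
    using nonneg i by (intro sum_norm_le) (auto simp: norm_mult intro: mult_left_mono)
  also have "\<dots> = (\<Sum>j<n. (T ^\<^sub>m m) $$ (i, j)) * norm (v $ i)" by (simp add: sum_distrib_right)
  finally have "norm e ^ m \<le> (\<Sum>j<n. (T ^\<^sub>m m) $$ (i, j))"
    using \<open>v $ i \<noteq> 0\<close> by (simp only: mult_le_cancel_right) simp
  then show ?thesis unfolding e(2) using i(1) by blast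
qed

lemma pow_mat_nonneg:
  fixes T :: "real mat"
  assumes "T \<in> carrier_mat n n" "\<And>i j. i < n \<Longrightarrow> j < n \<Longrightarrow> 0 \<le> T $$ (i, j)" "i < n" "j < n"
  shows "0 \<le> (T ^\<^sub>m m) $$ (i, j)"
  using assms(3,4)
proof (induction m arbitrary: i j)
  case 0
  have "T ^\<^sub>m 0 = 1\<^sub>m n" using assms(1) by simp
  then show ?case using 0 by simp
next
  case (Suc m)
  have eq: "(T ^\<^sub>m Suc m) $$ (i, j) = (\<Sum>l<n. (T ^\<^sub>m m) $$ (i, l) * T $$ (l, j))"
    unfolding pow_mat.simps(2) by (rule index_mult_mat_sum[OF pow_carrier_mat[OF assms(1)] assms(1) Suc.prems])
  show ?case
    unfolding eq
  proof (intro sum_nonneg mult_nonneg_nonneg)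
    fix l assume "l \<in> {..<n}"
    then have l: "l < n" by simp
    show "0 \<le> (T ^\<^sub>m m) $$ (i, l)" by (rule Suc.IH[OF Suc.prems(1) l])
    show "0 \<le> T $$ (l, j)" by (rule assms(2)[OF l Suc.prems(2)])
  qed
qed

text \<open>\<open>w\<close> may vanish in rows that die out under the powers of \<open>T\<close>: the hypothesis on \<open>M\<close> says that
  \<open>T ^ M\<close> maps into the span of the coordinates where \<open>w\<close> is positive, so such rows do not
  contribute to the growth rate.\<close>

lemma pow_mat_vec_growth:
  fixes T :: "real mat" and w :: "real vec"
  assumes T: "T \<in> carrier_mat n n" and n: "0 < n" and w: "w \<in> carrier_vec n"
    and T_nonneg: "\<And>i j. i < n \<Longrightarrow> j < n \<Longrightarrow> 0 \<le> T $$ (i, j)"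
    and w_nonneg: "\<And>i. i < n \<Longrightarrow> 0 \<le> w $ i"
    and rows: "\<And>i j. i < n \<Longrightarrow> j < n \<Longrightarrow> (T ^\<^sub>m M) $$ (i, j) \<noteq> 0 \<Longrightarrow> 0 < w $ i"
    and alive: "\<And>m. \<exists>i<n. 0 < (T ^\<^sub>m m *\<^sub>v w) $ i"
  shows "0 < sp T"
    and "\<exists>c>0. \<forall>m. \<exists>i<n. c * sp T ^ m \<le> (T ^\<^sub>m m *\<^sub>v w) $ i"
    and "sp T < \<rho> \<Longrightarrow> \<exists>C>0. \<forall>m. \<forall>i<n. (T ^\<^sub>m m *\<^sub>v w) $ i \<le> C * \<rho> ^ m"
proof -
  have pn: "0 \<le> (T ^\<^sub>m m) $$ (i, j)" if "i < n" "j < n" for m i j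
    using pow_mat_nonneg[OF T T_nonneg] that by blast
  have entry: "(T ^\<^sub>m m *\<^sub>v w) $ i = (\<Sum>j<n. (T ^\<^sub>m m) $$ (i, j) * w $ j)" if "i < n" for m i
    using mult_mat_vec_sum[OF pow_carrier_mat[OF T] w that] .
  have upper: "\<exists>C>0. \<forall>m. \<forall>i<n. (T ^\<^sub>m m *\<^sub>v w) $ i \<le> C * \<rho> ^ m" if \<rho>: "sp T < \<rho>" for \<rho>
  proof -
    obtain C where C: "0 < C" "\<And>m i j. i < n \<Longrightarrow> j < n \<Longrightarrow> \<bar>(T ^\<^sub>m m) $$ (i, j)\<bar> \<le> C * \<rho> ^ m"
      using pow_mat_le_geometric[OF T n \<rho>] by blast
    have "(T ^\<^sub>m m *\<^sub>v w) $ i \<le> C * (1 + (\<Sum>j<n. w $ j)) * \<rho> ^ m" if i: "i < n" for m i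
    proof -
      have C0: "0 \<le> C * \<rho> ^ m" using C(2)[OF i n, of m] by linarith
      have "(T ^\<^sub>m m *\<^sub>v w) $ i \<le> (\<Sum>j<n. C * \<rho> ^ m * w $ j)"
        unfolding entry[OF i] using C(2)[OF i] w_nonneg
        by (intro sum_mono mult_right_mono) (auto dest: abs_le_D1)
      also have "\<dots> = C * \<rho> ^ m * (\<Sum>j<n. w $ j)" by (simp add: sum_distrib_left)
      also have "\<dots> \<le> C * \<rho> ^ m * (1 + (\<Sum>j<n. w $ j))" using C0 by (intro mult_left_mono) auto
      finally show ?thesis by (simp add: algebra_simps)
    qed
    moreover have "0 < C * (1 + (\<Sum>j<n. w $ j))"
      using C(1) w_nonneg by (intro mult_pos_pos add_pos_nonneg sum_nonneg) auto
    ultimately show ?thesis by blast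
  qed
  then show "sp T < \<rho> \<Longrightarrow> \<exists>C>0. \<forall>m. \<forall>i<n. (T ^\<^sub>m m *\<^sub>v w) $ i \<le> C * \<rho> ^ m" by blast
  \<comment> \<open>Positive entries of \<open>T ^ m w\<close> are bounded below by a geometric sequence.\<close>
  show pos: "0 < sp T"
  proof -
    define \<delta> where "\<delta> = Min (insert 1 {T $$ (i, j) | i j. i < n \<and> j < n \<and> 0 < T $$ (i, j)})"
    define \<eta> where "\<eta> = Min (insert 1 {w $ i | i. i < n \<and> 0 < w $ i})"
    have f1: "finite {T $$ (i, j) | i j. i < n \<and> j < n \<and> 0 < T $$ (i, j)}"
      by (rule finite_subset[of _ "(\<lambda>(i, j). T $$ (i, j)) ` ({..<n} \<times> {..<n})"]) auto
    have f2: "finite {w $ i | i. i < n \<and> 0 < w $ i}"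
      by (rule finite_subset[of _ "(\<lambda>i. w $ i) ` {..<n}"]) auto
    have \<delta>: "0 < \<delta>" "\<And>i j. i < n \<Longrightarrow> j < n \<Longrightarrow> 0 < T $$ (i, j) \<Longrightarrow> \<delta> \<le> T $$ (i, j)"
      unfolding \<delta>_def using f1 by (auto intro!: Min_le)
    have \<eta>: "0 < \<eta>" "\<And>i. i < n \<Longrightarrow> 0 < w $ i \<Longrightarrow> \<eta> \<le> w $ i"
      unfolding \<eta>_def using f2 by (auto intro!: Min_le)
    have nn: "0 \<le> (T ^\<^sub>m m *\<^sub>v w) $ i" if "i < n" for m i
      unfolding entry[OF that] using pn that w_nonneg by (intro sum_nonneg mult_nonneg_nonneg) auto
    have low: "i < n \<Longrightarrow> 0 < (T ^\<^sub>m m *\<^sub>v w) $ i \<Longrightarrow> \<delta> ^ m * \<eta> \<le> (T ^\<^sub>m m *\<^sub>v w) $ i" for m i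
    proof (induction m arbitrary: i)
      case 0
      have "T ^\<^sub>m 0 *\<^sub>v w = w" using T w by simp
      then show ?case using \<eta>(2) 0 by simp
    next
      case (Suc m)
      let ?u = "T ^\<^sub>m m *\<^sub>v w"
      have u: "?u \<in> carrier_vec n" by (rule mult_mat_vec_carrier[OF pow_carrier_mat[OF T] w])
      have eq: "(T ^\<^sub>m Suc m *\<^sub>v w) $ i = (\<Sum>j<n. T $$ (i, j) * ?u $ j)"
        using pow_mat_Suc_vec[OF T w] mult_mat_vec_sum[OF T u Suc.prems(1)] by simp
      have nn': "0 \<le> T $$ (i, j) * ?u $ j" if "j < n" for j
        using nn[OF that] T_nonneg[OF Suc.prems(1) that] by simp
      have "(\<Sum>j<n. T $$ (i, j) * ?u $ j) \<noteq> 0" using Suc.prems(2) unfolding eq by (rule less_imp_neq[symmetric])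
      then obtain j where j: "j < n" "T $$ (i, j) * ?u $ j \<noteq> 0"
        by (rule sum.not_neutral_contains_not_neutral) simp
      then have "T $$ (i, j) \<noteq> 0" "?u $ j \<noteq> 0" by auto
      then have "0 < T $$ (i, j)" "0 < ?u $ j"
        using nn[OF j(1), of m] T_nonneg[OF Suc.prems(1) j(1)] by linarith+
      then have "\<delta> * (\<delta> ^ m * \<eta>) \<le> T $$ (i, j) * ?u $ j"
        using \<delta> \<eta>(1) Suc.IH[OF j(1)] Suc.prems(1) j(1) by (intro mult_mono) auto
      also have "\<dots> \<le> (T ^\<^sub>m Suc m *\<^sub>v w) $ i"
        unfolding eq using j(1) nn' by (intro member_le_sum) auto
      finally show ?case by (simp add: mult.assoc)
    qed
    show ?thesis
    proof (rule ccontr)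
      assume "\<not> 0 < sp T"
      then obtain C where C: "0 < C" "\<And>m i. i < n \<Longrightarrow> (T ^\<^sub>m m *\<^sub>v w) $ i \<le> C * (\<delta> / 2) ^ m"
        using upper[of "\<delta> / 2"] \<delta>(1) by force
      have "\<eta> \<le> C * (1 / 2) ^ m" for m
      proof -
        obtain i where i: "i < n" "0 < (T ^\<^sub>m m *\<^sub>v w) $ i" using alive by blast
        have "\<delta> ^ m * \<eta> \<le> C * (\<delta> / 2) ^ m" using low[OF i] C(2)[OF i(1), of m] by linarith
        also have "\<dots> = \<delta> ^ m * (C * (1 / 2) ^ m)" by (simp add: power_divide)
        finally show ?thesis using \<delta>(1) by simp
      qed
      moreover have "(\<lambda>m. C * (1 / 2 :: real) ^ m) \<longlonglongrightarrow> C * 0"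
        by (intro tendsto_intros LIMSEQ_power_zero) auto
      ultimately have "\<eta> \<le> 0" using LIMSEQ_le_const[of _ "C * 0" \<eta>] by auto
      then show False using \<eta>(1) by simp
    qed
  qed
  \<comment> \<open>\<open>R\<close> is \<open>T ^ M\<close> applied to the all-one vector; where \<open>w $ i = 0\<close>, also \<open>R i = 0\<close> and the quotient in \<open>C\<close> is \<open>0\<close>.\<close>
  define R where "R i = (\<Sum>j<n. (T ^\<^sub>m M) $$ (i, j))" for i
  define C where "C = 1 + (\<Sum>i<n. R i / w $ i)"
  have R_nonneg: "0 \<le> R i" if "i < n" for i unfolding R_def using pn that by (intro sum_nonneg) auto
  have q_nonneg: "0 \<le> R i / w $ i" if "i < n" for i using R_nonneg w_nonneg that by simp
  have C: "0 < C" unfolding C_def using q_nonneg by (intro add_pos_nonneg sum_nonneg) auto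
  have RC: "R i \<le> C * w $ i" if i: "i < n" for i
  proof (cases "w $ i = 0")
    case True
    then have "R i = 0" unfolding R_def using rows[OF i] by (intro sum.neutral) force
    then show ?thesis using True by simp
  next
    case False
    then have wi: "0 < w $ i" using w_nonneg[OF i] by simp
    have "R i / w $ i \<le> (\<Sum>i<n. R i / w $ i)" using i q_nonneg by (intro member_le_sum) auto
    then have "R i / w $ i \<le> C" by (simp add: C_def)
    then show ?thesis using wi by (simp add: divide_le_eq)
  qed
  have "\<exists>i<n. sp T ^ M / C * sp T ^ m \<le> (T ^\<^sub>m m *\<^sub>v w) $ i" for m
  proof -
    obtain i where i: "i < n" "sp T ^ (m + M) \<le> (\<Sum>j<n. (T ^\<^sub>m (m + M)) $$ (i, j))"
      using sp_power_le_row_sum[OF T n pn] by blast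
    note i(2)
    also have "(\<Sum>j<n. (T ^\<^sub>m (m + M)) $$ (i, j)) = (\<Sum>j<n. \<Sum>l<n. (T ^\<^sub>m m) $$ (i, l) * (T ^\<^sub>m M) $$ (l, j))"
      unfolding pow_mat_add[OF T]
      using index_mult_mat_sum[OF pow_carrier_mat[OF T] pow_carrier_mat[OF T] i(1)] by simp
    also have "\<dots> = (\<Sum>l<n. (T ^\<^sub>m m) $$ (i, l) * R l)"
      unfolding R_def sum_distrib_left by (rule sum.swap)
    also have "\<dots> \<le> (\<Sum>l<n. (T ^\<^sub>m m) $$ (i, l) * (C * w $ l))"
      using RC pn i(1) by (intro sum_mono mult_left_mono) auto
    also have "\<dots> = C * (T ^\<^sub>m m *\<^sub>v w) $ i"
      unfolding entry[OF i(1)] by (simp add: sum_distrib_left ac_simps)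
    finally have "sp T ^ M * sp T ^ m \<le> C * (T ^\<^sub>m m *\<^sub>v w) $ i" by (simp add: power_add mult.commute)
    then show ?thesis using C i(1) by (intro exI[of _ i]) (simp add: field_simps)
  qed
  moreover have "0 < sp T ^ M / C" using pos C by simp
  ultimately show "\<exists>c>0. \<forall>m. \<exists>i<n. c * sp T ^ m \<le> (T ^\<^sub>m m *\<^sub>v w) $ i" by blast
qed

text \<open>The radii between \<open>a q\<^sup>m\<^sup>+\<^sup>1\<close> and \<open>a q\<^sup>m\<close> are handled by monotonicity of \<open>g\<close>, at the cost of
  constant factors, which disappear after division by \<open>ln \<rho>\<close>.\<close>

lemma log_ratio_limit:
  fixes g :: "real \<Rightarrow> real"
  assumes q: "0 < q" "q < 1" and L: "0 < L" and a: "0 < a" and b: "0 < b" and c: "0 < c" and e: "0 < e"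
    and mono: "\<And>s t. 0 < s \<Longrightarrow> s \<le> t \<Longrightarrow> g s \<le> g t"
    and lower: "\<And>m. c * L ^ m \<le> g (a * q ^ m)"
    and upper: "\<And>\<rho>. L < \<rho> \<Longrightarrow> \<exists>C>0. \<forall>m. b * q ^ m < e \<longrightarrow> g (b * q ^ m) \<le> C * \<rho> ^ m"
  shows "((\<lambda>t. ln (g t) / ln t) \<longlongrightarrow> ln L / ln q) (at_right 0)"
proof -
  have lnq: "ln q < 0" using q by simp
  \<comment> \<open>\<open>N u t\<close> is the exponent with \<open>u * q ^ Suc (N u t) < t \<le> u * q ^ N u t\<close>.\<close>
  define N where "N u t = nat \<lfloor>ln (t / u) / ln q\<rfloor>" for u t :: real
  have N: "u * q ^ Suc (N u t) \<le> t" "t \<le> u * q ^ N u t"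
    "ln (t / u) / ln q - 1 \<le> real (N u t)" "real (N u t) \<le> ln (t / u) / ln q"
    if "0 < u" "0 < t" "t < u" for u t
  proof -
    let ?x = "ln (t / u) / ln q"
    have tu: "0 < t / u" "t / u \<le> 1" using that by simp_all
    then have "0 \<le> ?x" using lnq by (intro divide_nonpos_neg) simp_all
    then have "real (N u t) = of_int \<lfloor>?x\<rfloor>" unfolding N_def by (intro of_nat_nat) (simp only: zero_le_floor)
    then show f: "?x - 1 \<le> real (N u t)" "real (N u t) \<le> ?x"
      using floor_correct[of ?x] by linarith+
    have "?x < real (Suc (N u t))" using f(1) \<open>real (N u t) = of_int \<lfloor>?x\<rfloor>\<close> floor_correct[of ?x] by linarith
    then have "real (Suc (N u t)) * ln q \<le> ln (t / u)"
      unfolding neg_divide_less_eq[OF lnq] by (rule less_imp_le)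
    then have "ln (q ^ Suc (N u t)) \<le> ln (t / u)" unfolding ln_realpow .
    then have "q ^ Suc (N u t) \<le> t / u"
      unfolding ln_le_cancel_iff[OF zero_less_power[OF q(1)] tu(1)] .
    then show "u * q ^ Suc (N u t) \<le> t" using that(1) by (simp add: field_simps)
    have "ln (t / u) \<le> real (N u t) * ln q" using f(2) unfolding neg_le_divide_eq[OF lnq] .
    then have "ln (t / u) \<le> ln (q ^ N u t)" unfolding ln_realpow .
    then have "t / u \<le> q ^ N u t" unfolding ln_le_cancel_iff[OF tu(1) zero_less_power[OF q(1)]] .
    then show "t \<le> u * q ^ N u t" using that(1) by (simp add: field_simps)
  qed
  have small: "\<forall>\<^sub>F t in at_right 0. 0 < t \<and> t < u" if "0 < u" for u :: real
    using that by (auto simp: eventually_at_right_field)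
  have lim0: "((\<lambda>t. x / ln t) \<longlongrightarrow> 0) (at_right 0)" for x :: real
    by (rule tendsto_divide_0[OF tendsto_const filterlim_at_bot_imp_at_infinity[OF ln_at_0]])
  have limN: "((\<lambda>t. real (N u t) / ln t) \<longlongrightarrow> 1 / ln q) (at_right 0)" if "0 < u" for u
  proof (rule tendsto_sandwich)
    have ev: "\<forall>\<^sub>F t in at_right 0. 0 < t \<and> t < min u 1" using that by (intro small) auto
    have split: "(ln (t / u) / ln q - y) / ln t = 1 / ln q - (ln u / ln q + y) / ln t"
      if "0 < t" "t < min u 1" for t y
    proof -
      have "ln t < 0" using that by simp
      then show ?thesis using that \<open>0 < u\<close> lnq by (simp add: ln_div field_simps)
    qed
    have lim: "((\<lambda>t. 1 / ln q - (ln u / ln q + y) / ln t) \<longlongrightarrow> 1 / ln q - 0) (at_right 0)" for y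
      by (intro tendsto_diff tendsto_const lim0)
    show "((\<lambda>t. 1 / ln q - (ln u / ln q + 0) / ln t) \<longlongrightarrow> 1 / ln q) (at_right 0)"
      "((\<lambda>t. 1 / ln q - (ln u / ln q + 1) / ln t) \<longlongrightarrow> 1 / ln q) (at_right 0)"
      using lim[of 0] lim[of 1] by simp_all
    show "\<forall>\<^sub>F t in at_right 0. 1 / ln q - (ln u / ln q + 0) / ln t \<le> real (N u t) / ln t"
      using ev
    proof (rule eventually_mono)
      fix t assume t: "0 < t \<and> t < min u 1"
      then have "(ln (t / u) / ln q - 0) / ln t \<le> real (N u t) / ln t"
        using N(4)[of u t] that by (intro divide_right_mono_neg) auto
      then show "1 / ln q - (ln u / ln q + 0) / ln t \<le> real (N u t) / ln t" by (simp only: split[OF conjunct1[OF t] conjunct2[OF t]])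
    qed
    show "\<forall>\<^sub>F t in at_right 0. real (N u t) / ln t \<le> 1 / ln q - (ln u / ln q + 1) / ln t"
      using ev
    proof (rule eventually_mono)
      fix t assume t: "0 < t \<and> t < min u 1"
      then have "real (N u t) / ln t \<le> (ln (t / u) / ln q - 1) / ln t"
        using N(3)[of u t] that by (intro divide_right_mono_neg) auto
      then show "real (N u t) / ln t \<le> 1 / ln q - (ln u / ln q + 1) / ln t" by (simp only: split[OF conjunct1[OF t] conjunct2[OF t]])
    qed
  qed
  have limF: "((\<lambda>t. (x + real (N u t) * y) / ln t) \<longlongrightarrow> y / ln q) (at_right 0)" if "0 < u" for u x y
  proof -
    have "((\<lambda>t. x / ln t + real (N u t) / ln t * y) \<longlongrightarrow> 0 + 1 / ln q * y) (at_right 0)"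
      by (intro tendsto_add tendsto_mult tendsto_const lim0 limN that)
    then show ?thesis by (simp add: add_divide_distrib)
  qed
  have low: "c * L ^ Suc (N a t) \<le> g t" if "0 < t" "t < a" for t
    using lower[of "Suc (N a t)"] mono[of "a * q ^ Suc (N a t)" t] N(1)[OF a that] a q by force
  have gpos: "0 < g t" if "0 < t" "t < a" for t
    using low[OF that] c L by (smt (verit) mult_pos_pos zero_less_power)
  show ?thesis
  proof (rule order_tendstoI)
    fix y assume y: "ln L / ln q < y"
    have "\<forall>\<^sub>F t in at_right 0. (ln c + ln L + real (N a t) * ln L) / ln t < y"
      by (rule order_tendstoD(2)[OF limF[OF a] y])
    moreover have "\<forall>\<^sub>F t in at_right 0. 0 < t \<and> t < min a 1" using a by (intro small) auto
    ultimately show "\<forall>\<^sub>F t in at_right 0. ln (g t) / ln t < y"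
    proof (rule eventually_elim2)
      fix t assume t: "(ln c + ln L + real (N a t) * ln L) / ln t < y" "0 < t \<and> t < min a 1"
      have "ln (c * L ^ Suc (N a t)) \<le> ln (g t)"
        using low[of t] gpos[of t] t c L by (subst ln_le_cancel_iff) auto
      also have "ln (c * L ^ Suc (N a t)) = ln c + ln L + real (N a t) * ln L"
        using c L by (simp add: ln_mult ln_realpow algebra_simps)
      finally have "ln (g t) / ln t \<le> (ln c + ln L + real (N a t) * ln L) / ln t"
        using t by (intro divide_right_mono_neg) auto
      then show "ln (g t) / ln t < y" using t by simp
    qed
  next
    fix y assume y: "y < ln L / ln q"
    \<comment> \<open>With this \<open>\<delta>\<close>, the quotient \<open>ln \<rho> / ln q\<close> is the midpoint of \<open>y\<close> and \<open>ln L / ln q\<close>.\<close>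
    define \<delta> where "\<delta> = (ln L / ln q - y) / 2 * (- ln q)"
    define \<rho> where "\<rho> = exp (ln L + \<delta>)"
    have \<delta>: "0 < \<delta>" unfolding \<delta>_def using y lnq by (intro mult_pos_pos) auto
    have "L = exp (ln L)" using L by simp
    also have "\<dots> < \<rho>" unfolding \<rho>_def using \<delta> by simp
    finally have "L < \<rho>" .
    then obtain C where C: "0 < C" "\<And>m. b * q ^ m < e \<Longrightarrow> g (b * q ^ m) \<le> C * \<rho> ^ m"
      using upper by blast
    have "ln \<rho> / ln q = (y + ln L / ln q) / 2"
      using lnq by (simp add: \<rho>_def \<delta>_def field_simps)
    with field_less_half_sum[OF y] have "y < ln \<rho> / ln q" by (simp only:)
    then have "\<forall>\<^sub>F t in at_right 0. y < (ln C + real (N b t) * ln \<rho>) / ln t"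
      by (rule order_tendstoD(1)[OF limF[OF b]])
    moreover have "\<forall>\<^sub>F t in at_right 0. 0 < t \<and> t < min (min a b) (min (e * q) 1)"
      using a b e q by (intro small) auto
    ultimately show "\<forall>\<^sub>F t in at_right 0. y < ln (g t) / ln t"
    proof (rule eventually_elim2)
      fix t assume t: "y < (ln C + real (N b t) * ln \<rho>) / ln t" "0 < t \<and> t < min (min a b) (min (e * q) 1)"
      have \<rho>: "0 < \<rho>" by (simp add: \<rho>_def)
      have "q * (b * q ^ N b t) < q * e" using N(1)[of b t] b t by (simp add: ac_simps)
      then have "b * q ^ N b t < e" using q by simp
      then have "g t \<le> C * \<rho> ^ N b t" using C(2) mono[of t] N(2)[of b t] b t by force
      then have "ln (g t) \<le> ln (C * \<rho> ^ N b t)"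
        using gpos[of t] t C(1) \<rho> by (subst ln_le_cancel_iff) auto
      also have "\<dots> = ln C + real (N b t) * ln \<rho>"
        using C(1) \<rho> by (simp add: ln_mult ln_realpow)
      finally have "(ln C + real (N b t) * ln \<rho>) / ln t \<le> ln (g t) / ln t"
        using t by (intro divide_right_mono_neg) auto
      then show "y < ln (g t) / ln t" using t by simp
    qed
  qed
qed

section \<open>Words and cross-sections of the tree of words\<close>

context ifs
begin

lemma r_min_pos: "0 < r_min"
  unfolding r_min_def using ratio_pos by (subst Min_gr_iff) auto

lemma r_min_le: "j \<le> k \<Longrightarrow> r_min \<le> \<bar>r j\<bar>"
  unfolding r_min_def by (rule Min_le) auto

lemma r_min_less_1: "r_min < 1"
  using r_min_le[of 0] ratio_less_1[of 0] by simp

definition r_max :: real where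
  "r_max = Max ((\<lambda>j. \<bar>r j\<bar>) ` {..k})"

lemma r_max_ge: "j \<le> k \<Longrightarrow> \<bar>r j\<bar> \<le> r_max"
  unfolding r_max_def by (rule Max_ge) auto

lemma r_max_less_1: "r_max < 1"
  unfolding r_max_def using ratio_less_1 by (subst Max_less_iff) auto

lemma r_max_pos: "0 < r_max"
  using r_max_ge[of 0] ratio_pos[of 0] by simp

lemma S_Nil [simp]: "S [] = id"
  by (simp add: S_def)

lemma S_Cons: "S (j # \<sigma>) = (\<lambda>x. r j * x + d j) \<circ> S \<sigma>"
  by (simp add: S_def)

lemma S_append: "S (\<sigma> @ \<tau>) = S \<sigma> \<circ> S \<tau>"
  by (induction \<sigma>) (auto simp: S_Cons comp_assoc)

lemma ratio_Nil [simp]: "ratio [] = 1"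
  by (simp add: ratio_def)

lemma ratio_Cons [simp]: "ratio (j # \<sigma>) = r j * ratio \<sigma>"
  by (simp add: ratio_def)

lemma ratio_append [simp]: "ratio (\<sigma> @ \<tau>) = ratio \<sigma> * ratio \<tau>"
  by (simp add: ratio_def)

lemma S_affine: "S \<sigma> x = ratio \<sigma> * x + S \<sigma> 0"
proof (induction \<sigma>)
  case (Cons j \<sigma>)
  have "S (j # \<sigma>) x = r j * S \<sigma> x + d j" "S (j # \<sigma>) 0 = r j * S \<sigma> 0 + d j"
    by (simp_all add: S_Cons)
  then show ?case
    using Cons by (simp add: algebra_simps)
qed simp

lemma ratio_nonzero: "set \<sigma> \<subseteq> {..k} \<Longrightarrow> ratio \<sigma> \<noteq> 0"
proof (induction \<sigma>)
  case (Cons j \<sigma>)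
  then show ?case using ratio_pos[of j] by auto
qed simp

lemma abs_ratio_le: "set \<sigma> \<subseteq> {..k} \<Longrightarrow> \<bar>ratio \<sigma>\<bar> \<le> 1"
proof (induction \<sigma>)
  case (Cons j \<sigma>)
  then show ?case using ratio_less_1[of j] by (auto simp: abs_mult intro: mult_le_one)
qed simp

text \<open>The cross-section of the tree of words at scale \<open>t\<close>, seen from a node of ratio \<open>c\<close>: reading
  letters from that node, these are the words at which the accumulated ratio first drops to \<open>t\<close>.
  The sets \<open>\<Lambda> n\<close> are the case \<open>c = 1\<close>, and the words that extend a given word of \<open>\<Lambda> n\<close> to one
  of \<open>\<Lambda> (Suc n)\<close> are again such a cross-section.\<close>

definition stop_words :: "real \<Rightarrow> real \<Rightarrow> nat list set" where
  "stop_words c t = {\<omega>. set \<omega> \<subseteq> {..k} \<and> \<bar>c * ratio \<omega>\<bar> \<le> t \<and> (\<omega> = [] \<or> t < \<bar>c * ratio (butlast \<omega>)\<bar>)}"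

lemma stop_words_small:
  assumes "\<bar>c\<bar> \<le> t"
  shows "stop_words c t = {[]}"
proof -
  have "\<bar>c * ratio (butlast \<omega>)\<bar> \<le> t" if "set \<omega> \<subseteq> {..k}" for \<omega>
  proof -
    have "set (butlast \<omega>) \<subseteq> {..k}" using that by (meson in_set_butlastD subset_iff)
    then have "\<bar>c\<bar> * \<bar>ratio (butlast \<omega>)\<bar> \<le> \<bar>c\<bar>"
      using abs_ratio_le by (simp add: mult_left_le)
    then show ?thesis using assms by (simp add: abs_mult)
  qed
  then show ?thesis using assms unfolding stop_words_def by fastforce
qed

lemma Cons_in_stop_words:
  assumes "t < \<bar>c\<bar>"
  shows "j # \<omega> \<in> stop_words c t \<longleftrightarrow> j \<le> k \<and> \<omega> \<in> stop_words (c * r j) t"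
  using assms by (auto simp: stop_words_def mult.assoc)

lemma stop_words_big:
  assumes "t < \<bar>c\<bar>"
  shows "stop_words c t = (\<Union>j\<le>k. (#) j ` stop_words (c * r j) t)"
proof -
  have "[] \<notin> stop_words c t" using assms by (simp add: stop_words_def)
  show "stop_words c t = (\<Union>j\<le>k. (#) j ` stop_words (c * r j) t)"
  proof (intro Set.set_eqI)
    fix \<omega> show "\<omega> \<in> stop_words c t \<longleftrightarrow> \<omega> \<in> (\<Union>j\<le>k. (#) j ` stop_words (c * r j) t)"
      using \<open>[] \<notin> stop_words c t\<close> Cons_in_stop_words[OF assms] by (cases \<omega>) auto
  qed
qed

text \<open>A letter shrinks the ratio by the factor \<open>r_max < 1\<close> at least, so the recursion of
  \<open>stop_words_big\<close> ends.\<close>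

lemma stop_words_induct [consumes 1, case_names small big]:
  assumes "0 < t"
    and small: "\<And>c. \<bar>c\<bar> \<le> t \<Longrightarrow> P c"
    and big: "\<And>c. t < \<bar>c\<bar> \<Longrightarrow> (\<And>j. j \<le> k \<Longrightarrow> P (c * r j)) \<Longrightarrow> P c"
  shows "P c"
proof -
  have main: "\<bar>c\<bar> * r_max ^ N \<le> t \<Longrightarrow> P c" for N c
  proof (induction N arbitrary: c)
    case 0
    then show ?case using small by simp
  next
    case (Suc N)
    show ?case
    proof (cases "\<bar>c\<bar> \<le> t")
      case False
      have "P (c * r j)" if "j \<le> k" for j
      proof (rule Suc.IH)
        have "\<bar>r j\<bar> * (\<bar>c\<bar> * r_max ^ N) \<le> r_max * (\<bar>c\<bar> * r_max ^ N)"
          using r_max_ge[OF that] r_max_pos by (intro mult_right_mono) auto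
        then show "\<bar>c * r j\<bar> * r_max ^ N \<le> t"
          using Suc.prems by (simp add: abs_mult ac_simps)
      qed
      then show ?thesis using big False by simp
    qed (rule small)
  qed
  have "(\<lambda>N. \<bar>c\<bar> * r_max ^ N) \<longlonglongrightarrow> \<bar>c\<bar> * 0"
    using r_max_pos r_max_less_1 by (intro tendsto_intros LIMSEQ_power_zero) auto
  then have "\<forall>\<^sub>F N in sequentially. \<bar>c\<bar> * r_max ^ N < t"
    using \<open>0 < t\<close> by (intro order_tendstoD) auto
  then obtain N where "\<bar>c\<bar> * r_max ^ N < t"
    using eventually_happens'[OF sequentially_bot] by blast
  then show ?thesis using main[of c N] by simp
qed

lemma finite_stop_words:
  assumes "0 < t"
  shows "finite (stop_words c t)"
  using assms by (induction c rule: stop_words_induct) (auto simp: stop_words_small stop_words_big)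

lemma stop_words_scale:
  assumes "0 < q"
  shows "stop_words (q * c) (q * t) = stop_words c t"
  using assms by (simp add: stop_words_def mult.assoc abs_mult)

lemma prefix_in_stop_words:
  assumes "set \<tau> \<subseteq> {..k}" "\<bar>c * ratio \<tau>\<bar> \<le> t"
  shows "\<exists>\<sigma> \<omega>. \<tau> = \<sigma> @ \<omega> \<and> \<sigma> \<in> stop_words c t"
  using assms
proof (induction \<tau> arbitrary: c)
  case Nil
  then show ?case by (auto simp: stop_words_def)
next
  case (Cons j \<tau>)
  show ?case
  proof (cases "\<bar>c\<bar> \<le> t")
    case True
    then show ?thesis by (auto simp: stop_words_small)
  next
    case False
    obtain \<sigma> \<omega> where "\<tau> = \<sigma> @ \<omega>" "\<sigma> \<in> stop_words (c * r j) t"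
      using Cons.IH[of "c * r j"] Cons.prems by (auto simp: mult.assoc)
    then have "j # \<tau> = (j # \<sigma>) @ \<omega>" "j # \<sigma> \<in> stop_words c t"
      using Cons.prems False by (auto simp: Cons_in_stop_words)
    then show ?thesis by blast
  qed
qed

text \<open>For \<open>n = 0\<close> the threshold is 1, which the empty word does not exceed.\<close>

lemma \<Lambda>_eq_stop_words: "\<Lambda> n = stop_words 1 (r_min ^ n)"
proof (cases n)
  case 0
  then show ?thesis by (simp add: \<Lambda>_def stop_words_small)
next
  case (Suc m)
  have "r_min ^ n < 1" using Suc r_min_pos r_min_less_1 power_Suc_less_one[of r_min m] by simp
  then show ?thesis using Suc by (auto simp: \<Lambda>_def stop_words_def)
qed

lemma finite_\<Lambda>: "finite (\<Lambda> n)"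
  using finite_stop_words r_min_pos by (simp add: \<Lambda>_eq_stop_words)

lemma \<Lambda>_letters: "\<sigma> \<in> \<Lambda> n \<Longrightarrow> set \<sigma> \<subseteq> {..k}"
  by (simp add: \<Lambda>_eq_stop_words stop_words_def)

lemma \<Lambda>_ratio_le: "\<sigma> \<in> \<Lambda> n \<Longrightarrow> \<bar>ratio \<sigma>\<bar> \<le> r_min ^ n"
  by (simp add: \<Lambda>_eq_stop_words stop_words_def)

lemma \<Lambda>_ratio_greater:
  assumes "\<sigma> \<in> \<Lambda> n"
  shows "r_min ^ Suc n < \<bar>ratio \<sigma>\<bar>"
proof (cases \<sigma> rule: rev_cases)
  case Nil
  have "r_min ^ Suc n < 1" using r_min_pos r_min_less_1 by (rule power_Suc_less_one)
  then show ?thesis using Nil by simp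
next
  case (snoc \<tau> j)
  have "r_min ^ n < \<bar>ratio \<tau>\<bar>" "j \<le> k"
    using assms snoc by (auto simp: \<Lambda>_eq_stop_words stop_words_def)
  then have "r_min ^ n * r_min < \<bar>ratio \<tau>\<bar> * \<bar>r j\<bar>"
    using r_min_le[of j] r_min_pos by (intro mult_less_le_imp_less) auto
  then show ?thesis using snoc by (simp add: abs_mult mult.commute)
qed

lemma append_in_\<Lambda>_Suc:
  assumes "\<sigma> \<in> \<Lambda> n"
  shows "\<sigma> @ \<omega> \<in> \<Lambda> (Suc n) \<longleftrightarrow> \<omega> \<in> stop_words (ratio \<sigma>) (r_min ^ Suc n)"
proof (cases "\<omega> = []")
  case True
  have "\<sigma> \<notin> \<Lambda> (Suc n)" using \<Lambda>_ratio_greater[OF assms] \<Lambda>_ratio_le[of \<sigma> "Suc n"] by auto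
  then show ?thesis using True \<Lambda>_ratio_greater[OF assms] by (auto simp: stop_words_def)
next
  case False
  then show ?thesis using \<Lambda>_letters[OF assms]
    by (auto simp: \<Lambda>_eq_stop_words stop_words_def butlast_append)
qed

lemma \<Lambda>_Suc_prefix:
  assumes "\<tau> \<in> \<Lambda> (Suc n)"
  shows "\<exists>\<sigma> \<omega>. \<tau> = \<sigma> @ \<omega> \<and> \<sigma> \<in> \<Lambda> n \<and> \<omega> \<in> stop_words (ratio \<sigma>) (r_min ^ Suc n)"
proof -
  have "r_min ^ Suc n \<le> r_min ^ n" using r_min_pos r_min_less_1 by (intro power_decreasing) auto
  then have "\<bar>1 * ratio \<tau>\<bar> \<le> r_min ^ n" using \<Lambda>_ratio_le[OF assms] by simp
  then obtain \<sigma> \<omega> where "\<tau> = \<sigma> @ \<omega>" "\<sigma> \<in> \<Lambda> n"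
    using prefix_in_stop_words[OF \<Lambda>_letters[OF assms]] unfolding \<Lambda>_eq_stop_words by blast
  then show ?thesis using append_in_\<Lambda>_Suc assms by auto
qed

lemma K_step: "j \<le> k \<Longrightarrow> y \<in> K \<Longrightarrow> r j * y + d j \<in> K"
  using K_self_similar by blast

lemma S_K: "set \<sigma> \<subseteq> {..k} \<Longrightarrow> y \<in> K \<Longrightarrow> S \<sigma> y \<in> K"
  by (induction \<sigma>) (auto simp: S_Cons K_step)

lemma K_stop_words:
  assumes "0 < t" and "y \<in> K"
  shows "\<exists>\<omega>\<in>stop_words c t. \<exists>z\<in>K. y = S \<omega> z"
  using assms
proof (induction c arbitrary: y rule: stop_words_induct)
  case (small c)
  then show ?case by (auto simp: stop_words_small)
next
  case (big c)
  obtain j z where j: "j \<le> k" "z \<in> K" "y = r j * z + d j"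
    using K_self_similar big.prems by blast
  obtain \<omega> z' where "\<omega> \<in> stop_words (c * r j) t" "z' \<in> K" "z = S \<omega> z'"
    using big.IH[OF \<open>j \<le> k\<close> \<open>z \<in> K\<close>] by blast
  then show ?case using j big.hyps
    by (intro bexI[of _ "j # \<omega>"] bexI[of _ z']) (auto simp: S_Cons Cons_in_stop_words)
qed

lemma K_subset: "K \<subseteq> {0..1}"
  using K_hull hull_subset by metis

lemma K_ends: "0 \<in> K" "1 \<in> K"
proof -
  have cl: "closed K" "bounded K" using K_compact by (auto intro: compact_imp_closed compact_imp_bounded)
  then have bd: "bdd_below K" "bdd_above K" by (auto dest: bounded_imp_bdd_below bounded_imp_bdd_above)
  have "Inf K \<in> K" "Sup K \<in> K"
    using cl bd K_nonempty by (auto intro: closed_contains_Inf closed_contains_Sup)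
  moreover have "convex hull K \<subseteq> {Inf K..Sup K}"
    using bd by (intro hull_minimal) (auto intro: cInf_lower cSup_upper)
  then have "Inf K \<le> 0" "1 \<le> Sup K" using K_hull by auto
  ultimately show "0 \<in> K" "1 \<in> K" using K_subset
    by (metis atLeastAtMost_iff order_antisym subsetD)+
qed

definition lo :: "nat list \<Rightarrow> real" where "lo \<sigma> = min (S \<sigma> 0) (S \<sigma> 1)"
definition hi :: "nat list \<Rightarrow> real" where "hi \<sigma> = max (S \<sigma> 0) (S \<sigma> 1)"

lemma hi_minus_lo: "hi \<sigma> - lo \<sigma> = \<bar>ratio \<sigma>\<bar>"
  using S_affine[of \<sigma> 1] by (auto simp: lo_def hi_def)

lemma S_Icc: "S \<sigma> ` {0..1} = {lo \<sigma>..hi \<sigma>}"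
proof -
  have "S \<sigma> ` {0..1} = (\<lambda>x. ratio \<sigma> * x + S \<sigma> 0) ` {0..1}"
    by (rule image_cong[OF refl]) (rule S_affine)
  then show ?thesis
    unfolding image_affinity_atLeastAtMost using S_affine[of \<sigma> 1] by (auto simp: lo_def hi_def)
qed

lemma S_mem: "y \<in> {0..1} \<Longrightarrow> S \<sigma> y \<in> {lo \<sigma>..hi \<sigma>}"
  using S_Icc[of \<sigma>] by blast

lemma S_mem_open:
  assumes "set \<sigma> \<subseteq> {..k}" and "0 < y" "y < 1"
  shows "lo \<sigma> < S \<sigma> y \<and> S \<sigma> y < hi \<sigma>"
proof (cases "ratio \<sigma> > 0")
  case True
  then have "0 < ratio \<sigma> * y" "ratio \<sigma> * y < ratio \<sigma>" using assms by auto
  then show ?thesis using S_affine[of \<sigma> y] S_affine[of \<sigma> 1] by (auto simp: lo_def hi_def)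
next
  case False
  then have "ratio \<sigma> < 0" using ratio_nonzero[OF assms(1)] by simp
  then have "ratio \<sigma> * y < 0" "ratio \<sigma> < ratio \<sigma> * y" using assms
    by (auto simp: mult_neg_pos mult_less_cancel_left2)
  then show ?thesis using S_affine[of \<sigma> y] S_affine[of \<sigma> 1] by (auto simp: lo_def hi_def)
qed

lemma lo_less_hi: "set \<sigma> \<subseteq> {..k} \<Longrightarrow> lo \<sigma> < hi \<sigma>"
  using hi_minus_lo[of \<sigma>] ratio_nonzero[of \<sigma>] by auto

lemma S_Ioo:
  assumes "set \<sigma> \<subseteq> {..k}"
  shows "S \<sigma> ` {0<..<1} = {lo \<sigma><..<hi \<sigma>}"
proof
  show "S \<sigma> ` {0<..<1} \<subseteq> {lo \<sigma><..<hi \<sigma>}" using S_mem_open[OF assms] by auto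
  show "{lo \<sigma><..<hi \<sigma>} \<subseteq> S \<sigma> ` {0<..<1}"
  proof
    fix z assume z: "z \<in> {lo \<sigma><..<hi \<sigma>}"
    then obtain y where y: "y \<in> {0..1}" "z = S \<sigma> y" using S_Icc[of \<sigma>]
      by (metis atLeastAtMost_iff greaterThanLessThan_iff imageE less_imp_le)
    have "y \<noteq> 0" "y \<noteq> 1" using z y by (auto simp: lo_def hi_def)
    then show "z \<in> S \<sigma> ` {0<..<1}" using y by auto
  qed
qed

lemma S_inj: "set \<sigma> \<subseteq> {..k} \<Longrightarrow> S \<sigma> y = S \<sigma> z \<longleftrightarrow> y = z"
  using S_affine[of \<sigma> y] S_affine[of \<sigma> z] ratio_nonzero[of \<sigma>] by auto

lemma lo_hi_in_K: "set \<sigma> \<subseteq> {..k} \<Longrightarrow> lo \<sigma> \<in> K \<and> hi \<sigma> \<in> K"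
  using S_K K_ends by (auto simp: lo_def hi_def min_def max_def)

lemma S_unit: "set \<sigma> \<subseteq> {..k} \<Longrightarrow> 0 \<le> lo \<sigma> \<and> hi \<sigma> \<le> 1"
  using lo_hi_in_K[of \<sigma>] K_subset by auto

lemma S_append_Icc:
  assumes "set \<omega> \<subseteq> {..k}"
  shows "lo \<sigma> \<le> lo (\<sigma> @ \<omega>) \<and> hi (\<sigma> @ \<omega>) \<le> hi \<sigma>"
proof -
  have "S \<omega> 0 \<in> {0..1}" "S \<omega> 1 \<in> {0..1}"
    using S_K[OF assms K_ends(1)] S_K[OF assms K_ends(2)] K_subset by auto
  from this[THEN S_mem, of \<sigma>] show ?thesis
    unfolding lo_def[of "\<sigma> @ \<omega>"] hi_def[of "\<sigma> @ \<omega>"] by (simp add: S_append)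
qed

end

section \<open>Net intervals\<close>

context ifs
begin

lemma net_points_eq: "net_points n = lo ` \<Lambda> n \<union> hi ` \<Lambda> n"
  by (force simp: net_points_def lo_def hi_def min_def max_def image_iff)

lemma lo_hi_net_points: "\<sigma> \<in> \<Lambda> n \<Longrightarrow> lo \<sigma> \<in> net_points n \<and> hi \<sigma> \<in> net_points n"
  by (simp add: net_points_eq)

lemma finite_net_points: "finite (net_points n)"
  by (simp add: net_points_def finite_\<Lambda>)

lemma net_points_K: "net_points n \<subseteq> K"
  using lo_hi_in_K \<Lambda>_letters by (auto simp: net_points_eq)

lemma net_points_unit: "net_points n \<subseteq> {0..1}"
  using net_points_K K_subset by blast

lemma end_of_S:
  assumes "set \<omega> \<subseteq> {..k}" "e \<in> {0, 1}" "e = S \<omega> z" "z \<in> K"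
  shows "z \<in> {0, 1}"
proof (rule ccontr)
  assume "z \<notin> {0, 1}"
  then have "0 < z" "z < 1" using \<open>z \<in> K\<close> K_subset by (auto simp: less_le)
  then show False using S_mem_open[OF assms(1)] S_unit[OF assms(1)] assms(2,3) by fastforce
qed

text \<open>An end of \<open>S \<sigma> ` {0..1}\<close> stays a net point in the next generation: the ends of the hull of
  \<open>K\<close> belong to \<open>K\<close>, so each of them is an end of some smaller copy of the hull.\<close>

lemma net_points_Suc: "net_points n \<subseteq> net_points (Suc n)"
proof
  fix y assume "y \<in> net_points n"
  then obtain \<sigma> e where \<sigma>: "\<sigma> \<in> \<Lambda> n" "e \<in> {0, 1}" "y = S \<sigma> e"
    by (auto simp: net_points_def)
  have "0 < r_min ^ Suc n" "e \<in> K" using r_min_pos \<sigma>(2) K_ends by auto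
  then obtain \<omega> z where \<omega>: "\<omega> \<in> stop_words (ratio \<sigma>) (r_min ^ Suc n)" "z \<in> K" "e = S \<omega> z"
    using K_stop_words by blast
  have "set \<omega> \<subseteq> {..k}" using \<omega>(1) by (simp add: stop_words_def)
  then have "z \<in> {0, 1}" using end_of_S \<sigma>(2) \<omega> by blast
  moreover have "\<sigma> @ \<omega> \<in> \<Lambda> (Suc n)" using append_in_\<Lambda>_Suc \<sigma>(1) \<omega>(1) by simp
  moreover have "y = S (\<sigma> @ \<omega>) z" using \<sigma>(3) \<omega>(3) by (simp add: S_append)
  ultimately show "y \<in> net_points (Suc n)" unfolding net_points_def by blast
qed

lemma net_points_mono: "m \<le> n \<Longrightarrow> net_points m \<subseteq> net_points n"
  using lift_Suc_mono_le[of net_points, OF net_points_Suc] .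

lemma net_points_0: "net_points 0 = {0, 1}"
  by (auto simp: net_points_def \<Lambda>_def)

lemma net_points_ends: "0 \<in> net_points n" "1 \<in> net_points n"
  using net_points_mono[of 0 n] by (auto simp: net_points_0)

text \<open>Otherwise \<open>K\<close> would be \<open>{0, 1}\<close>; but \<open>S [0]\<close> maps 0 and 1 to points of \<open>K\<close> whose distance is
  neither 0 nor 1.\<close>

lemma K_interior: "\<exists>y\<in>K. 0 < y \<and> y < 1"
proof (rule ccontr)
  assume no: "\<not> ?thesis"
  have "d 0 \<in> K" "r 0 + d 0 \<in> K" using K_step[of 0 0] K_step[of 0 1] K_ends by auto
  then have "d 0 \<in> {0, 1}" "r 0 + d 0 \<in> {0, 1}" using no K_subset by (force simp: less_le)+
  then show False using ratio_pos[of 0] ratio_less_1[of 0] by auto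
qed

lemma net_interval_iff: "\<Delta> \<in> net_intervals n \<longleftrightarrow>
    fst \<Delta> \<in> net_points n \<and> snd \<Delta> \<in> net_points n \<and> fst \<Delta> < snd \<Delta> \<and>
    {fst \<Delta><..<snd \<Delta>} \<inter> net_points n = {} \<and> {fst \<Delta><..<snd \<Delta>} \<inter> K \<noteq> {}"
proof (cases "n = 0")
  case True
  have "{0<..<1} \<inter> K \<noteq> {}" using K_interior by auto
  then show ?thesis using True by (cases \<Delta>) (auto simp: net_intervals_def net_points_0)
qed (auto simp: net_intervals_def split: prod.splits)

lemma net_interval_less: "\<Delta> \<in> net_intervals n \<Longrightarrow> fst \<Delta> < snd \<Delta>"
  by (simp add: net_interval_iff)

lemma net_interval_unit: "\<Delta> \<in> net_intervals n \<Longrightarrow> 0 \<le> fst \<Delta> \<and> snd \<Delta> \<le> 1"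
  using net_points_unit[of n] by (auto simp: net_interval_iff)

lemma net_interval_no_point:
  "\<Delta> \<in> net_intervals n \<Longrightarrow> y \<in> net_points n \<Longrightarrow> y \<le> fst \<Delta> \<or> snd \<Delta> \<le> y"
  unfolding net_interval_iff by (metis disjoint_iff greaterThanLessThan_iff not_le)

lemma finite_net_intervals: "finite (net_intervals n)"
proof (rule finite_subset)
  show "net_intervals n \<subseteq> net_points n \<times> net_points n"
    by (auto simp: net_interval_iff)
qed (simp add: finite_net_points)

text \<open>The ends of \<open>D\<close> are net points of generation \<open>m\<close> too, so they do not lie inside \<open>\<Delta>\<close>.\<close>

lemma net_interval_nested:
  assumes "\<Delta> \<in> net_intervals m" "D \<in> net_intervals n" "n \<le> m"
    and "fst \<Delta> < snd D" "fst D < snd \<Delta>"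
  shows "fst D \<le> fst \<Delta> \<and> snd \<Delta> \<le> snd D"
proof -
  have "fst D \<in> net_points m" "snd D \<in> net_points m"
    using assms(2) net_points_mono[OF \<open>n \<le> m\<close>] by (auto simp: net_interval_iff)
  then show ?thesis using net_interval_no_point[OF assms(1)] assms(4,5) by fastforce
qed

lemma net_interval_eq:
  assumes "\<Delta> \<in> net_intervals n" "D \<in> net_intervals n" "fst \<Delta> < snd D" "fst D < snd \<Delta>"
  shows "\<Delta> = D"
  using net_interval_nested[OF assms(1,2)] net_interval_nested[OF assms(2,1)] assms
  by (simp add: prod_eq_iff)

lemma net_cell:
  assumes "y \<in> {0..1}" "y \<notin> net_points n"
  shows "\<exists>a\<in>net_points n. \<exists>b\<in>net_points n. a < y \<and> y < b \<and> {a<..<b} \<inter> net_points n = {}"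
proof -
  define A where "A = {z \<in> net_points n. z < y}"
  define B where "B = {z \<in> net_points n. y < z}"
  have "y \<noteq> 0" "y \<noteq> 1" using assms(2) net_points_ends by auto
  then have "0 \<in> A" "1 \<in> B" using assms(1) net_points_ends by (auto simp: A_def B_def)
  moreover have "finite A" "finite B" using finite_net_points by (auto simp: A_def B_def)
  ultimately have "Max A \<in> A" "Min B \<in> B" and
    m: "\<And>z. z \<in> A \<Longrightarrow> z \<le> Max A" "\<And>z. z \<in> B \<Longrightarrow> Min B \<le> z"
    by (auto intro: Max_in Min_in)
  moreover have "{Max A<..<Min B} \<inter> net_points n = {}"
  proof -
    have False if z: "z \<in> net_points n" "Max A < z" "z < Min B" for z
    proof -
      have "z \<noteq> y" using z assms(2) by auto
      then have "z \<in> A \<or> z \<in> B" using z by (auto simp: A_def B_def)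
      then show False using m z by force
    qed
    then show ?thesis by fastforce
  qed
  ultimately show ?thesis
    by (intro bexI[of _ "Max A"] bexI[of _ "Min B"]) (auto simp: A_def B_def)
qed

lemma childrenD:
  assumes "\<Delta> \<in> children n D"
  shows "\<Delta> \<in> net_intervals (Suc n)" "fst D \<le> fst \<Delta>" "snd \<Delta> \<le> snd D" "fst \<Delta> < snd \<Delta>"
proof -
  show *: "\<Delta> \<in> net_intervals (Suc n)" using assms by (simp add: children_def)
  show "fst \<Delta> < snd \<Delta>" by (rule net_interval_less[OF *])
  then show "fst D \<le> fst \<Delta>" "snd \<Delta> \<le> snd D" using assms by (auto simp: children_def)
qed

lemma childrenI:
  "\<Delta> \<in> net_intervals (Suc n) \<Longrightarrow> fst D \<le> fst \<Delta> \<Longrightarrow> snd \<Delta> \<le> snd D \<Longrightarrow> \<Delta> \<in> children n D"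
  by (auto simp: children_def)

lemma finite_children: "finite (children n D)"
  using finite_net_intervals by (auto simp: children_def)

lemma parent_exists:
  assumes "\<Delta> \<in> net_intervals (Suc n)"
  shows "\<exists>D\<in>net_intervals n. \<Delta> \<in> children n D"
proof -
  define y where "y = (fst \<Delta> + snd \<Delta>) / 2"
  have y: "fst \<Delta> < y" "y < snd \<Delta>" using net_interval_less[OF assms] by (auto simp: y_def)
  have "y \<notin> net_points n" using net_interval_no_point[OF assms] net_points_Suc y by fastforce
  moreover have "y \<in> {0..1}" using net_interval_unit[OF assms] y by auto
  ultimately obtain a b where ab: "a \<in> net_points n" "b \<in> net_points n" "a < y" "y < b"
    "{a<..<b} \<inter> net_points n = {}" using net_cell by blast
  have le: "a \<le> fst \<Delta>" "snd \<Delta> \<le> b"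
    using net_interval_no_point[OF assms] ab net_points_Suc y by (meson le_less_trans not_le subsetD order_trans less_imp_le)+
  obtain z where "z \<in> K" "fst \<Delta> < z" "z < snd \<Delta>" using assms by (auto simp: net_interval_iff)
  then have "z \<in> {a<..<b} \<inter> K" using le by auto
  then have "(a, b) \<in> net_intervals n" using ab by (auto simp: net_interval_iff)
  then show ?thesis using childrenI[OF assms, of "(a, b)"] le by auto
qed

lemma parent_unique:
  assumes "D \<in> net_intervals n" "D' \<in> net_intervals n" "\<Delta> \<in> children n D" "\<Delta> \<in> children n D'"
  shows "D = D'"
  using net_interval_eq[OF assms(1,2)] childrenD[OF assms(3)] childrenD[OF assms(4)] by linarith

lemma parent_eq:
  assumes "D \<in> net_intervals n" "\<Delta> \<in> children n D"
  shows "parent n \<Delta> = D"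
  unfolding parent_def using assms parent_unique by (intro the_equality) blast+

definition covers :: "nat \<Rightarrow> ivl \<Rightarrow> nat list set" where
  "covers n \<Delta> = {\<sigma> \<in> \<Lambda> n. {fst \<Delta>..snd \<Delta>} \<subseteq> S \<sigma> ` {0..1}}"

lemma covers_iff:
  "\<Delta> \<in> net_intervals n \<Longrightarrow> \<sigma> \<in> covers n \<Delta> \<longleftrightarrow> \<sigma> \<in> \<Lambda> n \<and> lo \<sigma> \<le> fst \<Delta> \<and> snd \<Delta> \<le> hi \<sigma>"
  using net_interval_less[of \<Delta> n] by (auto simp: covers_def S_Icc)

text \<open>The ends of \<open>S \<sigma> ` {0..1}\<close> are net points, so they do not lie inside \<open>\<Delta>\<close>.\<close>

lemma covers_if_meets:
  assumes "\<Delta> \<in> net_intervals n" "\<sigma> \<in> \<Lambda> n" "lo \<sigma> < snd \<Delta>" "fst \<Delta> < hi \<sigma>"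
  shows "\<sigma> \<in> covers n \<Delta>"
  using net_interval_no_point[OF assms(1), of "lo \<sigma>"] net_interval_no_point[OF assms(1), of "hi \<sigma>"]
    lo_hi_net_points[OF assms(2)] assms by (auto simp: covers_iff)

lemma covers_nonempty:
  assumes "\<Delta> \<in> net_intervals n"
  shows "covers n \<Delta> \<noteq> {}"
proof -
  obtain y where y: "y \<in> K" "fst \<Delta> < y" "y < snd \<Delta>" using assms by (auto simp: net_interval_iff)
  obtain \<sigma> z where \<sigma>: "\<sigma> \<in> \<Lambda> n" "z \<in> K" "y = S \<sigma> z"
    using K_stop_words[of "r_min ^ n" y 1] y(1) r_min_pos by (auto simp: \<Lambda>_eq_stop_words)
  have "y \<in> {lo \<sigma>..hi \<sigma>}" using S_mem \<sigma> K_subset by blast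
  then show ?thesis using covers_if_meets[OF assms \<sigma>(1)] y by fastforce
qed

lemma finite_covers: "finite (covers n \<Delta>)"
  using finite_\<Lambda> by (auto simp: covers_def)

lemma covers_Suc_prefix:
  assumes "D \<in> net_intervals n" "\<Delta> \<in> children n D" "\<tau> \<in> covers (Suc n) \<Delta>"
  shows "\<exists>\<sigma> \<omega>. \<tau> = \<sigma> @ \<omega> \<and> \<sigma> \<in> covers n D \<and> \<omega> \<in> stop_words (ratio \<sigma>) (r_min ^ Suc n)"
proof -
  have \<Delta>: "\<Delta> \<in> net_intervals (Suc n)" using childrenD[OF assms(2)] by blast
  have \<tau>: "\<tau> \<in> \<Lambda> (Suc n)" "lo \<tau> \<le> fst \<Delta>" "snd \<Delta> \<le> hi \<tau>" using assms(3) covers_iff[OF \<Delta>] by auto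
  obtain \<sigma> \<omega> where \<sigma>: "\<tau> = \<sigma> @ \<omega>" "\<sigma> \<in> \<Lambda> n" "\<omega> \<in> stop_words (ratio \<sigma>) (r_min ^ Suc n)"
    using \<Lambda>_Suc_prefix[OF \<tau>(1)] by blast
  have "lo \<sigma> \<le> lo \<tau>" "hi \<tau> \<le> hi \<sigma>"
    using S_append_Icc[of \<omega> \<sigma>] \<sigma> by (auto simp: stop_words_def)
  then have "lo \<sigma> < snd D" "fst D < hi \<sigma>" using \<tau> childrenD[OF assms(2)] by linarith+
  then show ?thesis using covers_if_meets[OF assms(1) \<sigma>(2)] \<sigma> by blast
qed

lemma net_interval_length:
  assumes "\<Delta> \<in> net_intervals n"
  shows "snd \<Delta> - fst \<Delta> \<le> r_min ^ n"
proof -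
  obtain \<sigma> where "\<sigma> \<in> covers n \<Delta>" using covers_nonempty[OF assms] by blast
  then show ?thesis using covers_iff[OF assms] hi_minus_lo[of \<sigma>] \<Lambda>_ratio_le[of \<sigma> n] by fastforce
qed

lemma linorder_lex: "class.linorder (\<lambda>u v. lex_less u v \<or> u = v) lex_less"
  by unfold_locales (auto simp: lex_less_def prod_eq_iff)

text \<open>A finite set has exactly one strictly increasing enumeration, so the neighbour set is well
  defined.\<close>

lemma nbr_set_props: "sorted_wrt lex_less (nbr_set n \<Delta>) \<and> set (nbr_set n \<Delta>) = nbr n \<Delta> ` covers n \<Delta>"
proof -
  interpret lx: linorder "\<lambda>u v. lex_less u v \<or> u = v" lex_less by (rule linorder_lex)
  have fin: "finite (nbr n \<Delta> ` covers n \<Delta>)" using finite_covers by blast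
  have "\<exists>!xs. sorted_wrt lex_less xs \<and> set xs = nbr n \<Delta> ` covers n \<Delta>"
  proof (rule ex1I)
    show "sorted_wrt lex_less (lx.sorted_list_of_set (nbr n \<Delta> ` covers n \<Delta>)) \<and>
       set (lx.sorted_list_of_set (nbr n \<Delta> ` covers n \<Delta>)) = nbr n \<Delta> ` covers n \<Delta>"
      using lx.strict_sorted_list_of_set lx.set_sorted_list_of_set[OF fin] by (intro conjI)
    fix xs assume "sorted_wrt lex_less xs \<and> set xs = nbr n \<Delta> ` covers n \<Delta>"
    then show "xs = lx.sorted_list_of_set (nbr n \<Delta> ` covers n \<Delta>)"
      using lx.strict_sorted_list_of_set lx.set_sorted_list_of_set[OF fin]
      by (intro lx.strict_sorted_equal) simp_all
  qed
  from theI'[OF this] show ?thesis unfolding nbr_set_def covers_def .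
qed

lemma set_nbr_set: "set (nbr_set n \<Delta>) = nbr n \<Delta> ` covers n \<Delta>"
  using nbr_set_props by blast

lemma distinct_nbr_set: "distinct (nbr_set n \<Delta>)"
proof -
  interpret lx: linorder "\<lambda>u v. lex_less u v \<or> u = v" lex_less by (rule linorder_lex)
  show ?thesis using nbr_set_props lx.strict_sorted_iff by blast
qed

lemma nbr_set_cong:
  assumes "nbr n \<Delta> ` covers n \<Delta> = nbr m \<Delta>' ` covers m \<Delta>'"
  shows "nbr_set n \<Delta> = nbr_set m \<Delta>'"
proof -
  interpret lx: linorder "\<lambda>u v. lex_less u v \<or> u = v" lex_less by (rule linorder_lex)
  show ?thesis using nbr_set_props assms lx.strict_sorted_equal by metis
qed

end

section \<open>Similar net intervals\<close>

context ifs
begin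

text \<open>Two net intervals with the same normalized length and neighbour set differ by an increasing
  similarity that carries everything the later generations see of one interval to the other; the
  next definitions are the relation and that similarity.\<close>

definition similar :: "nat \<Rightarrow> ivl \<Rightarrow> nat \<Rightarrow> ivl \<Rightarrow> bool" where
  "similar n D m E \<longleftrightarrow> D \<in> net_intervals n \<and> E \<in> net_intervals m \<and>
     norm_length n D = norm_length m E \<and> nbr_set n D = nbr_set m E"

definition xfer :: "nat \<Rightarrow> ivl \<Rightarrow> nat \<Rightarrow> ivl \<Rightarrow> real \<Rightarrow> real" where
  "xfer n D m E y = fst E + r_min ^ m / r_min ^ n * (y - fst D)"

definition xfer_ivl :: "nat \<Rightarrow> ivl \<Rightarrow> nat \<Rightarrow> ivl \<Rightarrow> ivl \<Rightarrow> ivl" where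
  "xfer_ivl n D m E \<Delta> = (xfer n D m E (fst \<Delta>), xfer n D m E (snd \<Delta>))"

lemma similar_sym: "similar n D m E \<Longrightarrow> similar m E n D"
  by (auto simp: similar_def)

lemma xfer_inverse: "xfer m E n D (xfer n D m E y) = y"
  using r_min_pos by (simp add: xfer_def)

lemma xfer_ivl_inverse: "xfer_ivl m E n D (xfer_ivl n D m E \<Delta>) = \<Delta>"
  by (simp add: xfer_ivl_def xfer_inverse)

lemma xfer_less: "xfer n D m E y < xfer n D m E z \<longleftrightarrow> y < z"
  using r_min_pos by (simp add: xfer_def divide_less_cancel)

lemma xfer_le: "xfer n D m E y \<le> xfer n D m E z \<longleftrightarrow> y \<le> z"
  using xfer_less[of n D m E z y] by (simp flip: not_less)

lemma xfer_fst: "xfer n D m E (fst D) = fst E"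
  by (simp add: xfer_def)

lemma xfer_snd:
  assumes "similar n D m E"
  shows "xfer n D m E (snd D) = snd E"
proof -
  have "(snd D - fst D) / r_min ^ n = (snd E - fst E) / r_min ^ m"
    using assms by (simp add: similar_def norm_length_def)
  then have "r_min ^ m / r_min ^ n * (snd D - fst D) = snd E - fst E"
    using r_min_pos by (simp add: field_simps)
  then show ?thesis by (simp add: xfer_def)
qed

lemma similar_D:
  assumes "similar n D m E"
  shows "D \<in> net_intervals n" "E \<in> net_intervals m"
  using assms by (auto simp: similar_def)

lemma S_eq_nbr: "S \<tau> y = fst \<Delta> + r_min ^ n * (snd (nbr n \<Delta> \<tau>) * y - fst (nbr n \<Delta> \<tau>))"
proof -
  have "r_min ^ n * (a / r_min ^ n * y - b / r_min ^ n) = a * y - b" for a b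
    using r_min_pos by (simp add: field_simps)
  then show ?thesis using S_affine[of \<tau> y] by (simp add: nbr_def)
qed

lemma nbr_eq_xfer:
  assumes "nbr n D \<sigma> = nbr m E \<sigma>'"
  shows "S \<sigma>' y = xfer n D m E (S \<sigma> y)"
  unfolding S_eq_nbr[of \<sigma>' y E m] S_eq_nbr[of \<sigma> y D n] assms xfer_def
  using r_min_pos by simp

lemma nbr_eq_ratio:
  assumes "nbr n D \<sigma> = nbr m E \<sigma>'"
  shows "ratio \<sigma>' = r_min ^ m / r_min ^ n * ratio \<sigma>"
  using assms r_min_pos by (simp add: nbr_def field_simps)

lemma nbr_eq_stop_words:
  assumes "nbr n D \<sigma> = nbr m E \<sigma>'"
  shows "stop_words (ratio \<sigma>') (r_min ^ Suc m) = stop_words (ratio \<sigma>) (r_min ^ Suc n)"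
proof -
  have q: "0 < r_min ^ m / r_min ^ n" using r_min_pos by simp
  have eq: "r_min ^ Suc m = r_min ^ m / r_min ^ n * r_min ^ Suc n" using r_min_pos by simp
  show ?thesis unfolding nbr_eq_ratio[OF assms] eq by (rule stop_words_scale[OF q])
qed

lemma nbr_xfer_append:
  assumes "nbr n D \<sigma> = nbr m E \<sigma>'"
  shows "nbr (Suc m) (xfer_ivl n D m E \<Delta>) (\<sigma>' @ \<omega>) = nbr (Suc n) \<Delta> (\<sigma> @ \<omega>)"
proof -
  have "xfer n D m E y - xfer n D m E z = r_min ^ m / r_min ^ n * (y - z)" for y z
    unfolding xfer_def by (simp only: add_diff_cancel_left right_diff_distrib[symmetric]) simp
  then have "xfer n D m E (fst \<Delta>) - S (\<sigma>' @ \<omega>) 0 = r_min ^ m / r_min ^ n * (fst \<Delta> - S (\<sigma> @ \<omega>) 0)"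
    using nbr_eq_xfer[OF assms] by (simp add: S_append)
  moreover have "q / p * z / (r_min * q) = z / (r_min * p)" if "0 < p" "0 < q" for p q z :: real
    using that r_min_pos by (simp add: field_simps)
  ultimately show ?thesis using nbr_eq_ratio[OF assms] r_min_pos
    by (simp add: nbr_def xfer_ivl_def mult.assoc del: times_divide_eq_left)
qed

lemma similar_covers:
  assumes "similar n D m E" "\<sigma> \<in> covers n D"
  shows "\<exists>\<sigma>'\<in>covers m E. nbr n D \<sigma> = nbr m E \<sigma>'"
proof -
  have "nbr n D \<sigma> \<in> set (nbr_set m E)"
    using assms set_nbr_set[of n D] by (auto simp: similar_def)
  then show ?thesis using set_nbr_set[of m E] by auto
qed

lemma covers_letters: "\<sigma> \<in> covers n D \<Longrightarrow> set \<sigma> \<subseteq> {..k}"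
  by (auto simp: covers_def dest: \<Lambda>_letters)

lemma covers_\<Lambda>: "\<sigma> \<in> covers n D \<Longrightarrow> \<sigma> \<in> \<Lambda> n"
  by (auto simp: covers_def)

lemma append_stop_words:
  assumes "\<sigma> \<in> \<Lambda> n" "\<omega> \<in> stop_words (ratio \<sigma>) (r_min ^ Suc n)"
  shows "\<sigma> @ \<omega> \<in> \<Lambda> (Suc n)"
  using assms append_in_\<Lambda>_Suc by blast

lemma K_in_cover:
  assumes "D \<in> net_intervals n" "y \<in> K" "fst D < y" "y < snd D"
  shows "\<exists>\<sigma>\<in>covers n D. \<exists>z\<in>K. y = S \<sigma> z"
proof -
  obtain \<sigma> z where \<sigma>: "\<sigma> \<in> \<Lambda> n" "z \<in> K" "y = S \<sigma> z"
    using K_stop_words[of "r_min ^ n" y 1] assms(2) r_min_pos by (auto simp: \<Lambda>_eq_stop_words)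
  have "y \<in> {lo \<sigma>..hi \<sigma>}" using S_mem \<sigma> K_subset by blast
  then have "\<sigma> \<in> covers n D" using covers_if_meets[OF assms(1) \<sigma>(1)] assms by auto
  then show ?thesis using \<sigma> by blast
qed

lemma xfer_K:
  assumes "similar n D m E" "y \<in> K" "fst D < y" "y < snd D"
  shows "xfer n D m E y \<in> K"
proof -
  obtain \<sigma> z where \<sigma>: "\<sigma> \<in> covers n D" "z \<in> K" "y = S \<sigma> z"
    using K_in_cover similar_D[OF assms(1)] assms by blast
  obtain \<sigma>' where \<sigma>': "\<sigma>' \<in> covers m E" "nbr n D \<sigma> = nbr m E \<sigma>'"
    using similar_covers[OF assms(1) \<sigma>(1)] by blast
  then show ?thesis using nbr_eq_xfer[OF \<sigma>'(2), of z] S_K[OF covers_letters[OF \<sigma>'(1)] \<sigma>(2)] \<sigma>(3)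
    by simp
qed

text \<open>Only words that cover \<open>D\<close> reach inside \<open>D\<close>. They correspond to words that cover \<open>E\<close>, and
  corresponding words have the same continuations in the next generation.\<close>

lemma xfer_net_points:
  assumes "similar n D m E" "y \<in> net_points (Suc n)" "fst D \<le> y" "y \<le> snd D"
  shows "xfer n D m E y \<in> net_points (Suc m)"
proof -
  have D: "D \<in> net_intervals n" "E \<in> net_intervals m" using similar_D[OF assms(1)] by auto
  then have ends: "fst E \<in> net_points (Suc m)" "snd E \<in> net_points (Suc m)"
    using net_points_Suc by (auto simp: net_interval_iff)
  show ?thesis
  proof (cases "y = fst D \<or> y = snd D")
    case True
    then show ?thesis using ends xfer_fst[of n D m E] xfer_snd[OF assms(1)] by auto
  next
    case False
    then have y: "fst D < y" "y < snd D" using assms by auto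
    obtain \<tau> e where \<tau>: "\<tau> \<in> \<Lambda> (Suc n)" "e \<in> {0, 1}" "y = S \<tau> e"
      using assms(2) by (auto simp: net_points_def)
    obtain \<sigma> \<omega> where \<sigma>: "\<tau> = \<sigma> @ \<omega>" "\<sigma> \<in> \<Lambda> n" "\<omega> \<in> stop_words (ratio \<sigma>) (r_min ^ Suc n)"
      using \<Lambda>_Suc_prefix[OF \<tau>(1)] by blast
    have "y \<in> {lo \<tau>..hi \<tau>}" using S_mem \<tau> by auto
    moreover have "lo \<sigma> \<le> lo \<tau>" "hi \<tau> \<le> hi \<sigma>"
      using S_append_Icc[of \<omega> \<sigma>] \<sigma> by (auto simp: stop_words_def)
    ultimately have "\<sigma> \<in> covers n D" using covers_if_meets[OF D(1) \<sigma>(2)] y by auto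
    then obtain \<sigma>' where \<sigma>': "\<sigma>' \<in> covers m E" "nbr n D \<sigma> = nbr m E \<sigma>'"
      using similar_covers[OF assms(1)] by blast
    have "\<sigma>' @ \<omega> \<in> \<Lambda> (Suc m)"
      using append_stop_words[OF covers_\<Lambda>[OF \<sigma>'(1)]] nbr_eq_stop_words[OF \<sigma>'(2)] \<sigma>(3) by simp
    moreover have "xfer n D m E y = S (\<sigma>' @ \<omega>) e"
      using nbr_eq_xfer[OF \<sigma>'(2)] \<tau>(3) \<sigma>(1) by (simp add: S_append)
    ultimately show ?thesis using \<tau>(2) unfolding net_points_def by blast
  qed
qed

lemma xfer_children:
  assumes "similar n D m E" "\<Delta> \<in> children n D"
  shows "xfer_ivl n D m E \<Delta> \<in> children m E"
proof (rule childrenI)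
  note \<Delta> = childrenD[OF assms(2)]
  let ?f = "xfer n D m E" and ?g = "xfer m E n D"
  show le: "fst E \<le> fst (xfer_ivl n D m E \<Delta>)" "snd (xfer_ivl n D m E \<Delta>) \<le> snd E"
    using \<Delta> xfer_le[of n D m E "fst D"] xfer_le[of n D m E _ "snd D"] xfer_fst[of n D m E] xfer_snd[OF assms(1)]
    by (auto simp: xfer_ivl_def)
  have "?f (fst \<Delta>) \<in> net_points (Suc m)" "?f (snd \<Delta>) \<in> net_points (Suc m)"
    using \<Delta> xfer_net_points[OF assms(1)] by (auto simp: net_interval_iff)
  moreover have "?f (fst \<Delta>) < ?f (snd \<Delta>)" using \<Delta> by (simp add: xfer_less)
  moreover have "z \<notin> net_points (Suc m)" if z: "?f (fst \<Delta>) < z" "z < ?f (snd \<Delta>)" for z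
  proof
    assume "z \<in> net_points (Suc m)"
    then have "?g z \<in> net_points (Suc n)"
      using xfer_net_points[OF similar_sym[OF assms(1)]] le z by (simp add: xfer_ivl_def)
    moreover have "fst \<Delta> < ?g z" "?g z < snd \<Delta>"
      using z xfer_less[of m E n D "?f (fst \<Delta>)" z] xfer_less[of m E n D z "?f (snd \<Delta>)"]
      by (simp_all add: xfer_inverse)
    ultimately show False using net_interval_no_point[OF \<Delta>(1)] by fastforce
  qed
  moreover obtain y where "y \<in> K" "fst \<Delta> < y" "y < snd \<Delta>" using \<Delta>(1) by (auto simp: net_interval_iff)
  then have "?f y \<in> {?f (fst \<Delta>)<..<?f (snd \<Delta>)} \<inter> K"
    using xfer_K[OF assms(1), of y] \<Delta> by (auto simp: xfer_less)
  ultimately show "xfer_ivl n D m E \<Delta> \<in> net_intervals (Suc m)"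
    unfolding net_interval_iff xfer_ivl_def fst_conv snd_conv by (intro conjI) auto
qed

lemma xfer_norm_length: "norm_length (Suc m) (xfer_ivl n D m E \<Delta>) = norm_length (Suc n) \<Delta>"
  using r_min_pos by (simp add: norm_length_def xfer_ivl_def xfer_def field_simps)

lemma xfer_nbr_subset:
  assumes "similar n D m E" "\<Delta> \<in> children n D"
  shows "nbr (Suc n) \<Delta> ` covers (Suc n) \<Delta> \<subseteq>
    nbr (Suc m) (xfer_ivl n D m E \<Delta>) ` covers (Suc m) (xfer_ivl n D m E \<Delta>)"
proof (rule image_subsetI)
  fix \<tau> assume \<tau>: "\<tau> \<in> covers (Suc n) \<Delta>"
  obtain \<sigma> \<omega> where \<sigma>: "\<tau> = \<sigma> @ \<omega>" "\<sigma> \<in> covers n D" "\<omega> \<in> stop_words (ratio \<sigma>) (r_min ^ Suc n)"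
    using covers_Suc_prefix[OF similar_D(1)[OF assms(1)] assms(2) \<tau>] by blast
  obtain \<sigma>' where \<sigma>': "\<sigma>' \<in> covers m E" "nbr n D \<sigma> = nbr m E \<sigma>'"
    using similar_covers[OF assms(1) \<sigma>(2)] by blast
  have f: "S (\<sigma>' @ \<omega>) e = xfer n D m E (S \<tau> e)" for e
    using nbr_eq_xfer[OF \<sigma>'(2)] \<sigma>(1) by (simp add: S_append)
  have mono: "mono (xfer n D m E)" by (auto intro!: monoI simp: xfer_le)
  have "lo (\<sigma>' @ \<omega>) = xfer n D m E (lo \<tau>)" "hi (\<sigma>' @ \<omega>) = xfer n D m E (hi \<tau>)"
    by (simp_all add: lo_def hi_def f min_of_mono[OF mono] max_of_mono[OF mono])
  moreover have "\<sigma>' @ \<omega> \<in> \<Lambda> (Suc m)"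
    using append_stop_words[OF covers_\<Lambda>[OF \<sigma>'(1)]] nbr_eq_stop_words[OF \<sigma>'(2)] \<sigma>(3) by simp
  ultimately have "\<sigma>' @ \<omega> \<in> covers (Suc m) (xfer_ivl n D m E \<Delta>)"
    using \<tau> covers_iff childrenD(1)[OF assms(2)] childrenD(1)[OF xfer_children[OF assms]]
    by (simp add: xfer_ivl_def xfer_le)
  moreover have "nbr (Suc n) \<Delta> \<tau> = nbr (Suc m) (xfer_ivl n D m E \<Delta>) (\<sigma>' @ \<omega>)"
    using nbr_xfer_append[OF \<sigma>'(2)] \<sigma>(1) by simp
  ultimately show "nbr (Suc n) \<Delta> \<tau> \<in>
      nbr (Suc m) (xfer_ivl n D m E \<Delta>) ` covers (Suc m) (xfer_ivl n D m E \<Delta>)" by blast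
qed

lemma xfer_nbr_set:
  assumes "similar n D m E" "\<Delta> \<in> children n D"
  shows "nbr_set (Suc m) (xfer_ivl n D m E \<Delta>) = nbr_set (Suc n) \<Delta>"
proof (rule nbr_set_cong, rule equalityI)
  show "nbr (Suc m) (xfer_ivl n D m E \<Delta>) ` covers (Suc m) (xfer_ivl n D m E \<Delta>)
    \<subseteq> nbr (Suc n) \<Delta> ` covers (Suc n) \<Delta>"
    using xfer_nbr_subset[OF similar_sym[OF assms(1)] xfer_children[OF assms]]
    by (simp add: xfer_ivl_inverse)
qed (rule xfer_nbr_subset[OF assms])

lemma xfer_charvec:
  assumes "similar n D m E" "\<Delta> \<in> children n D"
  shows "charvec (Suc m) (xfer_ivl n D m E \<Delta>) = charvec (Suc n) \<Delta>"
proof -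
  let ?f = "xfer_ivl n D m E" and ?g = "xfer_ivl m E n D"
  let ?A = "{\<Delta>' \<in> children n D. norm_length (Suc n) \<Delta>' = norm_length (Suc n) \<Delta> \<and>
    nbr_set (Suc n) \<Delta>' = nbr_set (Suc n) \<Delta> \<and> fst \<Delta>' \<le> fst \<Delta>}"
  let ?B = "{\<Delta>' \<in> children m E. norm_length (Suc m) \<Delta>' = norm_length (Suc m) (?f \<Delta>) \<and>
    nbr_set (Suc m) \<Delta>' = nbr_set (Suc m) (?f \<Delta>) \<and> fst \<Delta>' \<le> fst (?f \<Delta>)}"
  note sym = similar_sym[OF assms(1)]
  have fst_g: "fst (?g \<Delta>') \<le> fst \<Delta>" if "fst \<Delta>' \<le> fst (?f \<Delta>)" for \<Delta>'
    using that xfer_le[of m E n D "fst \<Delta>'" "fst (?f \<Delta>)"] by (simp add: xfer_ivl_def xfer_inverse)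
  have "bij_betw ?f ?A ?B"
  proof (rule bij_betwI[where g = ?g])
    show "?f \<in> ?A \<rightarrow> ?B"
      using xfer_children[OF assms(1)] xfer_norm_length xfer_nbr_set[OF assms(1)] assms(2)
      by (auto simp: xfer_ivl_def xfer_le)
    show "?g \<in> ?B \<rightarrow> ?A"
      using xfer_children[OF sym] xfer_norm_length xfer_nbr_set[OF sym] xfer_nbr_set[OF assms]
        fst_g by auto
  qed (simp_all add: xfer_ivl_inverse)
  then have "card ?A = card ?B" by (rule bij_betw_same_card)
  then have "sibling_index (Suc m) (?f \<Delta>) = sibling_index (Suc n) \<Delta>"
    using parent_eq[OF similar_D(1)[OF assms(1)] assms(2)]
      parent_eq[OF similar_D(2)[OF assms(1)] xfer_children[OF assms]]
    by (simp add: sibling_index_def)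
  then show ?thesis by (simp add: charvec_def xfer_norm_length xfer_nbr_set[OF assms])
qed

lemma similar_if_charvec:
  "D \<in> net_intervals n \<Longrightarrow> E \<in> net_intervals m \<Longrightarrow> charvec n D = charvec m E \<Longrightarrow> similar n D m E"
  by (simp add: similar_def charvec_def)

text \<open>The index \<open>t\<close> of a characteristic vector serves to tell apart the children of one net
  interval.\<close>

lemma child_determined:
  assumes "D \<in> net_intervals n" "\<Delta> \<in> children n D" "\<Delta>' \<in> children n D"
    and "charvec (Suc n) \<Delta> = charvec (Suc n) \<Delta>'"
  shows "\<Delta> = \<Delta>'"
proof -
  define A where "A \<Gamma> = {\<Delta>'' \<in> children n D. norm_length (Suc n) \<Delta>'' = norm_length (Suc n) \<Gamma> \<and>
    nbr_set (Suc n) \<Delta>'' = nbr_set (Suc n) \<Gamma> \<and> fst \<Delta>'' \<le> fst \<Gamma>}" for \<Gamma>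
  have fin: "finite (A \<Gamma>)" for \<Gamma> using finite_children by (simp add: A_def)
  have idx: "sibling_index (Suc n) \<Gamma> = card (A \<Gamma>)" if "\<Gamma> \<in> children n D" for \<Gamma>
    using parent_eq[OF assms(1) that] by (simp add: sibling_index_def A_def)
  have less: "card (A \<Gamma>) < card (A \<Gamma>')"
    if "\<Gamma>' \<in> children n D" "fst \<Gamma> < fst \<Gamma>'" "charvec (Suc n) \<Gamma> = charvec (Suc n) \<Gamma>'" for \<Gamma> \<Gamma>'
  proof (rule psubset_card_mono[OF fin])
    have "\<Gamma>' \<in> A \<Gamma>'" "\<Gamma>' \<notin> A \<Gamma>" using that by (auto simp: A_def)
    moreover have "A \<Gamma> \<subseteq> A \<Gamma>'" using that by (auto simp: A_def charvec_def)
    ultimately show "A \<Gamma> \<subset> A \<Gamma>'" by blast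
  qed
  have "card (A \<Delta>) = card (A \<Delta>')" using assms idx by (simp add: charvec_def)
  then have "fst \<Delta> = fst \<Delta>'"
    using less[OF assms(2), of \<Delta>'] less[OF assms(3), of \<Delta>] assms(4) by force
  then show ?thesis
    using net_interval_eq[of \<Delta> "Suc n" \<Delta>'] childrenD[OF assms(2)] childrenD[OF assms(3)] by simp
qed

lemma child_eq_xfer:
  assumes "similar n D m E" "\<Delta> \<in> children n D" "\<Delta>' \<in> children m E"
    and "charvec (Suc n) \<Delta> = charvec (Suc m) \<Delta>'"
  shows "\<Delta>' = xfer_ivl n D m E \<Delta>"
  using child_determined[OF similar_D(2)[OF assms(1)] assms(3) xfer_children[OF assms(1,2)]]
    xfer_charvec[OF assms(1,2)] assms(4) by simp

lemma net_interval_path: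
  assumes "D 0 = (0, 1)" "\<And>i. i < n \<Longrightarrow> D (Suc i) \<in> children i (D i)" "i \<le> n"
  shows "D i \<in> net_intervals i"
proof (cases i)
  case (Suc j)
  then have "D (Suc j) \<in> children j (D j)" using assms(2,3) by simp
  then show ?thesis using Suc childrenD(1) by blast
qed (simp add: assms(1) net_intervals_def)

end

context self_similar_measure
begin

lemma SOME_nbr:
  assumes "D \<in> net_intervals n" "i < length (nbr_set n D)"
  shows "(SOME \<sigma>. \<sigma> \<in> \<Lambda> n \<and> nbr n D \<sigma> = nbr_set n D ! i) \<in> \<Lambda> n"
    "nbr n D (SOME \<sigma>. \<sigma> \<in> \<Lambda> n \<and> nbr n D \<sigma> = nbr_set n D ! i) = nbr_set n D ! i"
proof -
  have "nbr_set n D ! i \<in> nbr n D ` covers n D" using assms(2) set_nbr_set nth_mem by blast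
  then have "\<exists>\<sigma>. \<sigma> \<in> \<Lambda> n \<and> nbr n D \<sigma> = nbr_set n D ! i" using covers_\<Lambda> by (metis imageE)
  from someI_ex[OF this] show "(SOME \<sigma>. \<sigma> \<in> \<Lambda> n \<and> nbr n D \<sigma> = nbr_set n D ! i) \<in> \<Lambda> n"
    "nbr n D (SOME \<sigma>. \<sigma> \<in> \<Lambda> n \<and> nbr n D \<sigma> = nbr_set n D ! i) = nbr_set n D ! i" by blast+
qed

text \<open>Corresponding words \<open>\<sigma>\<close> and \<open>\<sigma>'\<close> are continued by the same \<open>\<omega>\<close>, and the continuations take
  the same places in the neighbour sets of the children.\<close>

lemma ivl_trans_mat_cong:
  assumes "similar n D m E" "\<Delta> \<in> children n D" "\<Delta>' \<in> children m E"
    and "charvec (Suc n) \<Delta> = charvec (Suc m) \<Delta>'"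
  shows "ivl_trans_mat n D \<Delta> = ivl_trans_mat m E \<Delta>'"
proof -
  have \<Delta>': "\<Delta>' = xfer_ivl n D m E \<Delta>" by (rule child_eq_xfer[OF assms])
  have eqs: "nbr_set m E = nbr_set n D" "nbr_set (Suc m) \<Delta>' = nbr_set (Suc n) \<Delta>"
    using assms by (auto simp: similar_def charvec_def)
  have *: "{\<omega>. \<sigma> @ \<omega> \<in> \<Lambda> (Suc n) \<and> nbr (Suc n) \<Delta> (\<sigma> @ \<omega>) = v}
     = {\<omega>. \<sigma>' @ \<omega> \<in> \<Lambda> (Suc m) \<and> nbr (Suc m) \<Delta>' (\<sigma>' @ \<omega>) = v}"
    if "\<sigma> \<in> \<Lambda> n" "\<sigma>' \<in> \<Lambda> m" "nbr n D \<sigma> = nbr m E \<sigma>'" for \<sigma> \<sigma>' v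
    using append_in_\<Lambda>_Suc[OF that(1)] append_in_\<Lambda>_Suc[OF that(2)] nbr_eq_stop_words[OF that(3)]
      nbr_xfer_append[OF that(3)] unfolding \<Delta>' by simp
  show ?thesis
  proof (rule eq_matI)
    fix i j assume ij: "i < dim_row (ivl_trans_mat m E \<Delta>')" "j < dim_col (ivl_trans_mat m E \<Delta>')"
    then have i: "i < length (nbr_set n D)" "i < length (nbr_set m E)" and j: "j < length (nbr_set (Suc n) \<Delta>)"
      by (auto simp: ivl_trans_mat_def eqs)
    show "ivl_trans_mat n D \<Delta> $$ (i, j) = ivl_trans_mat m E \<Delta>' $$ (i, j)"
      using i j *[OF SOME_nbr(1)[OF similar_D(1)[OF assms(1)] i(1)]
          SOME_nbr(1)[OF similar_D(2)[OF assms(1)] i(2)]]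
        SOME_nbr(2)[OF similar_D(1)[OF assms(1)] i(1)] SOME_nbr(2)[OF similar_D(2)[OF assms(1)] i(2)]
      by (simp add: ivl_trans_mat_def eqs Let_def)
  qed (simp_all add: ivl_trans_mat_def eqs)
qed

lemma trans_mat_eq:
  assumes "D \<in> net_intervals n" "\<Delta> \<in> children n D"
  shows "trans_mat (charvec n D) (charvec (Suc n) \<Delta>) = ivl_trans_mat n D \<Delta>"
proof -
  let ?P = "\<lambda>M. \<exists>m. \<exists>E\<in>net_intervals m. \<exists>\<Delta>'\<in>children m E.
     charvec n D = charvec m E \<and> charvec (Suc n) \<Delta> = charvec (Suc m) \<Delta>' \<and> M = ivl_trans_mat m E \<Delta>'"
  have "?P (trans_mat (charvec n D) (charvec (Suc n) \<Delta>))"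
    unfolding trans_mat_def by (rule someI[of ?P "ivl_trans_mat n D \<Delta>"]) (use assms in blast)
  then obtain m E \<Delta>' where E: "E \<in> net_intervals m" "\<Delta>' \<in> children m E" "charvec n D = charvec m E"
    "charvec (Suc n) \<Delta> = charvec (Suc m) \<Delta>'"
    "trans_mat (charvec n D) (charvec (Suc n) \<Delta>) = ivl_trans_mat m E \<Delta>'" by blast
  have "ivl_trans_mat n D \<Delta> = ivl_trans_mat m E \<Delta>'"
    by (rule ivl_trans_mat_cong[OF similar_if_charvec[OF assms(1) E(1,3)] assms(2) E(2,4)])
  with E(5) show ?thesis by (rule trans[OF _ sym])
qed

end

section \<open>The self-similar measure\<close>

context self_similar_measure
begin

interpretation mu: prob_space \<mu> by (rule mu_prob)

lemma space_mu: "space \<mu> = UNIV"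
  using sets_eq_imp_space_eq[OF mu_borel] by simp

lemma mu_UNIV: "measure \<mu> UNIV = 1"
  using mu.prob_space space_mu by simp

lemma mu_le_1: "measure \<mu> A \<le> 1"
  by (rule mu.prob_le_1)

lemma mu_mono: "A \<subseteq> B \<Longrightarrow> B \<in> sets borel \<Longrightarrow> measure \<mu> A \<le> measure \<mu> B"
  by (rule mu.finite_measure_mono) (simp_all add: mu_borel)

definition prob_of :: "nat list \<Rightarrow> real" where
  "prob_of \<omega> = prod_list (map p \<omega>)"

lemma prob_of_simps [simp]: "prob_of [] = 1" "prob_of (j # \<omega>) = p j * prob_of \<omega>"
  by (simp_all add: prob_of_def)

lemma prob_of_pos: "set \<omega> \<subseteq> {..k} \<Longrightarrow> 0 < prob_of \<omega>"
  using p_pos by (induction \<omega>) auto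

lemma vimage_affine_borel: "A \<in> sets borel \<Longrightarrow> (\<lambda>x. a * x + b) -` A \<in> sets borel" for a b :: real
  by (rule measurable_sets_borel[where M = borel]) auto

lemma vimage_S_borel: "A \<in> sets borel \<Longrightarrow> S \<omega> -` A \<in> sets borel"
proof -
  assume "A \<in> sets borel"
  moreover have "S \<omega> -` A = (\<lambda>x. ratio \<omega> * x + S \<omega> 0) -` A"
    by (intro Set.set_eqI) (simp add: S_affine[of \<omega>, symmetric])
  ultimately show ?thesis using vimage_affine_borel by simp
qed

lemma mu_stop_words:
  assumes "0 < t" "A \<in> sets borel"
  shows "measure \<mu> A = (\<Sum>\<omega>\<in>stop_words c t. prob_of \<omega> * measure \<mu> (S \<omega> -` A))"
  using assms
proof (induction c arbitrary: A rule: stop_words_induct)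
  case (small c)
  then show ?case by (simp add: stop_words_small)
next
  case (big c)
  let ?f = "\<lambda>j x. r j * x + d j"
  have "(\<Sum>\<omega>\<in>stop_words c t. prob_of \<omega> * measure \<mu> (S \<omega> -` A)) =
    (\<Sum>j\<le>k. \<Sum>\<omega>\<in>(#) j ` stop_words (c * r j) t. prob_of \<omega> * measure \<mu> (S \<omega> -` A))"
    unfolding stop_words_big[OF big.hyps]
    by (rule sum.UNION_disjoint) (use finite_stop_words[OF \<open>0 < t\<close>] in auto)
  also have "\<dots> = (\<Sum>j\<le>k. p j * measure \<mu> (?f j -` A))"
  proof (rule sum.cong[OF refl])
    fix j assume "j \<in> {..k}"
    have "(\<Sum>\<omega>\<in>(#) j ` stop_words (c * r j) t. prob_of \<omega> * measure \<mu> (S \<omega> -` A)) =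
      (\<Sum>\<omega>\<in>stop_words (c * r j) t. p j * (prob_of \<omega> * measure \<mu> (S \<omega> -` (?f j -` A))))"
      by (subst sum.reindex) (auto simp: S_Cons vimage_comp comp_def mult.assoc)
    also have "\<dots> = p j * measure \<mu> (?f j -` A)"
      using big.IH[of j "?f j -` A"] \<open>j \<in> {..k}\<close> vimage_affine_borel[OF big.prems]
      by (simp add: sum_distrib_left)
    finally show "(\<Sum>\<omega>\<in>(#) j ` stop_words (c * r j) t. prob_of \<omega> * measure \<mu> (S \<omega> -` A)) =
      p j * measure \<mu> (?f j -` A)" .
  qed
  also have "\<dots> = measure \<mu> A" using mu_self_similar[OF big.prems] by simp
  finally show ?case by simp
qed

lemma stop_words_letters: "\<omega> \<in> stop_words c t \<Longrightarrow> set \<omega> \<subseteq> {..k}"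
  by (simp add: stop_words_def)

lemma prob_of_sum: "0 < t \<Longrightarrow> (\<Sum>\<omega>\<in>stop_words c t. prob_of \<omega>) = 1"
  using mu_stop_words[of t UNIV c] by (simp add: mu_UNIV)

lemma mu_stop_word_le:
  assumes "0 < t" "A \<in> sets borel" "\<omega> \<in> stop_words c t"
  shows "prob_of \<omega> * measure \<mu> (S \<omega> -` A) \<le> measure \<mu> A"
  unfolding mu_stop_words[OF assms(1,2), of c]
proof (rule member_le_sum[OF assms(3)])
  show "0 \<le> prob_of \<omega> * measure \<mu> (S \<omega> -` A)" if "\<omega> \<in> stop_words c t - {\<omega>'}" for \<omega> \<omega>'
    using prob_of_pos[OF stop_words_letters[of \<omega> c t]] that by simp
qed (rule finite_stop_words[OF assms(1)])

text \<open>Pull \<open>\<mu>\<close> back to words of ratio at most \<open>t / R\<close>: these move the bulk \<open>{-R..R}\<close> of the mass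
  to within \<open>t\<close> of \<open>K\<close>.\<close>

lemma mu_near_K:
  assumes "0 < t"
  shows "measure \<mu> {y. infdist y K \<le> t} = 1"
proof -
  let ?A = "{y. infdist y K \<le> t}"
  have "closed ?A" by (intro closed_Collect_le continuous_intros)
  then have A: "?A \<in> sets borel" by simp
  have "measure \<mu> {- real (Suc n)..real (Suc n)} \<le> measure \<mu> ?A" for n
  proof -
    let ?R = "real (Suc n)"
    have tR: "0 < t / ?R" using assms by simp
    have "measure \<mu> {- ?R..?R} = (\<Sum>\<omega>\<in>stop_words 1 (t / ?R). prob_of \<omega> * measure \<mu> {- ?R..?R})"
      using prob_of_sum[OF tR, of 1] by (simp flip: sum_distrib_right)
    also have "\<dots> \<le> (\<Sum>\<omega>\<in>stop_words 1 (t / ?R). prob_of \<omega> * measure \<mu> (S \<omega> -` ?A))"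
    proof (rule sum_mono)
      fix \<omega> assume \<omega>: "\<omega> \<in> stop_words 1 (t / ?R)"
      have "{- ?R..?R} \<subseteq> S \<omega> -` ?A"
      proof
        fix y assume "y \<in> {- ?R..?R}"
        then have "\<bar>y\<bar> \<le> ?R" by auto
        moreover have "\<bar>ratio \<omega>\<bar> \<le> t / ?R" using \<omega> by (simp add: stop_words_def)
        ultimately have "\<bar>ratio \<omega>\<bar> * \<bar>y\<bar> \<le> t / ?R * ?R" by (intro mult_mono) auto
        then have "dist (S \<omega> y) (S \<omega> 0) \<le> t"
          using S_affine[of \<omega> y] by (simp add: dist_real_def abs_mult)
        moreover have "S \<omega> 0 \<in> K" using S_K stop_words_letters[OF \<omega>] K_ends by blast
        ultimately show "y \<in> S \<omega> -` ?A" using infdist_le2 by auto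
      qed
      then have "measure \<mu> {- ?R..?R} \<le> measure \<mu> (S \<omega> -` ?A)"
        by (rule mu_mono[OF _ vimage_S_borel[OF A]])
      then show "prob_of \<omega> * measure \<mu> {- ?R..?R} \<le> prob_of \<omega> * measure \<mu> (S \<omega> -` ?A)"
        using prob_of_pos[OF stop_words_letters[OF \<omega>]] by simp
    qed
    also have "\<dots> = measure \<mu> ?A" using mu_stop_words[OF tR A, of 1] by simp
    finally show ?thesis .
  qed
  moreover have "(\<lambda>n. measure \<mu> {- real (Suc n)..real (Suc n)}) \<longlonglongrightarrow>
      measure \<mu> (\<Union>n. {- real (Suc n)..real (Suc n)})"
    by (rule mu.finite_Lim_measure_incseq) (auto simp: mu_borel incseq_def)
  moreover have "(\<Union>n. {- real (Suc n)..real (Suc n)}) = UNIV"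
  proof -
    have "\<exists>n. y \<in> {- real (Suc n)..real (Suc n)}" for y
    proof -
      obtain n where "\<bar>y\<bar> \<le> real n" using real_arch_simple by blast
      then show ?thesis by (intro exI[of _ n]) auto
    qed
    then show ?thesis by blast
  qed
  ultimately have "1 \<le> measure \<mu> ?A"
    using mu_UNIV LIMSEQ_le_const2 by (metis (no_types, lifting))
  then show ?thesis using mu_le_1[of ?A] by simp
qed

lemma mu_K: "measure \<mu> K = 1"
proof -
  let ?A = "\<lambda>n. {y. infdist y K \<le> 1 / real (Suc n)}"
  have cl: "closed (?A n)" for n by (intro closed_Collect_le continuous_intros)
  have "decseq ?A"
    unfolding decseq_def by (auto elim!: order_trans simp: frac_le)
  then have "(\<lambda>n. measure \<mu> (?A n)) \<longlonglongrightarrow> measure \<mu> (\<Inter>n. ?A n)"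
    using cl by (intro mu.finite_Lim_measure_decseq) (auto simp: mu_borel)
  then have "measure \<mu> (\<Inter>n. ?A n) = 1"
    using mu_near_K by (simp add: LIMSEQ_const_iff)
  moreover have "(\<Inter>n. ?A n) \<subseteq> K"
  proof
    fix y assume y: "y \<in> (\<Inter>n. ?A n)"
    have "infdist y K \<le> 0"
    proof (rule LIMSEQ_le_const[OF LIMSEQ_inverse_real_of_nat])
      show "\<exists>N. \<forall>n\<ge>N. infdist y K \<le> inverse (real (Suc n))" using y by (simp add: inverse_eq_divide)
    qed
    then have "infdist y K = 0" using infdist_nonneg[of y K] by simp
    then show "y \<in> K" using in_closed_iff_infdist_zero K_compact K_nonempty compact_imp_closed by blast
  qed
  ultimately show ?thesis
    using mu_mono[of "\<Inter>n. ?A n" K] mu_le_1[of K] K_compact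
    by (simp add: compact_imp_closed borel_closed)
qed

text \<open>A copy \<open>S \<omega> ` K\<close> of small diameter through \<open>y\<close> lies in \<open>U\<close> and has mass at least \<open>prob_of \<omega>\<close>.\<close>

lemma mu_pos_open:
  assumes "open U" "y \<in> U" "y \<in> K"
  shows "0 < measure \<mu> U"
proof -
  obtain e where e: "0 < e" "ball y e \<subseteq> U" using assms openE by blast
  obtain \<omega> z where \<omega>: "\<omega> \<in> stop_words 1 (e / 2)" "z \<in> K" "y = S \<omega> z"
    using K_stop_words[of "e / 2" y 1] e(1) assms(3) by auto
  have "K \<subseteq> S \<omega> -` U"
  proof
    fix u assume "u \<in> K"
    then have "\<bar>u - z\<bar> \<le> 1" using \<omega>(2) K_subset by (smt (verit) atLeastAtMost_iff subsetD)
    then have "\<bar>ratio \<omega>\<bar> * \<bar>u - z\<bar> \<le> e / 2 * 1"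
      using \<omega>(1) e(1) by (intro mult_mono) (auto simp: stop_words_def)
    moreover have "S \<omega> u - y = ratio \<omega> * (u - z)"
      using S_affine[of \<omega> u] S_affine[of \<omega> z] \<omega>(3) by (simp add: algebra_simps)
    ultimately have "\<bar>S \<omega> u - y\<bar> < e" using e(1) by (simp add: abs_mult)
    then have "dist y (S \<omega> u) < e" by (simp add: dist_real_def abs_minus_commute)
    then show "u \<in> S \<omega> -` U" using e(2) by auto
  qed
  then have "1 \<le> measure \<mu> (S \<omega> -` U)"
    using mu_mono[of K "S \<omega> -` U"] mu_K vimage_S_borel assms(1) by simp
  then have "0 < prob_of \<omega> * measure \<mu> (S \<omega> -` U)"
    using prob_of_pos[OF stop_words_letters[OF \<omega>(1)]] by (intro mult_pos_pos) auto
  also have "\<dots> \<le> measure \<mu> U" using mu_stop_word_le[OF _ _ \<omega>(1)] e(1) assms(1) by simp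
  finally show ?thesis .
qed

text \<open>The points of maximal mass would form a finite set mapped into itself by each \<open>S\<^sub>j\<^sup>-\<^sup>1\<close>; as these
  maps expand, there would be only one such point, fixed by all \<open>S\<^sub>j\<close>, and \<open>K\<close> would reduce to it.\<close>

lemma mu_singleton: "measure \<mu> {y} = 0"
proof (rule ccontr)
  assume "measure \<mu> {y} \<noteq> 0"
  define m where "m = measure \<mu> {y}"
  have m: "0 < m" using \<open>measure \<mu> {y} \<noteq> 0\<close> by (simp add: m_def less_le)
  define A where "A = {z. m \<le> measure \<mu> {z}}"
  have "finite A \<and> card A \<le> nat \<lfloor>1 / m\<rfloor>"
  proof (rule finite_if_finite_subsets_card_bdd)
    fix F assume F: "F \<subseteq> A" "finite F"
    have "real (card F) * m \<le> (\<Sum>z\<in>F. measure \<mu> {z})"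
      using F by (intro sum_bounded_below) (auto simp: A_def)
    also have "\<dots> = measure \<mu> F"
      using F(2) mu_borel by (intro mu.finite_measure_eq_sum_singleton[symmetric]) auto
    also have "\<dots> \<le> 1" by (rule mu_le_1)
    finally have "real (card F) \<le> 1 / m" using m by (simp add: field_simps)
    then show "card F \<le> nat \<lfloor>1 / m\<rfloor>" by (simp add: le_nat_floor)
  qed
  then have fin: "finite A" by blast
  define M where "M = Max ((\<lambda>z. measure \<mu> {z}) ` A)"
  have "y \<in> A" by (simp add: A_def m_def)
  have M: "measure \<mu> {z} \<le> M" for z
  proof (cases "z \<in> A")
    case False
    have "measure \<mu> {y} \<le> M" unfolding M_def using fin \<open>y \<in> A\<close> by simp
    then show ?thesis using False by (simp add: A_def m_def)
  qed (use fin in \<open>simp add: M_def\<close>)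
  define B where "B = {z \<in> A. measure \<mu> {z} = M}"
  have "M \<in> (\<lambda>z. measure \<mu> {z}) ` A" unfolding M_def using fin \<open>y \<in> A\<close> by (intro Max_in) auto
  then have "B \<noteq> {}" by (auto simp: B_def)
  have finB: "finite B" using fin by (simp add: B_def)
  have mM: "m \<le> M" using M[of y] by (simp add: m_def)
  have inv: "(z - d j) / r j \<in> B" if z: "z \<in> B" and j: "j \<le> k" for z j
  proof -
    let ?g = "\<lambda>j. measure \<mu> {(z - d j) / r j}"
    have "(\<lambda>x. r j * x + d j) -` {z} = {(z - d j) / r j}" if "j \<le> k" for j
      using ratio_pos[OF that] by (auto simp: field_simps)
    then have "M = (\<Sum>j\<le>k. p j * ?g j)"
      using mu_self_similar[of "{z}"] z by (simp add: B_def)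
    then have "(\<Sum>j\<le>k. p j * (M - ?g j)) = 0"
      using p_sum by (simp add: right_diff_distrib sum_subtractf flip: sum_distrib_right)
    then have "p j * (M - ?g j) = 0"
      using sum_nonneg_eq_0_iff[of "{..k}" "\<lambda>j. p j * (M - ?g j)"] M p_pos j by (simp add: less_imp_le)
    then have "?g j = M" using p_pos[OF j] by simp
    then show ?thesis using mM by (simp add: B_def A_def)
  qed
  have single: "z = z'" if "z \<in> B" "z' \<in> B" for z z'
  proof -
    define D where "D = (\<lambda>(u, v). \<bar>u - v\<bar>) ` (B \<times> B)"
    have D: "finite D" "D \<noteq> {}" using finB \<open>B \<noteq> {}\<close> by (auto simp: D_def)
    then have "Max D \<in> D" by simp
    then obtain u v where uv: "u \<in> B" "v \<in> B" "Max D = \<bar>u - v\<bar>" by (auto simp: D_def)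
    have "\<bar>(u - d 0) / r 0 - (v - d 0) / r 0\<bar> \<in> D" using inv[of _ 0] uv by (auto simp: D_def)
    then have "\<bar>(u - d 0) / r 0 - (v - d 0) / r 0\<bar> \<le> \<bar>u - v\<bar>" using D uv(3) by (metis Max_ge)
    moreover have "(u - d 0) / r 0 - (v - d 0) / r 0 = (u - v) / r 0" by (simp add: diff_divide_distrib)
    ultimately have "\<bar>u - v\<bar> \<le> \<bar>u - v\<bar> * \<bar>r 0\<bar>"
      using ratio_pos[of 0] by (simp add: divide_le_eq)
    then have "\<bar>u - v\<bar> = 0" using ratio_less_1[of 0] by (simp add: mult_le_cancel_left1)
    moreover have "\<bar>z - z'\<bar> \<le> Max D" using that D by (intro Max_ge) (auto simp: D_def)
    ultimately show ?thesis using uv by simp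
  qed
  obtain b where b: "b \<in> B" using \<open>B \<noteq> {}\<close> by blast
  have fixed: "r j * b + d j = b" if "j \<le> k" for j
    using single[OF b inv[OF b that]] ratio_pos[OF that] by (simp add: field_simps)
  have "\<exists>y\<in>K. \<forall>z\<in>K. dist b z \<le> dist b y" using distance_attains_sup[OF K_compact K_nonempty] .
  then obtain y where y: "y \<in> K" "\<And>z. z \<in> K \<Longrightarrow> \<bar>z - b\<bar> \<le> \<bar>y - b\<bar>" by (auto simp: dist_real_def abs_minus_commute)
  obtain j z where j: "j \<le> k" "z \<in> K" "y = r j * z + d j" using y(1) K_self_similar by blast
  have "\<bar>y - b\<bar> = \<bar>r j\<bar> * \<bar>z - b\<bar>"
    using fixed[OF j(1)] j(3) by (simp flip: abs_mult) (simp add: algebra_simps)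
  also have "\<dots> \<le> \<bar>r j\<bar> * \<bar>y - b\<bar>" using y(2)[OF j(2)] by (simp add: mult_left_mono)
  finally have "\<bar>y - b\<bar> = 0" using ratio_less_1[OF j(1)] by (simp add: mult_le_cancel_right1)
  then show False using y(2)[OF K_ends(1)] y(2)[OF K_ends(2)] by simp
qed

lemma mu_finite: "finite F \<Longrightarrow> measure \<mu> F = 0"
  using mu.finite_measure_eq_sum_singleton[of F] mu_borel mu_singleton by simp

text \<open>The complement of \<open>K\<close> and all finite sets are null.\<close>

lemma mu_le_mod_finite:
  assumes "A \<inter> K \<subseteq> B \<union> F" "finite F" "A \<in> sets borel" "B \<in> sets borel"
  shows "measure \<mu> A \<le> measure \<mu> B"
proof -
  have K: "K \<in> sets borel" using K_compact by (simp add: compact_imp_closed borel_closed)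
  have F: "F \<in> sets borel" using assms(2) by (simp add: finite_imp_closed borel_closed)
  have "measure \<mu> (UNIV - K) = 0"
    using mu.prob_compl[of K] K mu_K mu_borel space_mu by simp
  moreover have "measure \<mu> A \<le> measure \<mu> ((UNIV - K) \<union> (B \<union> F))"
    using K F assms(1,4) by (intro mu_mono) auto
  moreover have "measure \<mu> ((UNIV - K) \<union> (B \<union> F)) \<le> measure \<mu> (UNIV - K) + measure \<mu> (B \<union> F)"
    using K F assms(4) mu_borel by (intro measure_Un_le) auto
  moreover have "measure \<mu> (B \<union> F) \<le> measure \<mu> B + measure \<mu> F"
    using F assms(4) mu_borel by (intro measure_Un_le) auto
  ultimately show ?thesis using mu_finite[OF assms(2)] by simp
qed

end

section \<open>Weight vectors and transition matrices\<close>

context self_similar_measure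
begin

text \<open>The mass that a copy \<open>S \<sigma>\<close> with \<open>nbr n \<Delta> \<sigma> = v\<close> contributes, up to the factor \<open>prob_of \<sigma>\<close>, to
  a set \<open>A\<close>: it is \<open>measure \<mu> (S \<sigma> -` A)\<close>, expressed through \<open>v\<close> alone.\<close>

definition weight :: "nat \<Rightarrow> ivl \<Rightarrow> real set \<Rightarrow> real \<times> real \<Rightarrow> real" where
  "weight n \<Delta> A v = measure \<mu> {y. fst \<Delta> + r_min ^ n * (snd v * y - fst v) \<in> A}"

lemma weight_nbr: "weight n \<Delta> A (nbr n \<Delta> \<tau>) = measure \<mu> (S \<tau> -` A)"
proof -
  have "S \<tau> -` A = {y. fst \<Delta> + r_min ^ n * (snd (nbr n \<Delta> \<tau>) * y - fst (nbr n \<Delta> \<tau>)) \<in> A}"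
    using S_eq_nbr[of \<tau> _ \<Delta> n] by auto
  then show ?thesis by (simp add: weight_def)
qed

lemma weight_nonneg: "0 \<le> weight n \<Delta> A v"
  by (simp add: weight_def)

lemma weight_similar:
  assumes "similar n D m E"
  shows "weight n D {fst D..snd D} v = weight m E {fst E..snd E} v"
proof -
  have *: "(fst \<Delta> + r_min ^ i * (snd v * y - fst v) \<in> {fst \<Delta>..snd \<Delta>}) \<longleftrightarrow>
      0 \<le> snd v * y - fst v \<and> snd v * y - fst v \<le> norm_length i \<Delta>" for \<Delta> i y
  proof -
    have "a + c * z \<in> {a..b} \<longleftrightarrow> 0 \<le> z \<and> z \<le> (b - a) / c" if "0 < c" for a b c z :: real
      using that by (auto simp: pos_le_divide_eq mult.commute zero_le_mult_iff)
    then show ?thesis unfolding norm_length_def using r_min_pos by simp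
  qed
  show ?thesis unfolding weight_def * using assms by (simp add: similar_def)
qed

text \<open>A copy of \<open>K\<close> that does not cover \<open>\<Delta>\<close> meets it in its ends at most.\<close>

lemma null_unless_covers:
  assumes "\<Delta> \<in> net_intervals n" "\<tau> \<in> \<Lambda> n" "\<tau> \<notin> covers n \<Delta>"
    "A \<subseteq> {fst \<Delta>..snd \<Delta>}" "A \<in> sets borel"
  shows "measure \<mu> (S \<tau> -` A) = 0"
proof -
  note \<tau> = \<Lambda>_letters[OF assms(2)]
  have "finite (S \<tau> -` {fst \<Delta>, snd \<Delta>})"
    by (rule finite_vimageI) (auto intro: injI simp: S_inj[OF \<tau>])
  moreover have "S \<tau> -` A \<inter> K \<subseteq> {} \<union> S \<tau> -` {fst \<Delta>, snd \<Delta>}"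
  proof
    fix y assume y: "y \<in> S \<tau> -` A \<inter> K"
    then have "S \<tau> y \<in> {lo \<tau>..hi \<tau>}" using S_mem K_subset by blast
    moreover have "S \<tau> y \<in> {fst \<Delta>..snd \<Delta>}" using y assms(4) by auto
    moreover have "snd \<Delta> \<le> lo \<tau> \<or> hi \<tau> \<le> fst \<Delta>"
      using covers_if_meets[OF assms(1,2)] assms(3) by force
    ultimately show "y \<in> {} \<union> S \<tau> -` {fst \<Delta>, snd \<Delta>}" by auto
  qed
  ultimately have "measure \<mu> (S \<tau> -` A) \<le> measure \<mu> {}"
    using vimage_S_borel[OF assms(5)] by (intro mu_le_mod_finite) auto
  then show ?thesis by (simp add: measure_le_0_iff)
qed

lemma covers_if_nbr:
  assumes "\<Delta> \<in> net_intervals n" "\<tau> \<in> \<Lambda> n" "nbr n \<Delta> \<tau> \<in> nbr n \<Delta> ` covers n \<Delta>"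
  shows "\<tau> \<in> covers n \<Delta>"
proof -
  obtain \<sigma> where \<sigma>: "\<sigma> \<in> covers n \<Delta>" "nbr n \<Delta> \<tau> = nbr n \<Delta> \<sigma>" using assms(3) by auto
  then have "S \<tau> y = S \<sigma> y" for y unfolding S_eq_nbr[of _ y \<Delta> n] by simp
  then have "S \<tau> = S \<sigma>" by blast
  then show ?thesis using \<sigma>(1) assms(2) by (simp add: covers_def)
qed

text \<open>The word \<open>\<sigma>\<close> is either one of the preceding generation, which gives the rows of a transition
  matrix, or empty, which gives the mass of \<open>A\<close> itself. In both cases the words \<open>\<omega>\<close> form a
  cross-section, and they are grouped here by their neighbour pair.\<close>

lemma mu_decomposition:
  assumes "\<Delta> \<in> net_intervals n" "A \<subseteq> {fst \<Delta>..snd \<Delta>}" "A \<in> sets borel"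
    and W: "{\<omega>. \<sigma> @ \<omega> \<in> \<Lambda> n} = stop_words c t" "0 < t"
  shows "measure \<mu> (S \<sigma> -` A) = (\<Sum>v\<in>nbr n \<Delta> ` covers n \<Delta>.
     (\<Sum>\<omega> | \<sigma> @ \<omega> \<in> \<Lambda> n \<and> nbr n \<Delta> (\<sigma> @ \<omega>) = v. prob_of \<omega>) * weight n \<Delta> A v)"
proof -
  let ?V = "nbr n \<Delta> ` covers n \<Delta>"
  let ?f = "\<lambda>\<omega>. prob_of \<omega> * measure \<mu> (S (\<sigma> @ \<omega>) -` A)"
  let ?W = "{\<omega>. \<sigma> @ \<omega> \<in> \<Lambda> n \<and> nbr n \<Delta> (\<sigma> @ \<omega>) \<in> ?V}"
  have fin: "finite {\<omega>. \<sigma> @ \<omega> \<in> \<Lambda> n}" using finite_stop_words[OF W(2)] W(1) by simp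
  have "measure \<mu> (S \<sigma> -` A) = (\<Sum>\<omega> | \<sigma> @ \<omega> \<in> \<Lambda> n. ?f \<omega>)"
    using mu_stop_words[OF W(2) vimage_S_borel[OF assms(3)], of \<sigma> c] W(1)
    by (simp add: S_append vimage_comp)
  also have "\<dots> = (\<Sum>\<omega>\<in>?W. ?f \<omega>)"
  proof (rule sum.mono_neutral_right[OF fin])
    show "\<forall>\<omega>\<in>{\<omega>. \<sigma> @ \<omega> \<in> \<Lambda> n} - ?W. ?f \<omega> = 0"
    proof
      fix \<omega> assume \<omega>: "\<omega> \<in> {\<omega>. \<sigma> @ \<omega> \<in> \<Lambda> n} - ?W"
      then have "\<sigma> @ \<omega> \<notin> covers n \<Delta>" by blast
      then show "?f \<omega> = 0" using null_unless_covers[OF assms(1) _ _ assms(2,3), of "\<sigma> @ \<omega>"] \<omega> by simp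
    qed
  qed blast
  also have "\<dots> = (\<Sum>v\<in>?V. \<Sum>\<omega>\<in>{\<omega>\<in>?W. nbr n \<Delta> (\<sigma> @ \<omega>) = v}. ?f \<omega>)"
  proof (rule sum.group[symmetric])
    show "finite ?W" by (rule finite_subset[OF _ fin]) blast
  qed (use finite_covers in auto)
  also have "\<dots> = (\<Sum>v\<in>?V. (\<Sum>\<omega> | \<sigma> @ \<omega> \<in> \<Lambda> n \<and> nbr n \<Delta> (\<sigma> @ \<omega>) = v. prob_of \<omega>) * weight n \<Delta> A v)"
  proof (rule sum.cong[OF refl])
    fix v assume "v \<in> ?V"
    then have eq: "{\<omega>\<in>?W. nbr n \<Delta> (\<sigma> @ \<omega>) = v} = {\<omega>. \<sigma> @ \<omega> \<in> \<Lambda> n \<and> nbr n \<Delta> (\<sigma> @ \<omega>) = v}" by auto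
    show "(\<Sum>\<omega>\<in>{\<omega>\<in>?W. nbr n \<Delta> (\<sigma> @ \<omega>) = v}. ?f \<omega>) =
      (\<Sum>\<omega> | \<sigma> @ \<omega> \<in> \<Lambda> n \<and> nbr n \<Delta> (\<sigma> @ \<omega>) = v. prob_of \<omega>) * weight n \<Delta> A v"
      unfolding eq sum_distrib_right by (rule sum.cong) (auto simp: weight_nbr[symmetric, of _ A n \<Delta>])
  qed
  finally show ?thesis .
qed

definition wvec :: "nat \<Rightarrow> ivl \<Rightarrow> real set \<Rightarrow> real vec" where
  "wvec n \<Delta> A = vec (length (nbr_set n \<Delta>)) (\<lambda>i. weight n \<Delta> A (nbr_set n \<Delta> ! i))"

lemma wvec_carrier [simp]: "wvec n \<Delta> A \<in> carrier_vec (length (nbr_set n \<Delta>))"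
  by (simp add: wvec_def)

lemma ivl_trans_mat_carrier [simp]:
  "ivl_trans_mat n D \<Delta> \<in> carrier_mat (length (nbr_set n D)) (length (nbr_set (Suc n) \<Delta>))"
  by (simp add: ivl_trans_mat_def)

lemma ivl_trans_mat_entry:
  assumes "D \<in> net_intervals n" "i < length (nbr_set n D)"
  shows "\<exists>\<sigma>\<in>covers n D. nbr n D \<sigma> = nbr_set n D ! i \<and> (\<forall>\<Delta>. \<forall>j<length (nbr_set (Suc n) \<Delta>).
    ivl_trans_mat n D \<Delta> $$ (i, j) =
      (\<Sum>\<omega> | \<sigma> @ \<omega> \<in> \<Lambda> (Suc n) \<and> nbr (Suc n) \<Delta> (\<sigma> @ \<omega>) = nbr_set (Suc n) \<Delta> ! j. prob_of \<omega>))"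
proof -
  let ?\<sigma> = "SOME \<sigma>. \<sigma> \<in> \<Lambda> n \<and> nbr n D \<sigma> = nbr_set n D ! i"
  have "nbr n D ?\<sigma> \<in> nbr n D ` covers n D"
    using SOME_nbr(2)[OF assms] assms(2) set_nbr_set nth_mem by metis
  then have "?\<sigma> \<in> covers n D" by (rule covers_if_nbr[OF assms(1) SOME_nbr(1)[OF assms]])
  moreover have "\<forall>\<Delta>. \<forall>j<length (nbr_set (Suc n) \<Delta>). ivl_trans_mat n D \<Delta> $$ (i, j) =
      (\<Sum>\<omega> | ?\<sigma> @ \<omega> \<in> \<Lambda> (Suc n) \<and> nbr (Suc n) \<Delta> (?\<sigma> @ \<omega>) = nbr_set (Suc n) \<Delta> ! j. prob_of \<omega>)"
    using assms(2) by (simp add: ivl_trans_mat_def Let_def prob_of_def)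
  ultimately show ?thesis using SOME_nbr(2)[OF assms] by blast
qed

lemma append_\<Lambda>_stop_words:
  "\<sigma> \<in> \<Lambda> n \<Longrightarrow> {\<omega>. \<sigma> @ \<omega> \<in> \<Lambda> (Suc n)} = stop_words (ratio \<sigma>) (r_min ^ Suc n)"
  using append_in_\<Lambda>_Suc by blast

lemma sum_nbr_set: "(\<Sum>v\<in>nbr n \<Delta> ` covers n \<Delta>. f v) = (\<Sum>j<length (nbr_set n \<Delta>). f (nbr_set n \<Delta> ! j))"
  using sum.reindex_bij_betw[OF bij_betw_nth[OF distinct_nbr_set refl refl], of f n \<Delta>] set_nbr_set[of n \<Delta>]
  by simp

lemma wvec_step:
  assumes "D \<in> net_intervals n" "\<Delta> \<in> children n D" "A \<subseteq> {fst \<Delta>..snd \<Delta>}" "A \<in> sets borel"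
  shows "wvec n D A = ivl_trans_mat n D \<Delta> *\<^sub>v wvec (Suc n) \<Delta> A"
proof (rule eq_vecI)
  fix i assume "i < dim_vec (ivl_trans_mat n D \<Delta> *\<^sub>v wvec (Suc n) \<Delta> A)"
  then have i: "i < length (nbr_set n D)" by (simp add: ivl_trans_mat_def)
  obtain \<sigma> where \<sigma>: "\<sigma> \<in> covers n D" "nbr n D \<sigma> = nbr_set n D ! i"
    and T: "\<And>j. j < length (nbr_set (Suc n) \<Delta>) \<Longrightarrow> ivl_trans_mat n D \<Delta> $$ (i, j) =
      (\<Sum>\<omega> | \<sigma> @ \<omega> \<in> \<Lambda> (Suc n) \<and> nbr (Suc n) \<Delta> (\<sigma> @ \<omega>) = nbr_set (Suc n) \<Delta> ! j. prob_of \<omega>)"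
    using ivl_trans_mat_entry[OF assms(1) i] by blast
  have "wvec n D A $ i = measure \<mu> (S \<sigma> -` A)"
    using i weight_nbr[of n D A \<sigma>] \<sigma>(2) by (simp add: wvec_def)
  also have "\<dots> = (\<Sum>j<length (nbr_set (Suc n) \<Delta>).
     (\<Sum>\<omega> | \<sigma> @ \<omega> \<in> \<Lambda> (Suc n) \<and> nbr (Suc n) \<Delta> (\<sigma> @ \<omega>) = nbr_set (Suc n) \<Delta> ! j. prob_of \<omega>) *
     weight (Suc n) \<Delta> A (nbr_set (Suc n) \<Delta> ! j))"
    unfolding mu_decomposition[OF childrenD(1)[OF assms(2)] assms(3,4)
        append_\<Lambda>_stop_words[OF covers_\<Lambda>[OF \<sigma>(1)]] zero_less_power[OF r_min_pos]]
    by (rule sum_nbr_set)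
  also have "\<dots> = (\<Sum>j<length (nbr_set (Suc n) \<Delta>). ivl_trans_mat n D \<Delta> $$ (i, j) * wvec (Suc n) \<Delta> A $ j)"
    by (rule sum.cong) (simp_all add: T wvec_def)
  also have "\<dots> = (ivl_trans_mat n D \<Delta> *\<^sub>v wvec (Suc n) \<Delta> A) $ i"
    using mult_mat_vec_sum[OF ivl_trans_mat_carrier wvec_carrier i] by simp
  finally show "wvec n D A $ i = (ivl_trans_mat n D \<Delta> *\<^sub>v wvec (Suc n) \<Delta> A) $ i" .
qed (simp add: wvec_def ivl_trans_mat_def)

text \<open>The mass of \<open>A\<close> is a combination of the entries of \<open>wvec n \<Delta> A\<close> whose coefficients, the total
  probabilities of the words with a given neighbour pair, are positive and do not depend on \<open>A\<close>.\<close>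

lemma mu_comparable:
  assumes "\<Delta> \<in> net_intervals n"
  shows "\<exists>a>0. \<exists>b>0. \<forall>A\<in>sets borel. A \<subseteq> {fst \<Delta>..snd \<Delta>} \<longrightarrow>
    (\<forall>i<length (nbr_set n \<Delta>). a * wvec n \<Delta> A $ i \<le> measure \<mu> A) \<and>
    (\<forall>u. (\<forall>i<length (nbr_set n \<Delta>). wvec n \<Delta> A $ i \<le> u) \<longrightarrow> measure \<mu> A \<le> b * u)"
proof -
  let ?V = "nbr_set n \<Delta>"
  define P where "P i = (\<Sum>\<omega> | \<omega> \<in> \<Lambda> n \<and> nbr n \<Delta> \<omega> = ?V ! i. prob_of \<omega>)" for i
  have len: "0 < length ?V"
    using covers_nonempty[OF assms] set_nbr_set[of n \<Delta>] by (auto simp flip: length_greater_0_conv)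
  have P: "0 < P i" if "i < length ?V" for i
  proof -
    have "?V ! i \<in> nbr n \<Delta> ` covers n \<Delta>" using nth_mem[OF that] unfolding set_nbr_set .
    then obtain \<sigma> where "\<sigma> \<in> covers n \<Delta>" "?V ! i = nbr n \<Delta> \<sigma>" by (rule imageE)
    then have "\<sigma> \<in> {\<omega>. \<omega> \<in> \<Lambda> n \<and> nbr n \<Delta> \<omega> = ?V ! i}" using covers_\<Lambda>[of \<sigma> n \<Delta>] by simp
    then have "{\<omega>. \<omega> \<in> \<Lambda> n \<and> nbr n \<Delta> \<omega> = ?V ! i} \<noteq> {}" by (rule ex_in_conv[THEN iffD1, OF exI])
    then show ?thesis unfolding P_def
    proof (rule sum_pos[rotated])
      show "finite {\<omega>. \<omega> \<in> \<Lambda> n \<and> nbr n \<Delta> \<omega> = ?V ! i}" using finite_\<Lambda>[of n] by simp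
      show "0 < prob_of \<omega>" if "\<omega> \<in> {\<omega>. \<omega> \<in> \<Lambda> n \<and> nbr n \<Delta> \<omega> = ?V ! i}" for \<omega>
        using that by (intro prob_of_pos \<Lambda>_letters[of _ n]) simp
    qed
  qed
  have eq: "measure \<mu> A = (\<Sum>i<length ?V. P i * wvec n \<Delta> A $ i)"
    if A: "A \<in> sets borel" "A \<subseteq> {fst \<Delta>..snd \<Delta>}" for A
  proof -
    have "{\<omega>. [] @ \<omega> \<in> \<Lambda> n} = stop_words 1 (r_min ^ n)" by (simp add: \<Lambda>_eq_stop_words)
    from mu_decomposition[OF assms A(2,1) this zero_less_power[OF r_min_pos]]
    have "measure \<mu> A = (\<Sum>v\<in>nbr n \<Delta> ` covers n \<Delta>. (\<Sum>\<omega> | \<omega> \<in> \<Lambda> n \<and> nbr n \<Delta> \<omega> = v. prob_of \<omega>) * weight n \<Delta> A v)"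
      by simp
    then show ?thesis unfolding sum_nbr_set by (simp add: P_def wvec_def)
  qed
  have nonneg: "0 \<le> wvec n \<Delta> A $ i" if "i < length ?V" for i A
    using that weight_nonneg by (simp add: wvec_def)
  define a where "a = Min (P ` {..<length ?V})"
  define b where "b = (\<Sum>i<length ?V. P i)"
  have "0 < a"
    unfolding a_def using P len by (subst Min_gr_iff) auto
  have aP: "a \<le> P i" if "i < length ?V" for i
    unfolding a_def using that by (intro Min_le) auto
  have "0 < b" unfolding b_def using P len by (intro sum_pos) auto
  have lower: "a * wvec n \<Delta> A $ i \<le> measure \<mu> A"
    if "A \<in> sets borel" "A \<subseteq> {fst \<Delta>..snd \<Delta>}" "i < length ?V" for A i
  proof -
    have "a * wvec n \<Delta> A $ i \<le> P i * wvec n \<Delta> A $ i"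
      using aP nonneg that(3) by (intro mult_right_mono) auto
    also have "\<dots> \<le> measure \<mu> A" unfolding eq[OF that(1,2)]
    proof (rule member_le_sum)
      show "0 \<le> P l * wvec n \<Delta> A $ l" if "l \<in> {..<length ?V} - {i}" for l
        using that nonneg[of l A] P[of l] by simp
    qed (use that(3) in auto)
    finally show ?thesis .
  qed
  have upper: "measure \<mu> A \<le> b * u"
    if "A \<in> sets borel" "A \<subseteq> {fst \<Delta>..snd \<Delta>}" "\<forall>i<length ?V. wvec n \<Delta> A $ i \<le> u" for A u
    unfolding eq[OF that(1,2)] b_def sum_distrib_right
    by (rule sum_mono, rule mult_left_mono) (use that(3) P in \<open>simp_all add: less_imp_le\<close>)
  show ?thesis
    using \<open>0 < a\<close> \<open>0 < b\<close> lower upper by (intro exI[of _ a] exI[of _ b] conjI ballI impI allI) simp_all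
qed

lemma mu_net_interval_pos:
  assumes "\<Delta> \<in> net_intervals n"
  shows "0 < measure \<mu> {fst \<Delta>..snd \<Delta>}"
proof -
  obtain y where "y \<in> {fst \<Delta><..<snd \<Delta>}" "y \<in> K" using assms unfolding net_interval_iff by blast
  then have "0 < measure \<mu> {fst \<Delta><..<snd \<Delta>}" by (intro mu_pos_open) auto
  also have "\<dots> \<le> measure \<mu> {fst \<Delta>..snd \<Delta>}" by (rule mu_mono) auto
  finally show ?thesis .
qed

end

section \<open>Measure along periodic paths\<close>

context ifs
begin

definition is_path :: "(nat \<Rightarrow> ivl) \<Rightarrow> bool" where
  "is_path D \<longleftrightarrow> D 0 = (0, 1) \<and> (\<forall>n. D (Suc n) \<in> children n (D n))"

abbreviation cv :: "(nat \<Rightarrow> ivl) \<Rightarrow> nat \<Rightarrow> char_vec" where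
  "cv D n \<equiv> charvec n (D n)"

abbreviation Ivl :: "ivl \<Rightarrow> real set" where
  "Ivl \<Delta> \<equiv> {fst \<Delta>..snd \<Delta>}"

lemma symbolic_rep_iff:
  "symbolic_rep x \<rho> \<longleftrightarrow> (\<exists>D. is_path D \<and> (\<forall>n. x \<in> Ivl (D n)) \<and> (\<forall>n. \<rho> !! n = cv D n))"
  unfolding symbolic_rep_def is_path_def by blast

lemma path_child: "is_path D \<Longrightarrow> D (Suc n) \<in> children n (D n)"
  by (simp add: is_path_def)

lemma path_net: "is_path D \<Longrightarrow> D n \<in> net_intervals n"
  using net_interval_path[of D n n] by (simp add: is_path_def)

lemma path_nested:
  assumes "is_path D" "m \<le> n"
  shows "fst (D m) \<le> fst (D n) \<and> snd (D n) \<le> snd (D m)"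
  using assms(2)
proof (induction n rule: dec_induct)
  case (step n)
  then show ?case using childrenD(2,3)[OF path_child[OF assms(1), of n]] by linarith
qed simp

lemma path_fst_tendsto:
  assumes "is_path D" "\<And>n. x \<in> Ivl (D n)"
  shows "(\<lambda>n. fst (D n)) \<longlonglongrightarrow> x"
proof (rule tendsto_sandwich)
  show "\<forall>\<^sub>F n in sequentially. x - r_min ^ n \<le> fst (D n)"
  proof (rule always_eventually, rule allI)
    fix n show "x - r_min ^ n \<le> fst (D n)"
      using net_interval_length[OF path_net[OF assms(1), of n]] assms(2)[of n] by simp
  qed
  show "\<forall>\<^sub>F n in sequentially. fst (D n) \<le> x" using assms(2) by simp
  have "(\<lambda>n. x - r_min ^ n) \<longlonglongrightarrow> x - 0"
    using r_min_pos r_min_less_1 by (intro tendsto_intros LIMSEQ_power_zero) auto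
  then show "(\<lambda>n. x - r_min ^ n) \<longlonglongrightarrow> x" by simp
qed simp

text \<open>The similarity carrying \<open>D i\<close> to \<open>D (i + s)\<close> carries the whole rest of the path to its shift
  by \<open>s\<close>, hence it fixes the point \<open>x\<close> to which the path shrinks.\<close>

lemma periodic_path_geometry:
  assumes D: "is_path D" and x: "\<And>n. x \<in> Ivl (D n)"
    and per: "\<And>i. n0 \<le> i \<Longrightarrow> cv D (i + s) = cv D i"
  shows "fst (D (n0 + m * s)) = x - (r_min ^ s) ^ m * (x - fst (D n0))"
    and "snd (D (n0 + m * s)) = x + (r_min ^ s) ^ m * (snd (D n0) - x)"
proof -
  define q where "q = r_min ^ s"
  have step: "fst (D (Suc i + s)) - q * fst (D (Suc i)) = fst (D (i + s)) - q * fst (D i)" if "n0 \<le> i" for i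
  proof -
    have sim: "similar i (D i) (i + s) (D (i + s))"
      using similar_if_charvec path_net[OF D] per[OF that] by metis
    have "D (Suc (i + s)) = xfer_ivl i (D i) (i + s) (D (i + s)) (D (Suc i))"
      using child_eq_xfer[OF sim path_child[OF D] path_child[OF D]] per[of "Suc i"] that by simp
    moreover have "r_min ^ (i + s) / r_min ^ i = q" using r_min_pos by (simp add: q_def power_add)
    ultimately show ?thesis by (simp add: xfer_ivl_def xfer_def algebra_simps)
  qed
  have const: "fst (D (i + s)) - q * fst (D i) = fst (D (n0 + s)) - q * fst (D n0)" if "n0 \<le> i" for i
    using that
  proof (induction i rule: dec_induct)
    case (step i)
    then show ?case using \<open>\<And>i. n0 \<le> i \<Longrightarrow> fst (D (Suc i + s)) - q * fst (D (Suc i)) = fst (D (i + s)) - q * fst (D i)\<close>[of i]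
      by simp
  qed simp
  have lim: "(\<lambda>n. fst (D n)) \<longlonglongrightarrow> x" by (rule path_fst_tendsto[OF D x])
  have "(\<lambda>i. fst (D (i + s)) - q * fst (D i)) \<longlonglongrightarrow> x - q * x"
    by (intro tendsto_diff tendsto_mult tendsto_const lim LIMSEQ_ignore_initial_segment)
  moreover have "\<forall>\<^sub>F i in sequentially. fst (D (i + s)) - q * fst (D i) = fst (D (n0 + s)) - q * fst (D n0)"
    using const eventually_ge_at_top[of n0] by (rule eventually_mono[rotated])
  ultimately have "(\<lambda>i. fst (D (n0 + s)) - q * fst (D n0)) \<longlonglongrightarrow> x - q * x"
    by (rule Lim_transform_eventually)
  then have lim_eq: "fst (D (n0 + s)) - q * fst (D n0) = x - q * x" by (rule LIMSEQ_const_iff[THEN iffD1])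
  have F: "x - fst (D (i + s)) = q * (x - fst (D i))" if "n0 \<le> i" for i
    using const[OF that] lim_eq by (simp add: algebra_simps)
  have G: "snd (D (i + s)) - x = q * (snd (D i) - x)" if "n0 \<le> i" for i
  proof -
    have "norm_length (i + s) (D (i + s)) = norm_length i (D i)" using per[OF that] by (simp add: charvec_def)
    then have eq: "(snd (D (i + s)) - fst (D (i + s))) / (r_min ^ i * q) = (snd (D i) - fst (D i)) / r_min ^ i"
      by (simp add: norm_length_def q_def power_add)
    have pos: "0 < r_min ^ i" "0 < q" using r_min_pos by (simp_all add: q_def)
    then have "snd (D (i + s)) - fst (D (i + s)) = (snd (D (i + s)) - fst (D (i + s))) / (r_min ^ i * q) * (r_min ^ i * q)"
      using r_min_pos by simp
    also have "\<dots> = q * (snd (D i) - fst (D i))" unfolding eq using pos r_min_pos by simp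
    finally have "snd (D (i + s)) - fst (D (i + s)) = q * (snd (D i) - fst (D i))" .
    then show ?thesis using F[OF that] by (simp add: algebra_simps)
  qed
  have "x - fst (D (n0 + m * s)) = q ^ m * (x - fst (D n0)) \<and>
    snd (D (n0 + m * s)) - x = q ^ m * (snd (D n0) - x)"
  proof (induction m)
    case (Suc m)
    have eq: "n0 + Suc m * s = n0 + m * s + s" by simp
    show ?case unfolding eq using F[of "n0 + m * s"] G[of "n0 + m * s"] Suc by (simp add: mult.assoc)
  qed simp
  then show "fst (D (n0 + m * s)) = x - (r_min ^ s) ^ m * (x - fst (D n0))"
    "snd (D (n0 + m * s)) = x + (r_min ^ s) ^ m * (snd (D n0) - x)"
    unfolding q_def by linarith+
qed

text \<open>Near \<open>x\<close>, the interval \<open>D n0\<close> does not extend beyond its later descendants along the path.\<close>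

lemma periodic_path_near:
  assumes D: "is_path D" and x: "\<And>n. x \<in> Ivl (D n)"
    and per: "\<And>i. n0 \<le> i \<Longrightarrow> cv D (i + s) = cv D i"
  shows "\<exists>b>0. \<forall>m t. t \<le> b * (r_min ^ s) ^ m \<longrightarrow> {x - t..x + t} \<inter> Ivl (D n0) \<subseteq> Ivl (D (n0 + m * s))"
proof -
  define \<alpha> where "\<alpha> = x - fst (D n0)"
  define \<beta> where "\<beta> = snd (D n0) - x"
  \<comment> \<open>If \<open>x\<close> is an end of \<open>D n0\<close>, then nothing lies beyond it, and this side imposes no condition.\<close>
  define b where "b = min (if \<alpha> = 0 then 1 else \<alpha>) (if \<beta> = 0 then 1 else \<beta>)"
  have nn: "0 \<le> \<alpha>" "0 \<le> \<beta>" using x[of n0] by (auto simp: \<alpha>_def \<beta>_def)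
  then have "0 < b" by (auto simp: b_def)
  moreover have "{x - t..x + t} \<inter> Ivl (D n0) \<subseteq> Ivl (D (n0 + m * s))"
    if t: "t \<le> b * (r_min ^ s) ^ m" for m t
  proof -
    have q: "0 < (r_min ^ s) ^ m" using r_min_pos by simp
    have "t \<le> (r_min ^ s) ^ m * \<alpha> \<or> \<alpha> = 0"
    proof -
      have "b * (r_min ^ s) ^ m \<le> \<alpha> * (r_min ^ s) ^ m \<or> \<alpha> = 0"
        using q by (auto simp: b_def intro!: mult_right_mono)
      then show ?thesis using t by (auto simp: mult.commute)
    qed
    moreover have "t \<le> (r_min ^ s) ^ m * \<beta> \<or> \<beta> = 0"
    proof -
      have "b * (r_min ^ s) ^ m \<le> \<beta> * (r_min ^ s) ^ m \<or> \<beta> = 0"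
        using q by (auto simp: b_def intro!: mult_right_mono)
      then show ?thesis using t by (auto simp: mult.commute)
    qed
    moreover have "fst (D (n0 + m * s)) = x - (r_min ^ s) ^ m * \<alpha>"
      "snd (D (n0 + m * s)) = x + (r_min ^ s) ^ m * \<beta>"
      using periodic_path_geometry[OF D x per] by (simp_all add: \<alpha>_def \<beta>_def)
    moreover have "fst (D n0) = x - \<alpha>" "snd (D n0) = x + \<beta>" by (simp_all add: \<alpha>_def \<beta>_def)
    ultimately show ?thesis by auto
  qed
  ultimately show ?thesis by blast
qed

end

context self_similar_measure
begin

lemma nbr_eq_S:
  assumes "nbr n \<Delta> \<sigma> = nbr n \<Delta> \<tau>"
  shows "S \<sigma> = S \<tau>"
proof
  show "S \<sigma> y = S \<tau> y" for y unfolding S_eq_nbr[of _ y \<Delta> n] assms ..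
qed

text \<open>A nonzero entry of a product of transition matrices witnesses a word of the later generation
  that covers the later interval and extends (up to equality of maps) the word of its row. Unlike
  the entries themselves, this property passes to products at once.\<close>

definition linked :: "nat \<Rightarrow> ivl \<Rightarrow> nat \<Rightarrow> ivl \<Rightarrow> real mat \<Rightarrow> bool" where
  "linked n D m E P \<longleftrightarrow> P \<in> carrier_mat (length (nbr_set n D)) (length (nbr_set m E)) \<and>
    (\<forall>i<length (nbr_set n D). \<forall>j<length (nbr_set m E). 0 \<le> P $$ (i, j) \<and> (P $$ (i, j) \<noteq> 0 \<longrightarrow>
      (\<exists>\<sigma>\<in>covers n D. \<exists>\<tau>\<in>covers m E. nbr n D \<sigma> = nbr_set n D ! i \<and> nbr m E \<tau> = nbr_set m E ! j \<and>
        S \<tau> ` K \<subseteq> S \<sigma> ` K)))"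

lemma linkedD:
  assumes "linked n D m E P"
  shows "P \<in> carrier_mat (length (nbr_set n D)) (length (nbr_set m E))"
    "i < length (nbr_set n D) \<Longrightarrow> j < length (nbr_set m E) \<Longrightarrow> 0 \<le> P $$ (i, j)"
    "i < length (nbr_set n D) \<Longrightarrow> j < length (nbr_set m E) \<Longrightarrow> P $$ (i, j) \<noteq> 0 \<Longrightarrow>
      \<exists>\<sigma>\<in>covers n D. \<exists>\<tau>\<in>covers m E. nbr n D \<sigma> = nbr_set n D ! i \<and> nbr m E \<tau> = nbr_set m E ! j \<and>
        S \<tau> ` K \<subseteq> S \<sigma> ` K"
  using assms unfolding linked_def by blast+

lemma nbr_set_nth_covers:
  assumes "i < length (nbr_set n D)"
  shows "\<exists>\<sigma>\<in>covers n D. nbr n D \<sigma> = nbr_set n D ! i"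
  using nth_mem[OF assms] unfolding set_nbr_set by (metis imageE)

lemma linked_one: "linked n D n D (1\<^sub>m (length (nbr_set n D)))"
  unfolding linked_def
proof (intro conjI allI impI)
  fix i j assume ij: "i < length (nbr_set n D)" "j < length (nbr_set n D)"
  show "0 \<le> (1\<^sub>m (length (nbr_set n D)) :: real mat) $$ (i, j)" using ij by simp
  assume "(1\<^sub>m (length (nbr_set n D)) :: real mat) $$ (i, j) \<noteq> 0"
  then have "i = j" using ij by (simp split: if_splits)
  obtain \<sigma> where "\<sigma> \<in> covers n D" "nbr n D \<sigma> = nbr_set n D ! i" using nbr_set_nth_covers[OF ij(1)] by blast
  then show "\<exists>\<sigma>\<in>covers n D. \<exists>\<tau>\<in>covers n D. nbr n D \<sigma> = nbr_set n D ! i \<and> nbr n D \<tau> = nbr_set n D ! j \<and>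
        S \<tau> ` K \<subseteq> S \<sigma> ` K" using \<open>i = j\<close> by blast
qed simp

lemma linked_mult:
  assumes "linked n D m E P" "linked m E l F Q"
  shows "linked n D l F (P * Q)"
  unfolding linked_def
proof (intro conjI allI impI)
  note P = linkedD[OF assms(1)] and Q = linkedD[OF assms(2)]
  show "P * Q \<in> carrier_mat (length (nbr_set n D)) (length (nbr_set l F))"
    by (rule mult_carrier_mat[OF P(1) Q(1)])
  fix i j assume ij: "i < length (nbr_set n D)" "j < length (nbr_set l F)"
  have eq: "(P * Q) $$ (i, j) = (\<Sum>h<length (nbr_set m E). P $$ (i, h) * Q $$ (h, j))"
    by (rule index_mult_mat_sum[OF P(1) Q(1) ij])
  show "0 \<le> (P * Q) $$ (i, j)" unfolding eq
  proof (intro sum_nonneg mult_nonneg_nonneg)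
    fix h assume "h \<in> {..<length (nbr_set m E)}"
    then have h: "h < length (nbr_set m E)" by simp
    show "0 \<le> P $$ (i, h)" "0 \<le> Q $$ (h, j)" by (rule P(2)[OF ij(1) h], rule Q(2)[OF h ij(2)])
  qed
  assume "(P * Q) $$ (i, j) \<noteq> 0"
  then obtain h where h: "h < length (nbr_set m E)" "P $$ (i, h) * Q $$ (h, j) \<noteq> 0"
    unfolding eq by (rule sum.not_neutral_contains_not_neutral) simp
  then have nz: "P $$ (i, h) \<noteq> 0" "Q $$ (h, j) \<noteq> 0" by auto
  obtain \<sigma> \<tau> where \<sigma>: "\<sigma> \<in> covers n D" "nbr n D \<sigma> = nbr_set n D ! i"
    "nbr m E \<tau> = nbr_set m E ! h" "S \<tau> ` K \<subseteq> S \<sigma> ` K" using P(3)[OF ij(1) h(1) nz(1)] by blast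
  obtain \<tau>' \<nu> where \<nu>: "\<nu> \<in> covers l F" "nbr m E \<tau>' = nbr_set m E ! h" "nbr l F \<nu> = nbr_set l F ! j"
    "S \<nu> ` K \<subseteq> S \<tau>' ` K" using Q(3)[OF h(1) ij(2) nz(2)] by blast
  have "S \<tau>' = S \<tau>" using \<sigma>(3) \<nu>(2) by (intro nbr_eq_S[of m E]) simp
  then have "S \<nu> ` K \<subseteq> S \<sigma> ` K" using \<sigma>(4) \<nu>(4) by simp
  then show "\<exists>\<sigma>\<in>covers n D. \<exists>\<tau>\<in>covers l F. nbr n D \<sigma> = nbr_set n D ! i \<and> nbr l F \<tau> = nbr_set l F ! j \<and>
        S \<tau> ` K \<subseteq> S \<sigma> ` K" using \<sigma>(1,2) \<nu>(1,3) by blast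
qed

lemma linked_trans_mat:
  assumes "D \<in> net_intervals n" "\<Delta> \<in> children n D"
  shows "linked n D (Suc n) \<Delta> (ivl_trans_mat n D \<Delta>)"
  unfolding linked_def
proof (intro conjI allI impI)
  fix i j assume ij: "i < length (nbr_set n D)" "j < length (nbr_set (Suc n) \<Delta>)"
  obtain \<sigma> where \<sigma>: "\<sigma> \<in> covers n D" "nbr n D \<sigma> = nbr_set n D ! i"
    and T: "ivl_trans_mat n D \<Delta> $$ (i, j) =
      (\<Sum>\<omega> | \<sigma> @ \<omega> \<in> \<Lambda> (Suc n) \<and> nbr (Suc n) \<Delta> (\<sigma> @ \<omega>) = nbr_set (Suc n) \<Delta> ! j. prob_of \<omega>)"
    using ivl_trans_mat_entry[OF assms(1) ij(1)] ij(2) by blast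
  have letters: "set \<omega> \<subseteq> {..k}" if "\<sigma> @ \<omega> \<in> \<Lambda> (Suc n)" for \<omega>
    using \<Lambda>_letters[OF that] by simp
  show "0 \<le> ivl_trans_mat n D \<Delta> $$ (i, j)" unfolding T
  proof (rule sum_nonneg)
    fix \<omega> assume "\<omega> \<in> {\<omega>. \<sigma> @ \<omega> \<in> \<Lambda> (Suc n) \<and> nbr (Suc n) \<Delta> (\<sigma> @ \<omega>) = nbr_set (Suc n) \<Delta> ! j}"
    then show "0 \<le> prob_of \<omega>" using prob_of_pos[OF letters, of \<omega>] by simp
  qed
  assume "ivl_trans_mat n D \<Delta> $$ (i, j) \<noteq> 0"
  then obtain \<omega> where \<omega>: "\<sigma> @ \<omega> \<in> \<Lambda> (Suc n)" "nbr (Suc n) \<Delta> (\<sigma> @ \<omega>) = nbr_set (Suc n) \<Delta> ! j"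
    unfolding T by (rule sum.not_neutral_contains_not_neutral) auto
  have "nbr (Suc n) \<Delta> (\<sigma> @ \<omega>) \<in> nbr (Suc n) \<Delta> ` covers (Suc n) \<Delta>"
    unfolding \<omega>(2) set_nbr_set[symmetric] by (rule nth_mem[OF ij(2)])
  then have cov: "\<sigma> @ \<omega> \<in> covers (Suc n) \<Delta>" by (rule covers_if_nbr[OF childrenD(1)[OF assms(2)] \<omega>(1)])
  have "S \<omega> ` K \<subseteq> K" using S_K[OF letters[OF \<omega>(1)]] by (rule image_subsetI)
  then have "S (\<sigma> @ \<omega>) ` K \<subseteq> S \<sigma> ` K" unfolding S_append image_comp[symmetric] by (rule image_mono)
  then show "\<exists>\<sigma>\<in>covers n D. \<exists>\<tau>\<in>covers (Suc n) \<Delta>. nbr n D \<sigma> = nbr_set n D ! i \<and>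
      nbr (Suc n) \<Delta> \<tau> = nbr_set (Suc n) \<Delta> ! j \<and> S \<tau> ` K \<subseteq> S \<sigma> ` K" using \<sigma> \<omega>(2) cov by blast
qed (rule ivl_trans_mat_carrier)

lemma path_mat_Cons:
  assumes "trans_mat \<gamma> \<gamma>' \<in> carrier_mat a (length (fst (snd \<gamma>')))"
  shows "path_mat (\<gamma> # \<gamma>' # \<gamma>s) = trans_mat \<gamma> \<gamma>' * path_mat (\<gamma>' # \<gamma>s)"
  by (cases \<gamma>s) (simp_all add: right_mult_one_mat[OF assms])

text \<open>The two roles of \<open>path_mat\<close>: it is linked, and it transports the weight vectors of any set
  inside the last interval.\<close>

lemma path_mat_path:
  assumes "is_path D"
  shows "linked n (D n) (n + m) (D (n + m)) (path_mat (map (cv D) [n..<Suc (n + m)])) \<and>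
    (\<forall>A\<in>sets borel. A \<subseteq> Ivl (D (n + m)) \<longrightarrow>
      wvec n (D n) A = path_mat (map (cv D) [n..<Suc (n + m)]) *\<^sub>v wvec (n + m) (D (n + m)) A)"
proof (induction m arbitrary: n)
  case 0
  have "path_mat (map (cv D) [n..<Suc (n + 0)]) = 1\<^sub>m (length (nbr_set n (D n)))"
    by (simp add: charvec_def)
  then show ?case using linked_one[of n "D n"] one_mult_mat_vec[OF wvec_carrier] by simp
next
  case (Suc m)
  note net = path_net[OF assms, of n] and child = path_child[OF assms, of n]
  let ?T = "ivl_trans_mat n (D n) (D (Suc n))" and ?P = "path_mat (map (cv D) [Suc n..<Suc (Suc n + m)])"
  have T: "trans_mat (cv D n) (cv D (Suc n)) = ?T" by (rule trans_mat_eq[OF net child])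
  have list: "[n..<Suc (n + Suc m)] = n # [Suc n..<Suc (Suc n + m)]" by (simp add: upt_conv_Cons)
  have list': "[Suc n..<Suc (Suc n + m)] = Suc n # [Suc (Suc n)..<Suc (Suc n + m)]" by (simp add: upt_conv_Cons)
  have "trans_mat (cv D n) (cv D (Suc n)) \<in>
      carrier_mat (length (nbr_set n (D n))) (length (fst (snd (cv D (Suc n)))))"
    unfolding T by (simp add: charvec_def)
  then have eq: "path_mat (map (cv D) [n..<Suc (n + Suc m)]) = ?T * ?P"
    unfolding list list' list.map using path_mat_Cons T by simp
  have IH: "linked (Suc n) (D (Suc n)) (n + Suc m) (D (n + Suc m)) ?P"
    "\<And>A. A \<in> sets borel \<Longrightarrow> A \<subseteq> Ivl (D (n + Suc m)) \<Longrightarrow>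
      wvec (Suc n) (D (Suc n)) A = ?P *\<^sub>v wvec (n + Suc m) (D (n + Suc m)) A"
    using Suc.IH[of "Suc n"] by simp_all
  have "wvec n (D n) A = (?T * ?P) *\<^sub>v wvec (n + Suc m) (D (n + Suc m)) A"
    if A: "A \<in> sets borel" "A \<subseteq> Ivl (D (n + Suc m))" for A
  proof -
    have "A \<subseteq> Ivl (D (Suc n))" using A(2) path_nested[OF assms, of "Suc n" "n + Suc m"] by fastforce
    then have "wvec n (D n) A = ?T *\<^sub>v wvec (Suc n) (D (Suc n)) A" by (intro wvec_step net child A(1))
    also have "\<dots> = (?T * ?P) *\<^sub>v wvec (n + Suc m) (D (n + Suc m)) A"
      unfolding IH(2)[OF A]
      by (rule assoc_mult_mat_vec[symmetric, OF ivl_trans_mat_carrier linkedD(1)[OF IH(1)] wvec_carrier])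
    finally show ?thesis .
  qed
  then show ?case unfolding eq using linked_mult[OF linked_trans_mat[OF net child] IH(1)] by simp
qed

text \<open>A copy \<open>S \<tau> ` K\<close> whose hull covers a descendant of \<open>D\<close> but is shorter than \<open>D\<close> has an end
  inside \<open>D\<close>, and this end belongs to \<open>K\<close>.\<close>

lemma wvec_pos:
  assumes D: "D \<in> net_intervals n" and E: "E \<in> net_intervals m" "fst D \<le> fst E" "snd E \<le> snd D"
    and short: "r_min ^ m < snd D - fst D"
    and \<sigma>: "\<sigma> \<in> covers n D" "nbr n D \<sigma> = nbr_set n D ! i" "i < length (nbr_set n D)"
    and \<tau>: "\<tau> \<in> covers m E" "S \<tau> ` K \<subseteq> S \<sigma> ` K"
  shows "0 < wvec n D (Ivl D) $ i"
proof -
  have "lo \<tau> \<le> fst E" "snd E \<le> hi \<tau>" "hi \<tau> - lo \<tau> \<le> r_min ^ m" "fst E < snd E"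
    using \<tau>(1) covers_iff[OF E(1)] hi_minus_lo[of \<tau>] \<Lambda>_ratio_le[of \<tau> m] net_interval_less[OF E(1)] by auto
  then have "lo \<tau> \<in> {fst D<..<snd D} \<or> hi \<tau> \<in> {fst D<..<snd D}" using E(2,3) short by auto
  moreover have "lo \<tau> \<in> S \<tau> ` K" "hi \<tau> \<in> S \<tau> ` K"
    using imageI[OF K_ends(1), of "S \<tau>"] imageI[OF K_ends(2), of "S \<tau>"]
    by (cases "S \<tau> 0 \<le> S \<tau> 1"; simp add: lo_def hi_def)+
  ultimately obtain y where y: "y \<in> {fst D<..<snd D}" "y \<in> S \<tau> ` K" by metis
  obtain z where z: "z \<in> K" "S \<sigma> z \<in> {fst D<..<snd D}"
    using subsetD[OF \<tau>(2) y(2)] y(1) by (elim imageE) simp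
  have "continuous_on UNIV (S \<sigma>)"
    by (subst continuous_on_cong[OF refl S_affine]) (intro continuous_intros)
  then have "open (S \<sigma> -` {fst D<..<snd D})" by (intro open_vimage) simp_all
  then have "0 < measure \<mu> (S \<sigma> -` {fst D<..<snd D})" using z by (intro mu_pos_open) auto
  also have "\<dots> \<le> measure \<mu> (S \<sigma> -` Ivl D)" by (rule mu_mono[OF _ vimage_S_borel]) auto
  also have "\<dots> = wvec n D (Ivl D) $ i" using \<sigma>(2,3) weight_nbr[of n D "Ivl D" \<sigma>] by (simp add: wvec_def)
  finally show ?thesis .
qed

text \<open>With \<open>w\<close> the weight vector of \<open>D n0\<close> for \<open>D n0\<close> itself, the weight vector of \<open>D n0\<close> for
  \<open>D (n0 + m * s)\<close> is \<open>T ^ m w\<close>: the characteristic vectors agree, so that at the far end \<open>w\<close> appears again.\<close>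

lemma periodic_path_growth:
  assumes D: "is_path D" and s: "0 < s"
    and per: "\<And>i. n0 \<le> i \<Longrightarrow> cv D (i + s) = cv D i"
    and T: "T = path_mat (map (cv D) [n0..<Suc (n0 + s)])"
  shows "0 < sp T"
    and "\<exists>c>0. \<forall>m. c * sp T ^ m \<le> measure \<mu> (Ivl (D (n0 + m * s)))"
    and "sp T < \<rho> \<Longrightarrow> \<exists>C>0. \<forall>m. measure \<mu> (Ivl (D (n0 + m * s))) \<le> C * \<rho> ^ m"
proof -
  let ?V = "nbr_set n0 (D n0)" and ?D = "\<lambda>m. D (n0 + m * s)"
  define w where "w = wvec n0 (D n0) (Ivl (D n0))"
  have perm: "cv D (i + m * s) = cv D i" if "n0 \<le> i" for i m
  proof (induction m)
    case (Suc m)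
    have eq: "i + Suc m * s = (i + m * s) + s" by simp
    show ?case unfolding eq using per[of "i + m * s"] that Suc by simp
  qed simp
  have V: "nbr_set (n0 + m * s) (?D m) = ?V" for m
    using perm[of n0 m] by (simp add: charvec_def)
  have Tm: "path_mat (map (cv D) [n0 + m * s..<Suc (n0 + m * s + s)]) = T" for m
  proof -
    have "map (cv D) [n0 + m * s..<Suc (n0 + m * s + s)] = map (cv D) [n0..<Suc (n0 + s)]"
    proof (rule nth_equalityI)
      fix i assume "i < length (map (cv D) [n0 + m * s..<Suc (n0 + m * s + s)])"
      then show "map (cv D) [n0 + m * s..<Suc (n0 + m * s + s)] ! i = map (cv D) [n0..<Suc (n0 + s)] ! i"
        using perm[of "n0 + i" m] by (simp del: upt_Suc add: ac_simps)
    qed simp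
    then show ?thesis unfolding T by (rule arg_cong)
  qed
  have step: "n0 + m * s + s = n0 + Suc m * s" for m by simp
  note pm = path_mat_path[OF D, of "n0 + m * s" s for m, unfolded Tm, unfolded step]
  have Tc: "T \<in> carrier_mat (length ?V) (length ?V)"
    using linkedD(1)[OF conjunct1[OF pm[of 0]]] unfolding V .
  have pow: "linked n0 (D n0) (n0 + m * s) (?D m) (T ^\<^sub>m m) \<and>
    (\<forall>A\<in>sets borel. A \<subseteq> Ivl (?D m) \<longrightarrow> wvec n0 (D n0) A = T ^\<^sub>m m *\<^sub>v wvec (n0 + m * s) (?D m) A)" for m
  proof (induction m)
    case 0
    have "T ^\<^sub>m 0 = 1\<^sub>m (length ?V)" using Tc by simp
    then show ?case using linked_one[of n0 "D n0"] one_mult_mat_vec[OF wvec_carrier] by simp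
  next
    case (Suc m)
    have "wvec n0 (D n0) A = T ^\<^sub>m Suc m *\<^sub>v wvec (n0 + Suc m * s) (?D (Suc m)) A"
      if A: "A \<in> sets borel" "A \<subseteq> Ivl (?D (Suc m))" for A
    proof -
      have "A \<subseteq> Ivl (?D m)" using A(2) path_nested[OF D, of "n0 + m * s" "n0 + Suc m * s"] by fastforce
      then have "wvec n0 (D n0) A = T ^\<^sub>m m *\<^sub>v wvec (n0 + m * s) (?D m) A" using Suc A(1) by blast
      also have "wvec (n0 + m * s) (?D m) A = T *\<^sub>v wvec (n0 + Suc m * s) (?D (Suc m)) A"
        using pm[of m] A by blast
      also have "T ^\<^sub>m m *\<^sub>v (T *\<^sub>v wvec (n0 + Suc m * s) (?D (Suc m)) A) =
        (T ^\<^sub>m m * T) *\<^sub>v wvec (n0 + Suc m * s) (?D (Suc m)) A"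
        using wvec_carrier[of "n0 + Suc m * s" "?D (Suc m)" A] unfolding V
        by (rule assoc_mult_mat_vec[symmetric, OF pow_carrier_mat[OF Tc] Tc])
      finally show ?thesis by simp
    qed
    moreover have "linked n0 (D n0) (n0 + Suc m * s) (?D (Suc m)) (T ^\<^sub>m Suc m)"
      unfolding pow_mat.simps(2) by (rule linked_mult[OF conjunct1[OF Suc] conjunct1[OF pm]])
    ultimately show ?case by blast
  qed
  have wm: "wvec (n0 + m * s) (?D m) (Ivl (?D m)) = w" for m
  proof -
    have "similar (n0 + m * s) (?D m) n0 (D n0)"
      using similar_if_charvec path_net[OF D] perm[of n0 m] by blast
    then show ?thesis unfolding w_def wvec_def V using weight_similar by presburger
  qed
  have wA: "wvec n0 (D n0) (Ivl (?D m)) = T ^\<^sub>m m *\<^sub>v w" for m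
    using conjunct2[OF pow[of m], rule_format, OF _ subset_refl] unfolding wm by simp
  obtain a b where ab: "0 < a" "0 < b"
    and cmp: "\<forall>A\<in>sets borel. A \<subseteq> Ivl (D n0) \<longrightarrow>
      (\<forall>i<length ?V. a * wvec n0 (D n0) A $ i \<le> measure \<mu> A) \<and>
      (\<forall>u. (\<forall>i<length ?V. wvec n0 (D n0) A $ i \<le> u) \<longrightarrow> measure \<mu> A \<le> b * u)"
    using mu_comparable[OF path_net[OF D, of n0]] by (elim exE conjE) blast
  note lower = cmp[rule_format, THEN conjunct1, rule_format]
    and upper = cmp[rule_format, THEN conjunct2, rule_format]
  have sub: "Ivl (?D m) \<subseteq> Ivl (D n0)" for m using path_nested[OF D, of n0 "n0 + m * s"] by fastforce
  have len: "0 < length ?V"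
    using covers_nonempty[OF path_net[OF D, of n0]] set_nbr_set[of n0 "D n0"] by (cases ?V) auto
  \<comment> \<open>After \<open>M\<close> periods the copies are shorter than \<open>D n0\<close>, as \<open>wvec_pos\<close> requires.\<close>
  obtain M where M: "r_min ^ M < snd (D n0) - fst (D n0)"
    using real_arch_pow_inv[of "snd (D n0) - fst (D n0)" r_min] r_min_less_1 net_interval_less[OF path_net[OF D, of n0]]
    by auto
  have "r_min ^ (n0 + M * s) \<le> r_min ^ M"
    using r_min_pos r_min_less_1 s by (intro power_decreasing) (auto intro: order_trans[of M "M * s"])
  then have short: "r_min ^ (n0 + M * s) < snd (D n0) - fst (D n0)" using M by simp
  have 1: "0 \<le> T $$ (i, j)" if "i < length ?V" "j < length ?V" for i j
    using linkedD(2)[OF conjunct1[OF pm[of 0]], of i j] that unfolding V by simp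
  have 2: "0 \<le> w $ i" if "i < length ?V" for i using that weight_nonneg by (simp add: w_def wvec_def)
  have 3: "0 < w $ i" if ij: "i < length ?V" "j < length ?V" and nz: "(T ^\<^sub>m M) $$ (i, j) \<noteq> 0" for i j
  proof -
    obtain \<sigma> \<tau> where "\<sigma> \<in> covers n0 (D n0)" "\<tau> \<in> covers (n0 + M * s) (?D M)" "nbr n0 (D n0) \<sigma> = ?V ! i"
      "S \<tau> ` K \<subseteq> S \<sigma> ` K"
      using linkedD(3)[OF conjunct1[OF pow[of M]] ij(1) _ nz] ij(2) unfolding V by blast
    then show ?thesis unfolding w_def
      using path_net[OF D] path_nested[OF D, of n0 "n0 + M * s"] short ij(1)
      by (intro wvec_pos[of "D n0" n0 "?D M" "n0 + M * s" \<sigma> i \<tau>]) auto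
  qed
  have 4: "\<exists>i<length ?V. 0 < (T ^\<^sub>m m *\<^sub>v w) $ i" for m
  proof (rule ccontr)
    assume "\<not> ?thesis"
    then have "\<forall>i<length ?V. (T ^\<^sub>m m *\<^sub>v w) $ i \<le> 0" by (meson not_less)
    then have "measure \<mu> (Ivl (?D m)) \<le> b * 0"
      unfolding wA[symmetric] by (intro upper[OF _ sub]) simp_all
    then show False using mu_net_interval_pos[OF path_net[OF D, of "n0 + m * s"]] by simp
  qed
  have wc: "w \<in> carrier_vec (length ?V)" by (simp add: w_def)
  show "0 < sp T" by (rule pow_mat_vec_growth(1)[OF Tc len wc]) (fact 1 2 3 4)+
  obtain c where c: "0 < c" "\<And>m. \<exists>i<length ?V. c * sp T ^ m \<le> (T ^\<^sub>m m *\<^sub>v w) $ i"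
  proof -
    have "\<exists>c>0. \<forall>m. \<exists>i<length ?V. c * sp T ^ m \<le> (T ^\<^sub>m m *\<^sub>v w) $ i"
      by (rule pow_mat_vec_growth(2)[OF Tc len wc]) (fact 1 2 3 4)+
    then show thesis using that by blast
  qed
  have "a * c * sp T ^ m \<le> measure \<mu> (Ivl (?D m))" for m
  proof -
    obtain i where i: "i < length ?V" "c * sp T ^ m \<le> (T ^\<^sub>m m *\<^sub>v w) $ i" using c(2) by blast
    have "a * (c * sp T ^ m) \<le> a * wvec n0 (D n0) (Ivl (?D m)) $ i"
      unfolding wA using i(2) ab(1) by (intro mult_left_mono) auto
    also have "\<dots> \<le> measure \<mu> (Ivl (?D m))" by (rule lower[OF _ sub i(1)]) simp
    finally show ?thesis by (simp add: mult.assoc)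
  qed
  then show "\<exists>c>0. \<forall>m. c * sp T ^ m \<le> measure \<mu> (Ivl (?D m))"
    using ab(1) c(1) by (intro exI[of _ "a * c"]) simp
  assume \<rho>: "sp T < \<rho>"
  then obtain C where C: "0 < C" "\<And>m i. i < length ?V \<Longrightarrow> (T ^\<^sub>m m *\<^sub>v w) $ i \<le> C * \<rho> ^ m"
  proof -
    have "\<exists>C>0. \<forall>m. \<forall>i<length ?V. (T ^\<^sub>m m *\<^sub>v w) $ i \<le> C * \<rho> ^ m"
      by (rule pow_mat_vec_growth(3)[OF Tc len wc]) (fact 1 2 3 4 \<rho>)+
    then show thesis using that by blast
  qed
  have "measure \<mu> (Ivl (?D m)) \<le> b * C * \<rho> ^ m" for m
    using upper[of "Ivl (?D m)" "C * \<rho> ^ m"] sub C(2) wA by (simp add: mult.assoc)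
  then show "\<exists>C>0. \<forall>m. measure \<mu> (Ivl (?D m)) \<le> C * \<rho> ^ m"
    using ab(2) C(1) by (intro exI[of _ "b * C"]) simp
qed

end

section \<open>Finiteness of the set of characteristic vectors\<close>

lemma stream_eqI:
  assumes "\<And>i. s !! i = t !! i"
  shows "s = t"
proof -
  have "snth s = snth t" using assms by (rule ext)
  then show ?thesis using stream_smap_nats[of s] stream_smap_nats[of t] by simp
qed

lemma cycle_snth_add: "u \<noteq> [] \<Longrightarrow> cycle u !! (n + length u) = cycle u !! n"
  by (subst cycle_decomp) simp_all

lemma cycle_snth_less: "n < length u \<Longrightarrow> cycle u !! n = u ! n"
  by (subst cycle_decomp) auto

lemma eventually_cyclicD:
  assumes "\<rho> = \<gamma> @- cycle u" "u \<noteq> []" "length \<gamma> \<le> n"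
  shows "\<rho> !! (n + length u) = \<rho> !! n"
proof -
  have "n + length u - length \<gamma> = n - length \<gamma> + length u" using assms(3) by simp
  then show ?thesis using assms cycle_snth_add[OF assms(2), of "n - length \<gamma>"] by simp
qed

lemma eventually_cyclicI:
  assumes per: "\<And>i. n \<le> i \<Longrightarrow> \<rho> !! (i + p) = \<rho> !! i" and p: "0 < p"
  shows "\<rho> = map (snth \<rho>) [0..<n] @- cycle (map (snth \<rho>) [n..<n + p])"
proof (rule stream_eqI)
  fix i
  let ?u = "map (snth \<rho>) [n..<n + p]"
  have u: "?u \<noteq> []" "length ?u = p" using p by simp_all
  show "\<rho> !! i = (map (snth \<rho>) [0..<n] @- cycle ?u) !! i"
  proof (induction i rule: less_induct)
    case (less i)
    consider "i < n" | "n \<le> i" "i < n + p" | "n + p \<le> i" by linarith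
    then show ?case
    proof cases
      case 1
      then show ?thesis by simp
    next
      case 2
      then show ?thesis using cycle_snth_less[of "i - n" ?u] by simp
    next
      case 3
      then have eq: "i - p + p = i" "n \<le> i - p" "i - p < i" using p by simp_all
      have "\<rho> !! i = \<rho> !! (i - p)" using per[OF eq(2)] eq(1) by simp
      also have "\<dots> = (map (snth \<rho>) [0..<n] @- cycle ?u) !! (i - p)" by (rule less[OF eq(3)])
      also have "\<dots> = (map (snth \<rho>) [0..<n] @- cycle ?u) !! (i - p + length ?u)"
        by (rule eventually_cyclicD[OF refl u(1), symmetric]) (use eq in simp)
      finally show ?thesis using eq(1) u(2) by simp
    qed
  qed
qed

text \<open>A sequence that repeats with period \<open>s\<close> from index \<open>a\<close> on inherits there every period that it
  has from some later index on.\<close>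

lemma period_from_earlier:
  fixes f :: "nat \<Rightarrow> 'a"
  assumes s: "\<And>i. a \<le> i \<Longrightarrow> f (i + s) = f i" "0 < s"
    and p: "\<And>i. b \<le> i \<Longrightarrow> f (i + p) = f i"
    and i: "a \<le> i"
  shows "f (i + p) = f i"
proof -
  have mult: "f (j + m * s) = f j" if "a \<le> j" for j m
  proof (induction m)
    case (Suc m)
    have eq: "j + Suc m * s = (j + m * s) + s" by simp
    show ?case unfolding eq using s(1)[of "j + m * s"] that Suc by simp
  qed simp
  have "b * 1 \<le> b * s" using s(2) by (intro mult_le_mono2) simp
  then have b: "b \<le> i + b * s" by linarith
  have "f (i + p) = f ((i + b * s) + p)" using mult[of "i + p" b] i by (simp add: ac_simps)
  also have "\<dots> = f (i + b * s)" by (rule p[OF b])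
  also have "\<dots> = f i" by (rule mult[OF i])
  finally show ?thesis .
qed

lemma period_multiple:
  fixes f :: "nat \<Rightarrow> 'a"
  assumes "\<And>i. a \<le> i \<Longrightarrow> f (i + p) = f i" "p dvd q" "a \<le> i"
  shows "f (i + q) = f i"
proof -
  have "f (i + m * p) = f i" for m
  proof (induction m)
    case (Suc m)
    have eq: "i + Suc m * p = (i + m * p) + p" by simp
    show ?case unfolding eq using assms(1)[of "i + m * p"] assms(3) Suc by simp
  qed simp
  moreover obtain m where "q = m * p" using assms(2) by (metis dvd_def mult.commute)
  ultimately show ?thesis by blast
qed

lemma finite_image_factor:
  assumes "finite (g ` X)" "\<And>x y. x \<in> X \<Longrightarrow> y \<in> X \<Longrightarrow> g x = g y \<Longrightarrow> f x = f y"
  shows "finite (f ` X)"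
proof -
  have "f ` X \<subseteq> (\<lambda>v. f (SOME x. x \<in> X \<and> g x = v)) ` g ` X"
  proof
    fix y assume "y \<in> f ` X"
    then obtain x where x: "x \<in> X" "y = f x" by blast
    have "(SOME x'. x' \<in> X \<and> g x' = g x) \<in> X \<and> g (SOME x'. x' \<in> X \<and> g x' = g x) = g x"
      by (rule someI[of "\<lambda>x'. x' \<in> X \<and> g x' = g x"]) (use x in simp)
    then have "y = f (SOME x'. x' \<in> X \<and> g x' = g x)" using assms(2) x by metis
    then show "y \<in> (\<lambda>v. f (SOME x. x \<in> X \<and> g x = v)) ` g ` X" using x(1) by blast
  qed
  then show ?thesis using assms(1) by (rule finite_subset[OF _ finite_imageI])
qed

context ifs
begin

lemma neighbours_iff:
  assumes "\<sigma> \<in> \<Lambda> n"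
  shows "\<tau> \<in> neighbours n \<sigma> \<longleftrightarrow> \<tau> \<in> \<Lambda> n \<and> lo \<tau> < hi \<sigma> \<and> lo \<sigma> < hi \<tau>"
proof -
  have "{lo \<sigma><..<hi \<sigma>} \<inter> {lo \<tau><..<hi \<tau>} \<noteq> {} \<longleftrightarrow> lo \<tau> < hi \<sigma> \<and> lo \<sigma> < hi \<tau>" if "\<tau> \<in> \<Lambda> n"
  proof -
    have "lo \<sigma> < hi \<sigma>" "lo \<tau> < hi \<tau>" using lo_less_hi \<Lambda>_letters assms that by blast+
    moreover have "{lo \<sigma><..<hi \<sigma>} \<inter> {lo \<tau><..<hi \<tau>} = {max (lo \<sigma>) (lo \<tau>)<..<min (hi \<sigma>) (hi \<tau>)}" by auto
    ultimately show ?thesis by auto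
  qed
  then show ?thesis
    unfolding neighbours_def mem_Collect_eq S_Ioo[OF \<Lambda>_letters[OF assms]]
    using S_Ioo[OF \<Lambda>_letters, of \<tau> n] by metis
qed

text \<open>The normalized differences between ends of neighbours. They are invariants of the
  neighbourhood type, and contain all numbers that occur in the characteristic vectors of the net
  intervals covered by \<open>\<sigma>\<close>.\<close>

definition nbhd_diffs :: "nat \<Rightarrow> nat list \<Rightarrow> real set" where
  "nbhd_diffs n \<sigma> = {(S \<eta> e - S \<eta>' e') / r_min ^ n | \<eta> e \<eta>' e'.
     \<eta> \<in> neighbours n \<sigma> \<and> \<eta>' \<in> neighbours n \<sigma> \<and> e \<in> {0, 1} \<and> e' \<in> {0, 1}}"

lemma finite_nbhd_diffs: "finite (nbhd_diffs n \<sigma>)"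
proof (rule finite_subset)
  let ?E = "\<Union>\<eta>\<in>neighbours n \<sigma>. {S \<eta> 0, S \<eta> 1}"
  show "nbhd_diffs n \<sigma> \<subseteq> (\<lambda>(u, v). (u - v) / r_min ^ n) ` (?E \<times> ?E)"
  proof
    fix y assume "y \<in> nbhd_diffs n \<sigma>"
    then obtain \<eta> e \<eta>' e' where y: "y = (\<lambda>(u, v). (u - v) / r_min ^ n) (S \<eta> e, S \<eta>' e')"
      "\<eta> \<in> neighbours n \<sigma>" "\<eta>' \<in> neighbours n \<sigma>" "e \<in> {0, 1}" "e' \<in> {0, 1}"
      unfolding nbhd_diffs_def by auto
    then have "(S \<eta> e, S \<eta>' e') \<in> ?E \<times> ?E" by auto
    with y(1) show "y \<in> (\<lambda>(u, v). (u - v) / r_min ^ n) ` (?E \<times> ?E)" by (rule image_eqI)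
  qed
  have "finite (neighbours n \<sigma>)" using finite_\<Lambda>[of n] by (auto simp: neighbours_def)
  then show "finite ((\<lambda>(u, v). (u - v) / r_min ^ n) ` (?E \<times> ?E))" by simp
qed

lemma same_nbhd_type_diffs:
  assumes "((n, \<sigma>), (m, \<tau>)) \<in> same_nbhd_type"
  shows "nbhd_diffs m \<tau> \<subseteq> nbhd_diffs n \<sigma>"
proof
  fix y assume "y \<in> nbhd_diffs m \<tau>"
  then obtain \<nu> e \<nu>' e' where y: "y = (S \<nu> e - S \<nu>' e') / r_min ^ m" "\<nu> \<in> neighbours m \<tau>"
    "\<nu>' \<in> neighbours m \<tau>" "e \<in> {0, 1}" "e' \<in> {0, 1}" unfolding nbhd_diffs_def by blast
  define f where "f s c x = s * r_min powi (int m - int n) * x + c" for s c x :: real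
  obtain s c where s: "s \<in> {1, - 1}" and f: "(\<lambda>\<eta>. f s c \<circ> S \<eta>) ` neighbours n \<sigma> = S ` neighbours m \<tau>"
    using assms unfolding same_nbhd_type_def Let_def f_def by auto
  have "S \<nu> \<in> (\<lambda>\<eta>. f s c \<circ> S \<eta>) ` neighbours n \<sigma>" "S \<nu>' \<in> (\<lambda>\<eta>. f s c \<circ> S \<eta>) ` neighbours n \<sigma>"
    unfolding f by (rule imageI[OF y(2)], rule imageI[OF y(3)])
  then obtain \<eta> \<eta>' where \<eta>: "\<eta> \<in> neighbours n \<sigma>" "S \<nu> = f s c \<circ> S \<eta>"
    "\<eta>' \<in> neighbours n \<sigma>" "S \<nu>' = f s c \<circ> S \<eta>'" by blast
  have pw: "r_min powi (int m - int n) = r_min ^ m / r_min ^ n"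
    using r_min_pos by (simp add: power_int_diff)
  have "S \<nu> e - S \<nu>' e' = s * (r_min ^ m / r_min ^ n) * (S \<eta> e - S \<eta>' e')"
    unfolding \<eta>(2,4) f_def pw comp_def by (simp only: add_diff_cancel_right right_diff_distrib)
  then have "y = s * ((S \<eta> e - S \<eta>' e') / r_min ^ n)"
    using r_min_pos unfolding y(1) by simp
  then have "y = (S \<eta> e - S \<eta>' e') / r_min ^ n \<or> y = (S \<eta>' e' - S \<eta> e) / r_min ^ n"
    using s by (auto simp: minus_divide_left)
  then show "y \<in> nbhd_diffs n \<sigma>" unfolding nbhd_diffs_def using \<eta>(1,3) y(4,5) by blast
qed

lemma same_nbhd_type_refl: "\<sigma> \<in> \<Lambda> n \<Longrightarrow> ((n, \<sigma>), (n, \<sigma>)) \<in> same_nbhd_type"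
  unfolding same_nbhd_type_def mem_Collect_eq prod.case Let_def
  by (intro conjI exI[of _ "1::real"] exI[of _ "0::real"]) (simp_all add: comp_def)

text \<open>One representative of each neighbourhood type contributes all differences of its type.\<close>

lemma finite_nbhd_diffs_Union:
  assumes finite_type
  shows "finite (\<Union>(n, \<sigma>)\<in>(SIGMA n:UNIV. \<Lambda> n). nbhd_diffs n \<sigma>)"
proof -
  let ?A = "SIGMA n:UNIV. \<Lambda> n" and ?R = same_nbhd_type
  define rep where "rep C = (SOME y. y \<in> ?A \<and> ?R `` {y} = C)" for C
  have "(\<Union>(n, \<sigma>)\<in>?A. nbhd_diffs n \<sigma>) \<subseteq> (\<Union>C\<in>?A // ?R. case_prod nbhd_diffs (rep C))"
  proof
    fix y assume "y \<in> (\<Union>(n, \<sigma>)\<in>?A. nbhd_diffs n \<sigma>)"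
    then obtain m \<tau> where \<tau>: "\<tau> \<in> \<Lambda> m" "y \<in> nbhd_diffs m \<tau>" by blast
    let ?C = "?R `` {(m, \<tau>)}"
    have C: "?C \<in> ?A // ?R" using \<tau>(1) by (intro quotientI) simp
    have "rep ?C \<in> ?A \<and> ?R `` {rep ?C} = ?C"
      unfolding rep_def by (rule someI[of _ "(m, \<tau>)"]) (use \<tau>(1) in simp)
    moreover have "(m, \<tau>) \<in> ?C" using same_nbhd_type_refl[OF \<tau>(1)] by blast
    ultimately have "(m, \<tau>) \<in> ?R `` {rep ?C}" by (simp only:)
    then have "((fst (rep ?C), snd (rep ?C)), (m, \<tau>)) \<in> ?R" by (simp only: Image_singleton_iff prod.collapse)
    from subsetD[OF same_nbhd_type_diffs[OF this] \<tau>(2)] have "y \<in> case_prod nbhd_diffs (rep ?C)"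
      by (simp only: case_prod_beta)
    with C show "y \<in> (\<Union>C\<in>?A // ?R. case_prod nbhd_diffs (rep C))" by (rule UN_I)
  qed
  moreover have "finite (\<Union>C\<in>?A // ?R. case_prod nbhd_diffs (rep C))"
    unfolding case_prod_beta using assms[unfolded finite_type_def] finite_nbhd_diffs by (rule finite_UN_I)
  ultimately show ?thesis by (rule finite_subset)
qed

lemma net_point_neighbour:
  assumes "\<sigma> \<in> \<Lambda> n" "y \<in> net_points n" "lo \<sigma> \<le> y" "y \<le> hi \<sigma>"
  shows "\<exists>\<eta>\<in>neighbours n \<sigma>. \<exists>e\<in>{0, 1}. y = S \<eta> e"
proof -
  have self: "\<sigma> \<in> neighbours n \<sigma>"
    using neighbours_iff[OF assms(1)] assms(1) lo_less_hi[OF \<Lambda>_letters[OF assms(1)]] by simp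
  have ends: "\<exists>e\<in>{0, 1}. lo \<eta> = S \<eta> e" "\<exists>e\<in>{0, 1}. hi \<eta> = S \<eta> e" for \<eta>
    by (auto simp: lo_def hi_def min_def max_def)
  consider "y = lo \<sigma>" | "y = hi \<sigma>" | "lo \<sigma> < y" "y < hi \<sigma>" using assms(3,4) by linarith
  then show ?thesis
  proof cases
    case 3
    obtain \<tau> where \<tau>: "\<tau> \<in> \<Lambda> n" "y = lo \<tau> \<or> y = hi \<tau>"
      using assms(2) unfolding net_points_eq by blast
    have "\<tau> \<in> neighbours n \<sigma>"
      unfolding neighbours_iff[OF assms(1)] using \<tau> lo_less_hi[OF \<Lambda>_letters[OF \<tau>(1)]] 3 by linarith
    then show ?thesis using \<tau>(2) ends[of \<tau>] by metis
  qed (use self ends[of \<sigma>] in metis)+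
qed

text \<open>Any word \<open>\<sigma>\<close> that covers \<open>\<Delta>\<close> has the other such words as neighbours, and the ends of \<open>\<Delta>\<close> are
  ends of neighbours of \<open>\<sigma>\<close>.\<close>

lemma char_data_diffs:
  assumes "\<Delta> \<in> net_intervals n"
  shows "\<exists>\<sigma>\<in>\<Lambda> n. norm_length n \<Delta> \<in> nbhd_diffs n \<sigma> \<and> set (nbr_set n \<Delta>) \<subseteq> nbhd_diffs n \<sigma> \<times> nbhd_diffs n \<sigma>"
proof -
  obtain \<sigma> where "\<sigma> \<in> covers n \<Delta>" using covers_nonempty[OF assms] by blast
  then have \<sigma>: "\<sigma> \<in> \<Lambda> n" "lo \<sigma> \<le> fst \<Delta>" "snd \<Delta> \<le> hi \<sigma>" using covers_iff[OF assms] by auto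
  note less = net_interval_less[OF assms]
  have "fst \<Delta> \<in> net_points n" "snd \<Delta> \<in> net_points n" using assms by (auto simp: net_interval_iff)
  then obtain \<alpha> a \<beta> b where \<alpha>: "\<alpha> \<in> neighbours n \<sigma>" "a \<in> {0, 1}" "fst \<Delta> = S \<alpha> a"
    and \<beta>: "\<beta> \<in> neighbours n \<sigma>" "b \<in> {0, 1}" "snd \<Delta> = S \<beta> b"
    using net_point_neighbour[OF \<sigma>(1), of "fst \<Delta>"] net_point_neighbour[OF \<sigma>(1), of "snd \<Delta>"] \<sigma> less by force
  have "norm_length n \<Delta> \<in> nbhd_diffs n \<sigma>"
    unfolding norm_length_def nbhd_diffs_def \<alpha>(3) \<beta>(3) using \<alpha>(1,2) \<beta>(1,2) by blast
  moreover have "nbr n \<Delta> \<tau> \<in> nbhd_diffs n \<sigma> \<times> nbhd_diffs n \<sigma>" if "\<tau> \<in> covers n \<Delta>" for \<tau>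
  proof -
    have "\<tau> \<in> \<Lambda> n" "lo \<tau> \<le> fst \<Delta>" "snd \<Delta> \<le> hi \<tau>" using covers_iff[OF assms] that by auto
    then have \<tau>: "\<tau> \<in> neighbours n \<sigma>" using neighbours_iff[OF \<sigma>(1)] \<sigma> less by auto
    have "(fst \<Delta> - S \<tau> 0) / r_min ^ n \<in> nbhd_diffs n \<sigma>"
      unfolding nbhd_diffs_def \<alpha>(3) using \<alpha>(1,2) \<tau> by blast
    moreover have eq: "ratio \<tau> = S \<tau> 1 - S \<tau> 0" using S_affine[of \<tau> 1] by simp
    have "ratio \<tau> / r_min ^ n \<in> nbhd_diffs n \<sigma>"
      unfolding nbhd_diffs_def eq using \<tau> by blast
    ultimately show ?thesis by (simp add: nbr_def)
  qed
  ultimately show ?thesis using \<sigma>(1) unfolding set_nbr_set by blast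
qed

definition charvecs :: "char_vec set" where
  "charvecs = {charvec n \<Delta> | n \<Delta>. \<Delta> \<in> net_intervals n}"

lemma card_children_similar:
  assumes "similar n D m E"
  shows "card (children n D) = card (children m E)"
proof (rule bij_betw_same_card)
  show "bij_betw (xfer_ivl n D m E) (children n D) (children m E)"
    by (rule bij_betwI[where g = "xfer_ivl m E n D"])
      (use xfer_children[OF assms] xfer_children[OF similar_sym[OF assms]] in \<open>auto simp: xfer_ivl_inverse\<close>)
qed

text \<open>Lengths and neighbour pairs come from the finite set \<open>Q\<close>. They determine the number of
  children, which therefore takes finitely many values and bounds the indices.\<close>

lemma finite_charvecs:
  assumes finite_type
  shows "finite charvecs"
proof -
  define Q where "Q = (\<Union>(n, \<sigma>)\<in>(SIGMA n:UNIV. \<Lambda> n). nbhd_diffs n \<sigma>)"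
  define P where "P = Q \<times> {vs. set vs \<subseteq> Q \<times> Q \<and> distinct vs}"
  define X where "X = (SIGMA n:UNIV. net_intervals n)"
  have "finite Q" unfolding Q_def by (rule finite_nbhd_diffs_Union[OF assms])
  then have P: "finite P" unfolding P_def by (intro finite_cartesian_product finite_subset_distinct)
  have dataP: "(norm_length n \<Delta>, nbr_set n \<Delta>) \<in> P" if \<Delta>: "\<Delta> \<in> net_intervals n" for n \<Delta>
  proof -
    obtain \<sigma> where \<sigma>: "\<sigma> \<in> \<Lambda> n" "norm_length n \<Delta> \<in> nbhd_diffs n \<sigma>"
      "set (nbr_set n \<Delta>) \<subseteq> nbhd_diffs n \<sigma> \<times> nbhd_diffs n \<sigma>" using char_data_diffs[OF \<Delta>] by blast
    moreover have "nbhd_diffs n \<sigma> \<subseteq> Q" unfolding Q_def using \<sigma>(1) by blast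
    ultimately show ?thesis unfolding P_def using distinct_nbr_set by blast
  qed
  let ?g = "\<lambda>(n, \<Delta>). (norm_length n \<Delta>, nbr_set n \<Delta>)" and ?f = "\<lambda>(n, \<Delta>). card (children n \<Delta>)"
  have fin: "finite (?f ` X)"
  proof (rule finite_image_factor)
    show "finite (?g ` X)" by (rule finite_subset[OF _ P]) (auto simp: X_def dataP)
    show "?f x = ?f y" if "x \<in> X" "y \<in> X" "?g x = ?g y" for x y
      using that card_children_similar[of "fst x" "snd x" "fst y" "snd y"]
      by (auto simp: X_def similar_def)
  qed
  obtain B where B: "\<And>c. c \<in> ?f ` X \<Longrightarrow> c \<le> B" using finite_nat_set_iff_bounded_le fin by metis
  have idx: "sibling_index n \<Delta> \<le> max 1 B" if \<Delta>: "\<Delta> \<in> net_intervals n" for n \<Delta>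
  proof (cases n)
    case (Suc m)
    obtain D where D: "D \<in> net_intervals m" "\<Delta> \<in> children m D" using parent_exists \<Delta> Suc by blast
    have "sibling_index n \<Delta> \<le> card (children m D)"
      using parent_eq[OF D] finite_children[of m D] by (auto simp: Suc sibling_index_def intro!: card_mono)
    also have "\<dots> \<le> B" using B[of "card (children m D)"] D(1) by (force simp: X_def)
    finally show ?thesis by simp
  qed (simp add: sibling_index_def)
  have "charvecs \<subseteq> (\<lambda>((l, vs), t). (l, vs, t)) ` (P \<times> {..max 1 B})"
  proof
    fix v assume "v \<in> charvecs"
    then obtain n \<Delta> where \<Delta>: "\<Delta> \<in> net_intervals n" "v = charvec n \<Delta>" by (auto simp: charvecs_def)
    then have "v = (\<lambda>((l, vs), t). (l, vs, t)) ((norm_length n \<Delta>, nbr_set n \<Delta>), sibling_index n \<Delta>)"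
      by (simp add: charvec_def)
    moreover have "((norm_length n \<Delta>, nbr_set n \<Delta>), sibling_index n \<Delta>) \<in> P \<times> {..max 1 B}"
      using dataP[OF \<Delta>(1)] idx[OF \<Delta>(1)] by simp
    ultimately show "v \<in> (\<lambda>((l, vs), t). (l, vs, t)) ` (P \<times> {..max 1 B})" by (rule image_eqI)
  qed
  moreover have "finite ((\<lambda>((l, vs), t). (l, vs, t)) ` (P \<times> {..max 1 B}))" using P by blast
  ultimately show ?thesis by (rule finite_subset)
qed

end

section \<open>Symbolic representations of boundary points\<close>

context ifs
begin

lemma path_determined:
  assumes "is_path D" "is_path E" "\<And>n. cv D n = cv E n"
  shows "D n = E n"
proof (induction n)
  case 0
  then show ?case using assms(1,2) by (simp add: is_path_def)
next
  case (Suc n)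
  have "E (Suc n) \<in> children n (D n)" using path_child[OF assms(2), of n] Suc by simp
  then show ?case
    using child_determined[OF path_net[OF assms(1)] path_child[OF assms(1)], of "E (Suc n)" n] assms(3) by blast
qed

lemma path_ancestors_eq:
  assumes "is_path D" "is_path E" "D n = E n" "m \<le> n"
  shows "D m = E m"
  using assms(4)
proof (induction m rule: inc_induct)
  case (step m)
  then show ?case
    using parent_unique[OF path_net[OF assms(1), of m] path_net[OF assms(2), of m] path_child[OF assms(1), of m]]
      path_child[OF assms(2), of m] by simp
qed (rule assms(3))

lemma ancestors_exist:
  "\<Delta> \<in> net_intervals n \<Longrightarrow> \<exists>E. E 0 = (0, 1) \<and> E n = \<Delta> \<and> (\<forall>i<n. E (Suc i) \<in> children i (E i))"
proof (induction n arbitrary: \<Delta>)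
  case 0
  then show ?case by (intro exI[of _ "\<lambda>_. (0, 1)"]) (simp add: net_intervals_def)
next
  case (Suc n)
  obtain D where D: "D \<in> net_intervals n" "\<Delta> \<in> children n D" using parent_exists[OF Suc.prems] by blast
  obtain E where E: "E 0 = (0, 1)" "E n = D" "\<forall>i<n. E (Suc i) \<in> children i (E i)" using Suc.IH[OF D(1)] by blast
  show ?case
    by (intro exI[of _ "E(Suc n := \<Delta>)"]) (use D E in \<open>auto simp: less_Suc_eq\<close>)
qed

lemma adjacent_net_intervals:
  assumes "\<Delta> \<in> net_intervals n" "E \<in> net_intervals n" "\<Delta> \<noteq> E" "x \<in> Ivl \<Delta>" "x \<in> Ivl E"
  shows "snd \<Delta> = x \<and> fst E = x \<or> fst \<Delta> = x \<and> snd E = x"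
  using net_interval_eq[OF assms(1,2)] assms(3-5) by fastforce

lemma net_point_is_end:
  assumes "\<Delta> \<in> net_intervals n" "x \<in> net_points n" "x \<in> Ivl \<Delta>"
  shows "fst \<Delta> = x \<or> snd \<Delta> = x"
  using net_interval_no_point[OF assms(1,2)] assms(3) by auto

lemma path_end_stays:
  assumes D: "is_path D" "\<And>n. x \<in> Ivl (D n)" and "m \<le> n"
  shows "fst (D m) = x \<Longrightarrow> fst (D n) = x" "snd (D m) = x \<Longrightarrow> snd (D n) = x"
  using path_nested[OF D(1) assms(3)] D(2)[of n] by auto

text \<open>Once \<open>x\<close> is an end, the path is forced to follow the child at that end, so each
  characteristic vector determines the next one.\<close>

lemma end_path_deterministic:
  assumes D: "is_path D" and e: "(\<forall>n\<ge>N. fst (D n) = x) \<or> (\<forall>n\<ge>N. snd (D n) = x)"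
    and ij: "N \<le> i" "N \<le> j" "cv D i = cv D j"
  shows "cv D (Suc i) = cv D (Suc j)"
proof -
  have sim: "similar i (D i) j (D j)" using similar_if_charvec path_net[OF D] ij(3) by blast
  let ?E = "xfer_ivl i (D i) j (D j) (D (Suc i))"
  have E: "?E \<in> net_intervals (Suc j)" "D (Suc j) \<in> net_intervals (Suc j)"
    using childrenD(1)[OF xfer_children[OF sim path_child[OF D]]] path_net[OF D] by blast+
  note less = net_interval_less[OF E(1)] net_interval_less[OF E(2)]
  have "?E = D (Suc j)"
    using e
  proof
    assume e: "\<forall>n\<ge>N. fst (D n) = x"
    then have f: "fst (D i) = x" "fst (D j) = x" "fst (D (Suc i)) = x" "fst (D (Suc j)) = x" using ij(1,2) by auto
    have "fst ?E = x" using xfer_fst[of i "D i" j "D j"] unfolding f by (simp add: xfer_ivl_def f)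
    then show ?thesis using less f(4) by (intro net_interval_eq[OF E]) auto
  next
    assume e: "\<forall>n\<ge>N. snd (D n) = x"
    then have f: "snd (D i) = x" "snd (D j) = x" "snd (D (Suc i)) = x" "snd (D (Suc j)) = x" using ij(1,2) by auto
    have "snd ?E = x" using xfer_snd[OF sim] unfolding f by (simp add: xfer_ivl_def f)
    then show ?thesis using less f(4) by (intro net_interval_eq[OF E]) auto
  qed
  then show ?thesis using xfer_charvec[OF sim path_child[OF D]] by simp
qed

lemma boundary_path_ends:
  assumes D: "is_path D" "\<And>n. x \<in> Ivl (D n)" and x: "x \<in> net_points N"
  shows "(\<forall>n\<ge>N. fst (D n) = x) \<or> (\<forall>n\<ge>N. snd (D n) = x)"
  using net_point_is_end[OF path_net[OF D(1)] x D(2)] path_end_stays[OF D] by blast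

text \<open>Among any more indices than there are characteristic vectors, one vector occurs twice, and from
  there on the path repeats itself.\<close>

lemma boundary_path_periodic:
  assumes fin: "finite charvecs" and D: "is_path D" "\<And>n. x \<in> Ivl (D n)" and x: "x \<in> net_points N"
  shows "\<exists>n p. 0 < p \<and> p \<le> card charvecs \<and> (\<forall>i\<ge>n. cv D (i + p) = cv D i)"
proof -
  let ?I = "{N..N + card charvecs}"
  have "cv D ` ?I \<subseteq> charvecs" unfolding charvecs_def using path_net[OF D(1)] by blast
  then have "card (cv D ` ?I) \<le> card charvecs" by (rule card_mono[OF fin])
  then have "\<not> inj_on (cv D) ?I" using card_image[of "cv D" ?I] by auto
  then obtain i j where ij: "i \<in> ?I" "j \<in> ?I" "i < j" "cv D i = cv D j"
    unfolding inj_on_def by (metis linorder_neqE_nat)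
  define p where "p = j - i"
  have "cv D (l + p) = cv D l" if "i \<le> l" for l
    using that
  proof (induction l rule: dec_induct)
    case base
    show ?case using ij by (simp add: p_def)
  next
    case (step l)
    have "cv D (Suc (l + p)) = cv D (Suc l)"
      by (rule end_path_deterministic[OF D(1) boundary_path_ends[OF D x]]) (use step ij in auto)
    then show ?case by simp
  qed
  moreover have "0 < p" "p \<le> card charvecs" using ij by (auto simp: p_def)
  ultimately show ?thesis by blast
qed

lemma cycleI:
  assumes D: "is_path D" and p: "0 < p" and per: "cv D (n + p) = cv D n"
  shows "is_cycle (map (cv D) [n..<Suc (n + p)])"
proof -
  let ?\<theta> = "map (cv D) [n..<Suc (n + p)]"
  have "hd ?\<theta> = last ?\<theta>" using p per by (simp add: hd_map upt_conv_Cons last_map)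
  moreover have "successively child_vec ?\<theta>"
    unfolding successively_conv_nth
  proof (intro allI impI)
    fix i assume "Suc i < length ?\<theta>"
    then have "?\<theta> ! i = cv D (n + i)" "?\<theta> ! Suc i = cv D (Suc (n + i))"
      by (simp_all del: upt_Suc)
    then show "child_vec (?\<theta> ! i) (?\<theta> ! Suc i)"
      unfolding child_vec_def using path_net[OF D, of "n + i"] path_child[OF D, of "n + i"] by metis
  qed
  ultimately show ?thesis using p by (simp add: is_cycle_def)
qed

lemma periodic_path_stream:
  assumes D: "is_path D" and p: "0 < p" and per: "\<And>i. n \<le> i \<Longrightarrow> cv D (i + p) = cv D i"
    and \<rho>: "\<And>i. \<rho> !! i = cv D i"
  shows "is_cycle (map (cv D) [n..<Suc (n + p)])"
    and "\<rho> = map (cv D) [0..<n] @- cycle (butlast (map (cv D) [n..<Suc (n + p)]))"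
proof -
  show "is_cycle (map (cv D) [n..<Suc (n + p)])" by (rule cycleI[OF D p per]) simp
  have "snth \<rho> = cv D" using \<rho> by (rule ext)
  moreover have "butlast (map (cv D) [n..<Suc (n + p)]) = map (cv D) [n..<n + p]"
    by (simp add: map_butlast[symmetric])
  ultimately show "\<rho> = map (cv D) [0..<n] @- cycle (butlast (map (cv D) [n..<Suc (n + p)]))"
    using eventually_cyclicI[of n \<rho> p, OF _ p] per \<rho> by simp
qed

lemma stream_cycleD:
  assumes \<rho>: "\<And>i. \<rho> !! i = cv D i" and eq: "\<rho> = \<gamma> @- cycle (butlast \<theta>)" and cyc: "is_cycle \<theta>"
  shows "0 < length \<theta> - 1" and "length \<gamma> \<le> i \<Longrightarrow> cv D (i + (length \<theta> - 1)) = cv D i"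
    and "\<theta> = map (cv D) [length \<gamma>..<Suc (length \<gamma> + (length \<theta> - 1))]"
proof -
  have len: "2 \<le> length \<theta>" "hd \<theta> = last \<theta>" using cyc by (auto simp: is_cycle_def)
  then show pos: "0 < length \<theta> - 1" by simp
  have ne: "butlast \<theta> \<noteq> []" "length (butlast \<theta>) = length \<theta> - 1" using len(1) by (auto simp flip: length_0_conv)
  show per: "cv D (i + (length \<theta> - 1)) = cv D i" if "length \<gamma> \<le> i" for i
    using eventually_cyclicD[OF eq ne(1) that] \<rho> ne(2) by simp
  have \<theta>: "\<theta> \<noteq> []" using len(1) by auto
  have nth: "\<theta> ! j = cv D (length \<gamma> + j)" if "j < length \<theta> - 1" for j
  proof -
    have "cv D (length \<gamma> + j) = (\<gamma> @- cycle (butlast \<theta>)) !! (length \<gamma> + j)" using \<rho>[of "length \<gamma> + j"] eq by simp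
    also have "\<dots> = cycle (butlast \<theta>) !! j" by simp
    also have "\<dots> = butlast \<theta> ! j" by (rule cycle_snth_less) (use that in simp)
    finally show ?thesis using that by (simp add: nth_butlast)
  qed
  show "\<theta> = map (cv D) [length \<gamma>..<Suc (length \<gamma> + (length \<theta> - 1))]"
  proof (rule nth_equalityI)
    show "length \<theta> = length (map (cv D) [length \<gamma>..<Suc (length \<gamma> + (length \<theta> - 1))])"
      using len(1) unfolding length_map length_upt by linarith
    fix j assume j: "j < length \<theta>"
    have r: "map (cv D) [length \<gamma>..<Suc (length \<gamma> + (length \<theta> - 1))] ! j = cv D (length \<gamma> + j)"
      using j by (simp del: upt_Suc)
    show "\<theta> ! j = map (cv D) [length \<gamma>..<Suc (length \<gamma> + (length \<theta> - 1))] ! j"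
    proof (cases "j < length \<theta> - 1")
      case True
      then show ?thesis using nth r by simp
    next
      case False
      then have "j = length \<theta> - 1" using j by simp
      then have "\<theta> ! j = last \<theta>" using last_conv_nth[OF \<theta>] by simp
      also have "\<dots> = \<theta> ! 0" using len(2) hd_conv_nth[OF \<theta>] by simp
      also have "\<dots> = cv D (length \<gamma>)" using nth[of 0] pos by simp
      also have "\<dots> = cv D (length \<gamma> + j)" using per[of "length \<gamma>"] \<open>j = length \<theta> - 1\<close> by simp
      finally show ?thesis using r by simp
    qed
  qed
qed

lemma boundary_net_point: "boundary_point x \<Longrightarrow> \<exists>N. x \<in> net_points N"
  unfolding boundary_point_def by (auto simp: net_interval_iff)

lemma min_period_length_props:
  assumes fin: "finite charvecs" and x: "boundary_point x" and \<rho>: "symbolic_rep x \<rho>"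
  shows "0 < min_period_length \<rho>" "min_period_length \<rho> \<le> card charvecs"
    "\<exists>n. \<forall>i\<ge>n. \<rho> !! (i + min_period_length \<rho>) = \<rho> !! i"
proof -
  let ?P = "\<lambda>s. \<exists>\<gamma> \<theta>. \<gamma> \<noteq> [] \<and> is_cycle \<theta> \<and> length \<theta> - 1 = s \<and> \<rho> = \<gamma> @- cycle (butlast \<theta>)"
  obtain D where D: "is_path D" "\<And>n. x \<in> Ivl (D n)" "\<And>i. \<rho> !! i = cv D i" using \<rho> symbolic_rep_iff by blast
  obtain N where N: "x \<in> net_points N" using boundary_net_point[OF x] by blast
  obtain n p where p: "0 < p" "p \<le> card charvecs" "\<And>i. n \<le> i \<Longrightarrow> cv D (i + p) = cv D i"
    using boundary_path_periodic[OF fin D(1,2) N] by blast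
  have c: "is_cycle (map (cv D) [Suc n..<Suc (Suc n + p)])"
    "\<rho> = map (cv D) [0..<Suc n] @- cycle (butlast (map (cv D) [Suc n..<Suc (Suc n + p)]))"
    by (rule periodic_path_stream[OF D(1) p(1) _ D(3)], use p(3) in simp)+
  have "?P p"
    \<comment> \<open>\<open>Suc n\<close> instead of \<open>n\<close> makes the preperiod nonempty.\<close>
    by (rule exI[of _ "map (cv D) [0..<Suc n]"], rule exI[of _ "map (cv D) [Suc n..<Suc (Suc n + p)]"])
       (use c in \<open>simp del: upt_Suc\<close>)
  then have P: "?P (min_period_length \<rho>)" and le: "min_period_length \<rho> \<le> p"
    unfolding min_period_length_def by (rule LeastI, rule Least_le)
  then obtain \<gamma> \<theta> where \<theta>: "is_cycle \<theta>" "length \<theta> - 1 = min_period_length \<rho>" "\<rho> = \<gamma> @- cycle (butlast \<theta>)"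
    by blast
  show "0 < min_period_length \<rho>" using stream_cycleD(1)[OF D(3) \<theta>(3,1)] \<theta>(2) by simp
  show "min_period_length \<rho> \<le> card charvecs" using le p(2) by simp
  have "\<forall>i\<ge>length \<gamma>. \<rho> !! (i + min_period_length \<rho>) = \<rho> !! i"
    using stream_cycleD(2)[OF D(3) \<theta>(3,1)] \<theta>(2) D(3) by simp
  then show "\<exists>n. \<forall>i\<ge>n. \<rho> !! (i + min_period_length \<rho>) = \<rho> !! i" by blast
qed

text \<open>The minimal periods are positive and bounded by the number of characteristic vectors, so this is
  the least common multiple of a finite set without 0.\<close>

lemma std_period_length_props:
  assumes fin: "finite charvecs"
  shows "0 < std_period_length"
    and "boundary_point x \<Longrightarrow> symbolic_rep x \<rho> \<Longrightarrow> \<exists>n. \<forall>i\<ge>n. \<rho> !! (i + std_period_length) = \<rho> !! i"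
proof -
  let ?X = "{min_period_length \<rho> |x \<rho>. boundary_point x \<and> symbolic_rep x \<rho>}"
  have "?X \<subseteq> {..card charvecs}" using min_period_length_props(2)[OF fin] by auto
  then have "finite ?X" by (rule finite_subset) simp
  moreover have "0 \<notin> ?X" using min_period_length_props(1)[OF fin] by force
  ultimately have "std_period_length \<noteq> 0" unfolding std_period_length_def by (simp add: Lcm_0_iff)
  then show "0 < std_period_length" by simp
  assume x: "boundary_point x" "symbolic_rep x \<rho>"
  then obtain n where n: "\<forall>i\<ge>n. \<rho> !! (i + min_period_length \<rho>) = \<rho> !! i"
    using min_period_length_props(3)[OF fin] by blast
  have "min_period_length \<rho> \<in> ?X" using x by blast
  then have "min_period_length \<rho> dvd std_period_length" unfolding std_period_length_def by (rule dvd_Lcm)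
  then have "\<rho> !! (i + std_period_length) = \<rho> !! i" if "n \<le> i" for i
    using period_multiple[of n "snth \<rho>" "min_period_length \<rho>"] n that by blast
  then show "\<exists>n. \<forall>i\<ge>n. \<rho> !! (i + std_period_length) = \<rho> !! i" by blast
qed

text \<open>One of the two standard representations of a boundary point: beyond the bound \<open>\<kappa>\<close> for the
  preperiods, the tail is purely periodic, hence also with the common period.\<close>

lemma standard_representation:
  assumes fin: "finite charvecs" and D: "is_path D" "\<And>n. x \<in> Ivl (D n)" and x: "boundary_point x"
    and \<rho>: "\<And>i. \<rho> !! i = cv D i" and \<gamma>: "\<gamma> = map (cv D) [0..<Suc n]"
    and le: "min_preperiod_length \<gamma> \<rho> \<le> \<kappa>"
  shows "\<exists>\<psi> \<phi>. length \<psi> = \<kappa> \<and> is_cycle \<phi> \<and> length \<phi> - 1 = std_period_length \<and>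
    \<rho> = (\<gamma> @ \<psi>) @- cycle (butlast \<phi>)"
proof -
  let ?s = std_period_length and ?n = "Suc n + \<kappa>"
  have rep: "symbolic_rep x \<rho>" using symbolic_rep_iff D \<rho> by blast
  obtain b where b: "\<And>i. b \<le> i \<Longrightarrow> \<rho> !! (i + ?s) = \<rho> !! i"
    using std_period_length_props(2)[OF fin x rep] by blast
  let ?P = "\<lambda>l. \<exists>\<psi> \<theta>. length \<psi> = l \<and> is_cycle \<theta> \<and> \<rho> = (\<gamma> @ \<psi>) @- cycle (butlast \<theta>)"
  have "?P b"
  proof -
    have per: "cv D (i + ?s) = cv D i" if "Suc n + b \<le> i" for i using b[of i] that \<rho> by simp
    have "map (cv D) [0..<Suc n + b] = \<gamma> @ map (cv D) [Suc n..<Suc n + b]"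
      unfolding \<gamma> map_append[symmetric] by (rule arg_cong[of _ _ "map (cv D)"]) (rule upt_add_eq_append, simp)
    moreover have "is_cycle (map (cv D) [Suc n + b..<Suc (Suc n + b + ?s)])"
      "\<rho> = map (cv D) [0..<Suc n + b] @- cycle (butlast (map (cv D) [Suc n + b..<Suc (Suc n + b + ?s)]))"
      by (rule periodic_path_stream[OF D(1) std_period_length_props(1)[OF fin] _ \<rho>], erule per)+
    ultimately show ?thesis
      by (intro exI[of _ "map (cv D) [Suc n..<Suc n + b]"]
          exI[of _ "map (cv D) [Suc n + b..<Suc (Suc n + b + ?s)]"] conjI) (simp_all only:, simp_all)
  qed
  then have "?P (min_preperiod_length \<gamma> \<rho>)" unfolding min_preperiod_length_def by (rule LeastI)
  then obtain \<psi> \<theta> where \<psi>: "length \<psi> = min_preperiod_length \<gamma> \<rho>" "is_cycle \<theta>"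
    "\<rho> = (\<gamma> @ \<psi>) @- cycle (butlast \<theta>)" by blast
  have "cv D (i + (length \<theta> - 1)) = cv D i" if "?n \<le> i" for i
    using stream_cycleD(2)[OF \<rho> \<psi>(3,2), of i] that \<psi>(1) le by (simp add: \<gamma>)
  then have per: "cv D (i + ?s) = cv D i" if "?n \<le> i" for i
    using period_from_earlier[of ?n "cv D" "length \<theta> - 1" b ?s i] stream_cycleD(1)[OF \<rho> \<psi>(3,2)] b \<rho> that by simp
  have c: "is_cycle (map (cv D) [?n..<Suc (?n + ?s)])"
    "\<rho> = map (cv D) [0..<?n] @- cycle (butlast (map (cv D) [?n..<Suc (?n + ?s)]))"
    by (rule periodic_path_stream[OF D(1) std_period_length_props(1)[OF fin] _ \<rho>], erule per)+
  have "map (cv D) [0..<?n] = \<gamma> @ map (cv D) [Suc n..<?n]"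
    unfolding \<gamma> map_append[symmetric] by (rule arg_cong[of _ _ "map (cv D)"]) (rule upt_add_eq_append, simp)
  then show ?thesis
    using c by (intro exI[of _ "map (cv D) [Suc n..<?n]"] exI[of _ "map (cv D) [?n..<Suc (?n + ?s)]"])
      (simp del: upt_Suc)
qed

text \<open>Let \<open>n\<close> be the last generation in which \<open>x\<close> is interior to its net interval. The two paths agree
  up to \<open>n\<close>, and this common part is the symbolic representation \<open>\<gamma>\<close> that the standard
  representations start with.\<close>

lemma standard_periods_exist:
  assumes fin: "finite charvecs" and \<kappa>: "preperiod_bound \<kappa>"
    and D: "is_path D" "\<And>n. x \<in> Ivl (D n)" and E: "is_path E" "\<And>n. x \<in> Ivl (E n)"
    and ne: "D N \<noteq> E N"
  shows "\<exists>\<phi> \<phi>'. standard_periods \<kappa> x \<phi> \<phi>'"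
proof -
  note adj = adjacent_net_intervals[OF path_net[OF D(1)] path_net[OF E(1)] ne D(2) E(2)]
  have x: "boundary_point x"
    unfolding boundary_point_def using adj path_net[OF D(1), of N] by blast
  have "x \<in> net_points N" using adj path_net[OF D(1), of N] by (auto simp: net_interval_iff)
  then have xN: "x \<in> net_points m" if "N \<le> m" for m using net_points_mono[OF that] by blast
  have x01: "x \<in> {fst (D 0)<..<snd (D 0)}"
    using adj net_interval_less[OF path_net[OF D(1), of N]] net_interval_less[OF path_net[OF E(1), of N]]
      net_interval_unit[OF path_net[OF D(1), of N]] net_interval_unit[OF path_net[OF E(1), of N]] D(1)
    by (auto simp: is_path_def)
  define J where "J = {m. x \<in> {fst (D m)<..<snd (D m)}}"
  have JN: "m < N" if "m \<in> J" for m
  proof (rule ccontr)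
    assume "\<not> m < N"
    then show False
      using net_interval_no_point[OF path_net[OF D(1), of m] xN[of m]] that by (auto simp: J_def)
  qed
  then have "J \<subseteq> {..<N}" by blast
  then have finJ: "finite J" "0 \<in> J" using x01 by (auto simp: J_def dest: finite_subset)
  define n where "n = Max J"
  have n: "n \<in> J" unfolding n_def using finJ by (intro Max_in) auto
  have nmax: "x \<in> net_points m" if "n < m" for m
  proof -
    have "m \<notin> J" using Max_ge[OF finJ(1), of m] that by (auto simp: n_def)
    then have "x = fst (D m) \<or> x = snd (D m)" using D(2)[of m] by (auto simp: J_def)
    then show ?thesis using path_net[OF D(1), of m] by (auto simp: net_interval_iff)
  qed
  have DE: "D n = E n"
    using adjacent_net_intervals[OF path_net[OF D(1)] path_net[OF E(1)] _ D(2) E(2), of n] n by (auto simp: J_def)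
  define \<gamma> where "\<gamma> = map (cv D) [0..<Suc n]"
  have \<gamma>E: "\<gamma> = map (cv E) [0..<Suc n]"
    unfolding \<gamma>_def using path_ancestors_eq[OF D(1) E(1) DE] by (intro map_cong) auto
  have int: "interior_rep x \<gamma>"
    unfolding interior_rep_def
  proof (intro exI[of _ n] bexI[of _ "D n"] conjI allI impI ballI)
    show "x \<in> {fst (D n)<..<snd (D n)}" using n by (simp add: J_def)
    show "x \<notin> {fst \<Delta>'<..<snd \<Delta>'}" if "n < m" "\<Delta>' \<in> net_intervals m" for m \<Delta>'
      using net_interval_no_point[OF that(2) nmax[OF that(1)]] by auto
    show "ivl_symbolic_rep n (D n) \<gamma>"
      unfolding ivl_symbolic_rep_def \<gamma>_def using D(1) by (intro exI[of _ D]) (simp add: is_path_def)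
  qed (rule path_net[OF D(1)])
  define \<rho> where "\<rho> = smap (cv D) nats"
  define \<rho>' where "\<rho>' = smap (cv E) nats"
  have \<rho>: "\<And>i. \<rho> !! i = cv D i" "\<And>i. \<rho>' !! i = cv E i" by (simp_all add: \<rho>_def \<rho>'_def)
  have rep: "symbolic_rep x \<rho>" "symbolic_rep x \<rho>'" using symbolic_rep_iff D E \<rho> by blast+
  have neq: "\<rho> \<noteq> \<rho>'" using path_determined[OF D(1) E(1), of N] \<rho> ne by metis
  have "min_preperiod_length \<gamma> \<rho> \<le> \<kappa>" "min_preperiod_length \<gamma> \<rho>' \<le> \<kappa>"
    using \<kappa> x rep neq int unfolding preperiod_bound_def by metis+
  then obtain \<psi> \<phi> \<psi>' \<phi>' where
    "length \<psi> = \<kappa>" "is_cycle \<phi>" "length \<phi> - 1 = std_period_length" "\<rho> = (\<gamma> @ \<psi>) @- cycle (butlast \<phi>)"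
    "length \<psi>' = \<kappa>" "is_cycle \<phi>'" "length \<phi>' - 1 = std_period_length" "\<rho>' = (\<gamma> @ \<psi>') @- cycle (butlast \<phi>')"
    using standard_representation[OF fin D x \<rho>(1) \<gamma>_def] standard_representation[OF fin E x \<rho>(2) \<gamma>E] by metis
  then have "standard_periods \<kappa> x \<phi> \<phi>'"
    unfolding standard_periods_def using x int rep neq by metis
  then show ?thesis by blast
qed

end

section \<open>The local dimension\<close>

context self_similar_measure
begin

text \<open>Finitely many closed intervals avoid \<open>x\<close>, so a small ball avoids all of them; the rest of \<open>K\<close>
  near \<open>x\<close> lies in the net intervals that contain \<open>x\<close>, up to net points.\<close>

lemma mu_near_x:
  "\<exists>e>0. \<forall>t<e. measure \<mu> {x - t..x + t} \<le>
     measure \<mu> ({x - t..x + t} \<inter> \<Union> (Ivl ` {\<Delta> \<in> net_intervals n. x \<in> Ivl \<Delta>}))"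
proof -
  let ?N = "{\<Delta> \<in> net_intervals n. x \<in> Ivl \<Delta>}"
  let ?F = "\<Union> (Ivl ` {\<Delta> \<in> net_intervals n. x \<notin> Ivl \<Delta>})"
  have "closed ?F" using finite_net_intervals by (intro closed_Union) auto
  then have "open (- ?F)" by (rule open_Compl)
  moreover have "x \<in> - ?F" by blast
  ultimately obtain e where e: "0 < e" "ball x e \<subseteq> - ?F" using openE by blast
  have "measure \<mu> {x - t..x + t} \<le> measure \<mu> ({x - t..x + t} \<inter> \<Union> (Ivl ` ?N))" if t: "t < e" for t
  proof (rule mu_le_mod_finite[OF _ finite_net_points])
    show "{x - t..x + t} \<inter> K \<subseteq> {x - t..x + t} \<inter> \<Union> (Ivl ` ?N) \<union> net_points n"
    proof
      fix y assume y: "y \<in> {x - t..x + t} \<inter> K"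
      show "y \<in> {x - t..x + t} \<inter> \<Union> (Ivl ` ?N) \<union> net_points n"
      proof (cases "y \<in> net_points n")
        case False
        have "y \<in> {0..1}" using y K_subset by blast
        then obtain a b where ab: "a \<in> net_points n" "b \<in> net_points n" "a < y" "y < b" "{a<..<b} \<inter> net_points n = {}"
          using net_cell[OF _ False] by blast
        then have net: "(a, b) \<in> net_intervals n" using y by (auto simp: net_interval_iff)
        have yab: "y \<in> Ivl (a, b)" using ab by simp
        have "y \<in> ball x e" using y t by (auto simp: dist_real_def)
        then have "y \<notin> ?F" using e(2) by blast
        then have "x \<in> Ivl (a, b)" using net yab by blast
        then have "y \<in> \<Union> (Ivl ` ?N)" using net yab by blast
        then show ?thesis using y by blast
      qed simp
    qed
    have "finite ?N" using finite_net_intervals by simp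
    then show "{x - t..x + t} \<inter> \<Union> (Ivl ` ?N) \<in> sets borel" by (intro sets.Int sets.finite_Union) auto
  qed simp
  then show ?thesis using e(1) by blast
qed

text \<open>For radii of order \<open>r_min ^ (m * s)\<close> a ball around \<open>x\<close> contains \<open>D (n0 + m * s)\<close> and its mass is at most
  that of \<open>D (n0 + m * s)\<close> and \<open>E (n0 + m * s)\<close> together; of the two growth rates the larger one, that of
  \<open>D\<close>, prevails. The case \<open>E = D\<close> is that of a point interior to its net intervals, or with no mass on the
  other side.\<close>

lemma local_dim_two_paths:
  assumes D: "is_path D" "\<And>n. x \<in> Ivl (D n)" and E: "is_path E" "\<And>n. x \<in> Ivl (E n)"
    and s: "0 < s"
    and perD: "\<And>i. n0 \<le> i \<Longrightarrow> cv D (i + s) = cv D i"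
    and perE: "\<And>i. n0 \<le> i \<Longrightarrow> cv E (i + s) = cv E i"
    and TD: "TD = path_mat (map (cv D) [n0..<Suc (n0 + s)])"
    and TE: "TE = path_mat (map (cv E) [n0..<Suc (n0 + s)])"
    and le: "sp TE \<le> sp TD"
    and n: "n0 \<le> n" and cover: "\<And>\<Delta>. \<Delta> \<in> net_intervals n \<Longrightarrow> x \<in> Ivl \<Delta> \<Longrightarrow> \<Delta> = D n \<or> \<Delta> = E n"
  shows "has_local_dim \<mu> x (ln (sp TD) / (real s * ln r_min))"
proof -
  define q where "q = r_min ^ s"
  define g where "g t = measure \<mu> {x - t..x + t}" for t
  obtain bD where bD: "0 < bD"
    "\<And>m t. t \<le> bD * q ^ m \<Longrightarrow> {x - t..x + t} \<inter> Ivl (D n0) \<subseteq> Ivl (D (n0 + m * s))"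
    using periodic_path_near[OF D perD] unfolding q_def by blast
  obtain bE where bE: "0 < bE"
    "\<And>m t. t \<le> bE * q ^ m \<Longrightarrow> {x - t..x + t} \<inter> Ivl (E n0) \<subseteq> Ivl (E (n0 + m * s))"
    using periodic_path_near[OF E perE] unfolding q_def by blast
  obtain e where e: "0 < e" "\<And>t. t < e \<Longrightarrow> g t \<le>
     measure \<mu> ({x - t..x + t} \<inter> \<Union> (Ivl ` {\<Delta> \<in> net_intervals n. x \<in> Ivl \<Delta>}))"
    using mu_near_x[of x n] unfolding g_def by blast
  obtain c where c: "0 < c" "\<And>m. c * sp TD ^ m \<le> measure \<mu> (Ivl (D (n0 + m * s)))"
    using periodic_path_growth(2)[OF D(1) s perD TD] by blast
  have pos: "0 < sp TD" by (rule periodic_path_growth(1)[OF D(1) s perD TD])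
  have q: "0 < q" "q < 1" using r_min_pos r_min_less_1 s by (simp_all add: q_def power_less_one_iff)
  have "((\<lambda>t. ln (g t) / ln t) \<longlongrightarrow> ln (sp TD) / ln q) (at_right 0)"
  proof (rule log_ratio_limit[where a = 1 and b = "min bD bE" and c = c and e = e])
    show "0 < q" "q < 1" "0 < sp TD" "0 < c" "0 < e" "0 < (1 :: real)" "0 < min bD bE"
      using q pos c(1) e(1) bD(1) bE(1) by simp_all
    show "g u \<le> g v" if "0 < u" "u \<le> v" for u v
      unfolding g_def using that by (intro mu_mono) auto
    show "c * sp TD ^ m \<le> g (1 * q ^ m)" for m
    proof -
      have "r_min ^ (n0 + m * s) \<le> r_min ^ (m * s)"
        using r_min_pos r_min_less_1 by (intro power_decreasing) auto
      also have "\<dots> = q ^ m" by (simp add: q_def power_mult[symmetric] mult.commute)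
      finally have "snd (D (n0 + m * s)) - fst (D (n0 + m * s)) \<le> q ^ m"
        using net_interval_length[OF path_net[OF D(1), of "n0 + m * s"]] by linarith
      then have "Ivl (D (n0 + m * s)) \<subseteq> {x - 1 * q ^ m..x + 1 * q ^ m}"
        using D(2)[of "n0 + m * s"] by auto
      then have "measure \<mu> (Ivl (D (n0 + m * s))) \<le> g (1 * q ^ m)" unfolding g_def by (rule mu_mono) simp
      then show ?thesis using c(2)[of m] by linarith
    qed
    show "\<exists>C>0. \<forall>m. min bD bE * q ^ m < e \<longrightarrow> g (min bD bE * q ^ m) \<le> C * \<rho> ^ m" if \<rho>: "sp TD < \<rho>" for \<rho>
    proof -
      obtain CD where CD: "0 < CD" "\<And>m. measure \<mu> (Ivl (D (n0 + m * s))) \<le> CD * \<rho> ^ m"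
        using periodic_path_growth(3)[OF D(1) s perD TD \<rho>] by blast
      obtain CE where CE: "0 < CE" "\<And>m. measure \<mu> (Ivl (E (n0 + m * s))) \<le> CE * \<rho> ^ m"
        using periodic_path_growth(3)[OF E(1) s perE TE order_le_less_trans[OF le \<rho>]] by blast
      have "g (min bD bE * q ^ m) \<le> (CD + CE) * \<rho> ^ m" if m: "min bD bE * q ^ m < e" for m
      proof -
        let ?t = "min bD bE * q ^ m"
        let ?B = "{x - ?t..x + ?t}"
        have t: "?t \<le> bD * q ^ m" "?t \<le> bE * q ^ m" using q(1) by (auto intro!: mult_right_mono)
        have "?B \<inter> \<Union> (Ivl ` {\<Delta> \<in> net_intervals n. x \<in> Ivl \<Delta>}) \<subseteq> ?B \<inter> (Ivl (D n) \<union> Ivl (E n))"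
          using cover by blast
        also have "\<dots> \<subseteq> ?B \<inter> (Ivl (D n0) \<union> Ivl (E n0))"
          using path_nested[OF D(1) n] path_nested[OF E(1) n] by fastforce
        also have "\<dots> \<subseteq> Ivl (D (n0 + m * s)) \<union> Ivl (E (n0 + m * s))"
          using bD(2)[OF t(1)] bE(2)[OF t(2)] by blast
        finally have sub: "?B \<inter> \<Union> (Ivl ` {\<Delta> \<in> net_intervals n. x \<in> Ivl \<Delta>}) \<subseteq>
          Ivl (D (n0 + m * s)) \<union> Ivl (E (n0 + m * s))" .
        have "g ?t \<le> measure \<mu> (Ivl (D (n0 + m * s)) \<union> Ivl (E (n0 + m * s)))"
          using e(2)[OF m] mu_mono[OF sub] by simp
        also have "\<dots> \<le> measure \<mu> (Ivl (D (n0 + m * s))) + measure \<mu> (Ivl (E (n0 + m * s)))"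
          by (intro measure_Un_le) (simp_all add: mu_borel)
        also have "\<dots> \<le> (CD + CE) * \<rho> ^ m" using CD(2)[of m] CE(2)[of m] by (simp add: distrib_right)
        finally show ?thesis .
      qed
      then show ?thesis using CD(1) CE(1) by (intro exI[of _ "CD + CE"]) simp
    qed
  qed
  moreover have "ln q = real s * ln r_min" unfolding q_def by (rule ln_realpow)
  ultimately show ?thesis unfolding has_local_dim_def g_def by simp
qed

text \<open>If \<open>x\<close> has a second net interval next to \<open>D n\<close> in every late generation, then these intervals
  form a second path.\<close>

lemma second_path:
  assumes D: "is_path D" "\<And>n. x \<in> Ivl (D n)"
    and other: "\<And>n. n0 \<le> n \<Longrightarrow> \<exists>\<Delta>\<in>net_intervals n. x \<in> Ivl \<Delta> \<and> \<Delta> \<noteq> D n"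
  shows "\<exists>E. is_path E \<and> (\<forall>n. x \<in> Ivl (E n)) \<and> D n0 \<noteq> E n0"
proof -
  obtain F where F: "\<And>n. n0 \<le> n \<Longrightarrow> F n \<in> net_intervals n" "\<And>n. n0 \<le> n \<Longrightarrow> x \<in> Ivl (F n)"
    "\<And>n. n0 \<le> n \<Longrightarrow> F n \<noteq> D n" using other by metis
  obtain G where G: "G 0 = (0, 1)" "G n0 = F n0" "\<And>i. i < n0 \<Longrightarrow> G (Suc i) \<in> children i (G i)"
    using ancestors_exist[OF F(1)[OF order_refl]] by blast
  define E where "E n = (if n \<le> n0 then G n else F n)" for n
  have EF: "E n = F n" if "n0 \<le> n" for n using that G(2) by (auto simp: E_def)
  have adj: "snd (F n) = x \<and> fst (D n) = x \<or> fst (F n) = x \<and> snd (D n) = x" if "n0 \<le> n" for n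
    by (rule adjacent_net_intervals[OF F(1)[OF that] path_net[OF D(1)] F(3)[OF that] F(2)[OF that] D(2)])
  have child: "F (Suc n) \<in> children n (F n)" if n: "n0 \<le> n" for n
  proof -
    have n': "n0 \<le> Suc n" using n by simp
    have less: "fst (F n) < snd (F n)" "fst (F (Suc n)) < snd (F (Suc n))" "fst (D (Suc n)) < snd (D (Suc n))"
      using net_interval_less[OF F(1)[OF n]] net_interval_less[OF F(1)[OF n']]
        net_interval_less[OF path_net[OF D(1), of "Suc n"]] by blast+
    have "fst (F (Suc n)) < snd (F n) \<and> fst (F n) < snd (F (Suc n))"
      using adj[OF n] adj[OF n'] less path_end_stays[OF D, of n "Suc n"] by auto
    then show ?thesis
      using net_interval_nested[OF F(1)[OF n'] F(1)[OF n]] by (intro childrenI F(1)[OF n']) auto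
  qed
  have E: "is_path E"
    unfolding is_path_def
  proof (intro conjI allI)
    show "E 0 = (0, 1)" by (simp add: E_def G(1))
    show "E (Suc n) \<in> children n (E n)" for n
    proof (cases "n < n0")
      case True
      then show ?thesis using G(3)[OF True] by (simp add: E_def)
    next
      case False
      then show ?thesis using EF[of n] EF[of "Suc n"] child[of n] by simp
    qed
  qed
  moreover have "x \<in> Ivl (E n)" for n
  proof (cases "n0 \<le> n")
    case True
    then show ?thesis using F(2) EF by simp
  next
    case False
    then show ?thesis using path_nested[OF E, of n n0] F(2)[OF order_refl] EF[OF order_refl] by auto
  qed
  ultimately show ?thesis using F(3)[OF order_refl] EF[OF order_refl] by metis
qed

text \<open>If there are no standard representations, then some late generation has only one net interval
  containing \<open>x\<close>: otherwise the second ones would form a path, and the two paths would have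
  standard representations.\<close>

lemma local_dim_periodic_point:
  assumes fin: finite_type and \<kappa>: "preperiod_bound \<kappa>" and period: "has_period x \<theta>"
    and std: "(\<exists>\<phi> \<phi>'. standard_periods \<kappa> x \<phi> \<phi>') \<Longrightarrow>
      \<exists>\<theta>'. standard_periods \<kappa> x \<theta> \<theta>' \<and> sp (path_mat \<theta>) \<ge> sp (path_mat \<theta>')"
  shows "has_local_dim \<mu> x (ln (sp (path_mat \<theta>)) / (real (length \<theta> - 1) * ln r_min))"
proof (cases "\<exists>\<phi> \<phi>'. standard_periods \<kappa> x \<phi> \<phi>'")
  case True
  then obtain \<theta>' where \<theta>': "standard_periods \<kappa> x \<theta> \<theta>'" "sp (path_mat \<theta>') \<le> sp (path_mat \<theta>)"
    using std by blast
  then obtain \<gamma> \<psi> \<psi>' where cyc: "is_cycle \<theta>" "is_cycle \<theta>'" and len: "length \<theta>' - 1 = length \<theta> - 1"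
    "length \<psi>' = length \<psi>"
    and rep: "symbolic_rep x ((\<gamma> @ \<psi>) @- cycle (butlast \<theta>))" "symbolic_rep x ((\<gamma> @ \<psi>') @- cycle (butlast \<theta>'))"
    and ne: "(\<gamma> @ \<psi>) @- cycle (butlast \<theta>) \<noteq> (\<gamma> @ \<psi>') @- cycle (butlast \<theta>')"
    unfolding standard_periods_def by metis
  obtain D where D: "is_path D" "\<And>n. x \<in> Ivl (D n)" "\<And>i. ((\<gamma> @ \<psi>) @- cycle (butlast \<theta>)) !! i = cv D i"
    using rep(1) symbolic_rep_iff by blast
  obtain E where E: "is_path E" "\<And>n. x \<in> Ivl (E n)" "\<And>i. ((\<gamma> @ \<psi>') @- cycle (butlast \<theta>')) !! i = cv E i"
    using rep(2) symbolic_rep_iff by blast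
  define n0 where "n0 = length (\<gamma> @ \<psi>)"
  have n0': "n0 = length (\<gamma> @ \<psi>')" using len(2) by (simp add: n0_def)
  obtain N where "D N \<noteq> E N" using ne D(3) E(3) stream_eqI by metis
  then have neq: "D (max N n0) \<noteq> E (max N n0)" using path_ancestors_eq[OF D(1) E(1)] max.cobounded1 by metis
  show ?thesis
  proof (rule local_dim_two_paths[OF D(1,2) E(1,2), where n = "max N n0"])
    show "0 < length \<theta> - 1" by (rule stream_cycleD(1)[OF D(3) refl cyc(1)])
    show "cv D (i + (length \<theta> - 1)) = cv D i" if "n0 \<le> i" for i
      using stream_cycleD(2)[OF D(3) refl cyc(1)] that by (simp only: n0_def)
    show "cv E (i + (length \<theta> - 1)) = cv E i" if "n0 \<le> i" for i
      using stream_cycleD(2)[OF E(3) refl cyc(2)] that by (simp only: n0' len(1))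
    show "path_mat \<theta> = path_mat (map (cv D) [n0..<Suc (n0 + (length \<theta> - 1))])"
      using stream_cycleD(3)[OF D(3) refl cyc(1)] by (simp only: n0_def)
    show "path_mat \<theta>' = path_mat (map (cv E) [n0..<Suc (n0 + (length \<theta> - 1))])"
      using stream_cycleD(3)[OF E(3) refl cyc(2)] unfolding n0' len(1) by (rule arg_cong)
    show "\<Delta> = D (max N n0) \<or> \<Delta> = E (max N n0)" if \<Delta>: "\<Delta> \<in> net_intervals (max N n0)" "x \<in> Ivl \<Delta>" for \<Delta>
    proof -
      let ?n = "max N n0"
      note net = path_net[OF D(1), of ?n] path_net[OF E(1), of ?n]
      show ?thesis
        using adjacent_net_intervals[OF net neq D(2) E(2)]
          adjacent_net_intervals[OF \<Delta>(1) net(1) _ \<Delta>(2) D(2)] adjacent_net_intervals[OF \<Delta>(1) net(2) _ \<Delta>(2) E(2)]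
          net_interval_less[OF net(1)] net_interval_less[OF net(2)] net_interval_less[OF \<Delta>(1)] by force
    qed
  qed (use \<theta>'(2) in simp_all)
next
  case False
  obtain \<gamma> where \<gamma>: "is_cycle \<theta>" "symbolic_rep x (\<gamma> @- cycle (butlast \<theta>))"
    using period unfolding has_period_def by blast
  obtain D where D: "is_path D" "\<And>n. x \<in> Ivl (D n)" "\<And>i. (\<gamma> @- cycle (butlast \<theta>)) !! i = cv D i"
    using \<gamma>(2) symbolic_rep_iff by blast
  let ?n0 = "length \<gamma>"
  have "\<exists>n\<ge>?n0. \<forall>\<Delta>\<in>net_intervals n. x \<in> Ivl \<Delta> \<longrightarrow> \<Delta> = D n"
  proof (rule ccontr)
    assume "\<not> ?thesis"
    then obtain E where "is_path E" "\<And>n. x \<in> Ivl (E n)" "D ?n0 \<noteq> E ?n0"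
      using second_path[OF D(1,2), of ?n0] by blast
    then show False using standard_periods_exist[OF finite_charvecs[OF fin] \<kappa> D(1,2)] False by blast
  qed
  then obtain n where n: "?n0 \<le> n" "\<And>\<Delta>. \<Delta> \<in> net_intervals n \<Longrightarrow> x \<in> Ivl \<Delta> \<Longrightarrow> \<Delta> = D n" by blast
  note cyc = stream_cycleD[OF D(3) refl \<gamma>(1)]
  show ?thesis
  proof (rule local_dim_two_paths[OF D(1,2) D(1,2) cyc(1)])
    show eq: "path_mat \<theta> = path_mat (map (cv D) [?n0..<Suc (?n0 + (length \<theta> - 1))])"
      using cyc(3) by (rule arg_cong)
    show "path_mat \<theta> = path_mat (map (cv D) [?n0..<Suc (?n0 + (length \<theta> - 1))])" by (rule eq)
    show per: "cv D (i + (length \<theta> - 1)) = cv D i" if "?n0 \<le> i" for i using that by (rule cyc(2))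
    show "cv D (i + (length \<theta> - 1)) = cv D i" if "?n0 \<le> i" for i using that by (rule cyc(2))
    show "?n0 \<le> n" by (rule n(1))
    show "\<Delta> = D n \<or> \<Delta> = D n" if "\<Delta> \<in> net_intervals n" "x \<in> Ivl \<Delta>" for \<Delta> using n(2)[OF that] by simp
  qed simp
qed

end

theorem proposition3p6:
  fixes k :: nat and r d p :: "nat \<Rightarrow> real" and K :: "real set" and \<mu> :: "real measure"
    and \<kappa> :: nat and x :: real and \<theta> :: "char_vec list"
  assumes "self_similar_measure k r d K p \<mu>"
    and "ifs.finite_type k r d"
    and "ifs.preperiod_bound k r d K \<kappa>"
    and "ifs.has_period k r d K x \<theta>"
    and "(\<exists>\<phi> \<phi>'. ifs.standard_periods k r d K \<kappa> x \<phi> \<phi>') \<Longrightarrow>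
      \<exists>\<theta>'. ifs.standard_periods k r d K \<kappa> x \<theta> \<theta>' \<and>
        sp (self_similar_measure.path_mat k r d K p \<theta>) \<ge>
        sp (self_similar_measure.path_mat k r d K p \<theta>')"
  shows "has_local_dim \<mu> x
    (ln (sp (self_similar_measure.path_mat k r d K p \<theta>)) /
      (real (length \<theta> - 1) * ln (ifs.r_min k r)))"
  by (rule self_similar_measure.local_dim_periodic_point[OF assms])

end
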